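(* Let $k\ge3$ be an integer. Let $\kappa$ be a $C^\infty$ function germ at $0\in\mathbb{R}$, let $\theta(t)=\int_0^t\kappa(u)\,du$ with Taylor expansion $\sum_{i\ge1}\theta_i t^i/i!$, let $\boldsymbol t=(\cos\theta,\sin\theta)$, $\boldsymbol n=(-\sin\theta,\cos\theta)$, and let $\phi_3(t)=\int_0^t \frac{u^2}{2}\,\boldsymbol t(u)\,du$. For a nonzero constant $\delta$ let $\phi_3^\delta(t)=\phi_3(t)+\delta\,\boldsymbol n(t)$ be its parallel curve. Assume that $\phi_3$ has an $E_{6k}$ (resp. $E_{6k+2}$) singularity at $0$. (1) Assume $\delta\ne\theta_3^{-1}$. Then $\phi_3^\delta$ has an $E_{6k}$ (resp. $E_{6k+2}$) singularity at $0$. More precisely, suppose $\phi_3$ is $\mathcal A$-equivalent at $0$ to $$(t^3,t^{3k+1}+\varepsilon_p t^{3(k+p)+2})\quad(\text{resp. }(t^3,t^{3k+2}+\varepsilon_{p+1}t^{3(k+p)+4}))$$ for some $p$ with $0\le p\le k-2$. - If $0\le p<k-2$, then $\phi_3^\delta$ is $\mathcal A$-equivalent to $\phi_3$ at $0$. - If $p=k-2$, then $\phi_3^\delta$ degenerates to $(t^3,t^{3k+1})$ (resp. $(t^3,t^{3k+2})$), i.e. is $\mathcal A$-equivalent to it at $0$, if and only if $\delta^{-1}$ satisfies $$\frac1{\delta^{-1}-\theta_3}\,\frac{2\theta_{3l_1+1}^2}{(3l_1)!\,(3l_1+1)!}+\frac{\theta_{3l_2+2}}{(3l_2+2)!}=0\quad\Bigl(\text{resp.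 }\ \frac{\theta_{3l_1+1}}{(3l_1+1)!}+\frac1{\delta^{-1}-\theta_3}\,\frac{2\theta_{3l_2+2}^2}{(3l_2+1)!\,(3l_2+2)!}=0\Bigr),$$ where $(l_1,l_2)=(k-1,k+p-1)$ (resp. $(l_1,l_2)=(k+p,k-1)$). (2) If $\delta^{-1}=\theta_3$, then $\phi_3^\delta$ is of multiplicity $\ge5$ at $0$. In particular, $\phi_3^\delta$ is not $\mathcal A$-simple.
   Context: Two $C^\infty$ map germs $f,g:(\mathbb{R},0)\to(\mathbb{R}^2,0)$ are $\mathcal A$-equivalent if there are diffeomorphism germs $h$ of $(\mathbb{R},0)$ and $\psi$ of $(\mathbb{R}^2,0)$ with $f\circ h=\psi\circ g$. Parallel curves are regarded as germs at $0$ after translating $\phi_3^\delta(0)$ to the origin. The condition $\delta=\theta_3^{-1}$ means $\delta\theta_3=1$ (so if $\theta_3=0$, then $\delta\ne\theta_3^{-1}$ for every $\delta$). Convention: $\varepsilon_p=1$ if $p$ is even, and $\varepsilon_p\in\{1,-1\}$ if $p$ is odd. A germ has an $E_{6k}$ singularity at $0$ if it is $\mathcal A$-equivalent to $(t^3,t^{3k+1}+\varepsilon_p t^{3(k+p)+2})$ for some $0\le p\le k-2$, or to $(t^3,t^{3k+1})$; it has an $E_{6k+2}$ singularity at $0$ if it is $\mathcal A$-equivalent to $(t^3,t^{3k+2}+\varepsilon_{p+1}t^{3(k+p)+4})$ for some $0\le p\le k-2$, or to $(t^3,t^{3k+2})$. A germ has multiplicity $m$ at $0$ if it equals $\frac{t^m}{m!}\hat\phi(t)$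 with $\hat\phi$ a $C^\infty$ map to $\mathbb{R}^2$, $\hat\phi(0)\ne0$. A germ $\phi:(\mathbb{R},0)\to(\mathbb{R}^2,0)$ is $\mathcal A$-simple if it is an irreducible parametrization and for any finite-parameter deformation $\{\phi^u\}_{u\in(\mathbb{R}^r,0)}$, $\phi^0=\phi$, the point $0\in\mathbb{R}^r$ is not in the closure of a set of parameters $u$ for which the $\phi^u$ are all $\mathcal A$-distinct (moduli). By the classification of Bruce and Gaffney, the singular $\mathcal A$-simple germs are, up to $\mathcal A$-equivalence: $(t^2,t^{2k+1})$ ($k\ge1$); the germs of type $E_{6k}$ and $E_{6k+2}$ above ($k\ge1$); $(t^4,t^5\pm t^7)$, $(t^4,t^5)$; $(t^4,t^6+t^{2q+5})$, $q\ge1$; $(t^4,t^7\pm t^9)$, $(t^4,t^7\pm t^{13})$, $(t^4,t^7)$. *)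

theory Defs
  imports "HOL-Analysis.Analysis"
begin

section \<open>Smooth germs and \<open>\<A>\<close>-equivalence\<close>

text \<open>
  A germ is represented by a total function; only its values near the base point matter, so
  equality of germs is equality on a neighbourhood of the base point.
\<close>

text \<open>On open sets, \<open>C_on n S f\<close> says that \<open>f\<close> is of class \<open>C\<close> to the \<open>n\<close>, by recursion on the
  directional derivatives.\<close>

primrec C_on :: "nat \<Rightarrow> 'a::real_normed_vector set \<Rightarrow> ('a \<Rightarrow> 'b::real_normed_vector) \<Rightarrow> bool" where
  "C_on 0 S f \<longleftrightarrow> continuous_on S f"
| "C_on (Suc n) S f \<longleftrightarrow>
     (\<forall>x\<in>S. f differentiable (at x)) \<and> (\<forall>v. C_on n S (\<lambda>x. frechet_derivative f (at x) v))"

definition smooth_at :: "('a::real_normed_vector \<Rightarrow> 'b::real_normed_vector) \<Rightarrow> 'a \<Rightarrow> bool" where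
  "smooth_at f a \<longleftrightarrow> (\<exists>U. open U \<and> a \<in> U \<and> (\<forall>n. C_on n U f))"

definition smooth_germ :: "('a::real_normed_vector \<Rightarrow> 'b::real_normed_vector) \<Rightarrow> bool" where
  "smooth_germ f \<longleftrightarrow> smooth_at f 0 \<and> f 0 = 0"

definition diffeo_germ :: "('a::real_normed_vector \<Rightarrow> 'a) \<Rightarrow> bool" where
  "diffeo_germ h \<longleftrightarrow> smooth_germ h \<and>
     (\<exists>g. smooth_germ g \<and> (\<forall>\<^sub>F x in nhds 0. g (h x) = x) \<and> (\<forall>\<^sub>F y in nhds 0. h (g y) = y))"

definition A_equiv :: "(real \<Rightarrow> real \<times> real) \<Rightarrow> (real \<Rightarrow> real \<times> real) \<Rightarrow> bool" where
  "A_equiv f g \<longleftrightarrow>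
     (\<exists>h \<psi>. diffeo_germ h \<and> diffeo_germ \<psi> \<and> (\<forall>\<^sub>F t in nhds 0. f (h t) = \<psi> (g t)))"

definition has_multiplicity :: "(real \<Rightarrow> real \<times> real) \<Rightarrow> nat \<Rightarrow> bool" where
  "has_multiplicity f m \<longleftrightarrow>
     (\<exists>g. smooth_at g 0 \<and> g 0 \<noteq> 0 \<and> (\<forall>\<^sub>F t in nhds 0. f t = (t ^ m / fact m) *\<^sub>R g t))"


section \<open>The singularities \<open>E\<^bsub>6k\<^esub>\<close> and \<open>E\<^bsub>6k+2\<^esub>\<close>\<close>

definition admissible_sign :: "nat \<Rightarrow> real \<Rightarrow> bool" where
  "admissible_sign p \<epsilon> \<longleftrightarrow> (if even p then \<epsilon> = 1 else \<epsilon> = 1 \<or> \<epsilon> = -1)"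

definition E6k_form :: "nat \<Rightarrow> nat \<Rightarrow> real \<Rightarrow> real \<Rightarrow> real \<times> real" where
  "E6k_form k p \<epsilon> t = (t ^ 3, t ^ (3 * k + 1) + \<epsilon> * t ^ (3 * (k + p) + 2))"

definition E6k_last_form :: "nat \<Rightarrow> real \<Rightarrow> real \<times> real" where
  "E6k_last_form k t = (t ^ 3, t ^ (3 * k + 1))"

definition E6k2_form :: "nat \<Rightarrow> nat \<Rightarrow> real \<Rightarrow> real \<Rightarrow> real \<times> real" where
  "E6k2_form k p \<epsilon> t = (t ^ 3, t ^ (3 * k + 2) + \<epsilon> * t ^ (3 * (k + p) + 4))"

definition E6k2_last_form :: "nat \<Rightarrow> real \<Rightarrow> real \<times> real" where
  "E6k2_last_form k t = (t ^ 3, t ^ (3 * k + 2))"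

text \<open>The bound \<open>p \<le> k - 2\<close> is an inequality of integers, hence written \<open>p + 2 \<le> k\<close>.\<close>

definition has_E6k :: "nat \<Rightarrow> (real \<Rightarrow> real \<times> real) \<Rightarrow> bool" where
  "has_E6k k f \<longleftrightarrow>
     (\<exists>p \<epsilon>. p + 2 \<le> k \<and> admissible_sign p \<epsilon> \<and> A_equiv f (E6k_form k p \<epsilon>))
     \<or> A_equiv f (E6k_last_form k)"

definition has_E6k2 :: "nat \<Rightarrow> (real \<Rightarrow> real \<times> real) \<Rightarrow> bool" where
  "has_E6k2 k f \<longleftrightarrow>
     (\<exists>p \<epsilon>. p + 2 \<le> k \<and> admissible_sign (p + 1) \<epsilon> \<and> A_equiv f (E6k2_form k p \<epsilon>))
     \<or> A_equiv f (E6k2_last_form k)"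


section \<open>\<open>\<A>\<close>-simple germs\<close>

text \<open>A parametrization is irreducible if it does not factor through a source map germ that is
  not invertible, such as a power \<open>t \<mapsto> t ^ d\<close> with \<open>d \<ge> 2\<close>.\<close>

definition irreducible_param :: "(real \<Rightarrow> real \<times> real) \<Rightarrow> bool" where
  "irreducible_param \<phi> \<longleftrightarrow>
     (\<forall>\<psi> h. smooth_germ \<psi> \<and> smooth_germ h \<and> (\<forall>\<^sub>F t in nhds 0. \<phi> t = \<psi> (h t)) \<longrightarrow> diffeo_germ h)"

text \<open>
  The number \<open>r\<close> of parameters of a deformation has to be quantified, so the parameter space
  is \<^term>\<open>Euclidean_space r\<close>, which consists of the \<^typ>\<open>nat \<Rightarrow> real\<close> vanishing from index \<open>r\<close> on.
  This is not a normed type; smoothness in \<open>(u, t)\<close> is existence and continuity of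
  all iterated partial derivatives.
\<close>

primrec C_family :: "nat \<Rightarrow> nat \<Rightarrow> ((nat \<Rightarrow> real) \<times> real) set \<Rightarrow>
    ((nat \<Rightarrow> real) \<Rightarrow> real \<Rightarrow> real \<times> real) \<Rightarrow> bool" where
  "C_family 0 r W F \<longleftrightarrow>
     continuous_map (subtopology (prod_topology (Euclidean_space r) euclideanreal) W)
       euclidean (\<lambda>(u, t). F u t)"
| "C_family (Suc n) r W F \<longleftrightarrow>
     (\<forall>(u, t)\<in>W. F u differentiable (at t) \<and>
        (\<forall>i<r. (\<lambda>s. F (u(i := s)) t) differentiable (at (u i)))) \<and>
     C_family n r W (\<lambda>u t. vector_derivative (F u) (at t)) \<and>
     (\<forall>i<r. C_family n r W (\<lambda>u t. vector_derivative (\<lambda>s. F (u(i := s)) t) (at (u i))))"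

definition deformation ::
    "nat \<Rightarrow> ((nat \<Rightarrow> real) \<Rightarrow> real \<Rightarrow> real \<times> real) \<Rightarrow> (real \<Rightarrow> real \<times> real) \<Rightarrow> bool" where
  "deformation r F \<phi> \<longleftrightarrow>
     (\<exists>W. openin (prod_topology (Euclidean_space r) euclideanreal) W \<and> (\<lambda>_. 0, 0) \<in> W \<and>
        (\<forall>n. C_family n r W F) \<and> (\<forall>u. (u, 0) \<in> W \<longrightarrow> F u 0 = 0)) \<and>
     (\<forall>\<^sub>F t in nhds 0. F (\<lambda>_. 0) t = \<phi> t)"

text \<open>
  Moduli: a set of parameters with pairwise inequivalent germs, uncountably many of them
  in every neighbourhood of the origin. Asking only that the origin be in the closure would admit
  the set consisting of the origin alone, for every germ. Asking only that it be a limit point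
  would admit sequences of parameters; germs that are not simple in the sense
  below are not simple in that sense either.
\<close>

definition moduli_at_0 ::
    "nat \<Rightarrow> ((nat \<Rightarrow> real) \<Rightarrow> real \<Rightarrow> real \<times> real) \<Rightarrow> (nat \<Rightarrow> real) set \<Rightarrow> bool" where
  "moduli_at_0 r F S \<longleftrightarrow>
     S \<subseteq> topspace (Euclidean_space r) \<and>
     pairwise (\<lambda>u v. \<not> A_equiv (F u) (F v)) S \<and>
     (\<forall>U. openin (Euclidean_space r) U \<and> (\<lambda>_. 0) \<in> U \<longrightarrow> uncountable (S \<inter> U))"

definition A_simple :: "(real \<Rightarrow> real \<times> real) \<Rightarrow> bool" where
  "A_simple \<phi> \<longleftrightarrow> irreducible_param \<phi> \<and>
     (\<forall>r F. deformation r F \<phi> \<longrightarrow> \<not> (\<exists>S. moduli_at_0 r F S))"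


section \<open>The curve with a given curvature density and its parallel curves\<close>

text \<open>The interval integrals are oriented, so they are meaningful also for \<open>t < 0\<close>.\<close>

definition angle :: "(real \<Rightarrow> real) \<Rightarrow> real \<Rightarrow> real" where
  "angle \<kappa> t = (LBINT u=0..t. \<kappa> u)"

definition theta_coeff :: "(real \<Rightarrow> real) \<Rightarrow> nat \<Rightarrow> real" where
  "theta_coeff \<kappa> i = (deriv ^^ i) (angle \<kappa>) 0"

definition tangent :: "(real \<Rightarrow> real) \<Rightarrow> real \<Rightarrow> real \<times> real" where
  "tangent \<kappa> t = (cos (angle \<kappa> t), sin (angle \<kappa> t))"

definition normal_vec :: "(real \<Rightarrow> real) \<Rightarrow> real \<Rightarrow> real \<times> real" where
  "normal_vec \<kappa> t = (- sin (angle \<kappa> t), cos (angle \<kappa> t))"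

definition phi3 :: "(real \<Rightarrow> real) \<Rightarrow> real \<Rightarrow> real \<times> real" where
  "phi3 \<kappa> t = (LBINT u=0..t. (u\<^sup>2 / 2) *\<^sub>R tangent \<kappa> u)"

definition parallel3 :: "(real \<Rightarrow> real) \<Rightarrow> real \<Rightarrow> real \<Rightarrow> real \<times> real" where
  "parallel3 \<kappa> \<delta> t = phi3 \<kappa> t + \<delta> *\<^sub>R normal_vec \<kappa> t"

definition parallel3_germ :: "(real \<Rightarrow> real) \<Rightarrow> real \<Rightarrow> real \<Rightarrow> real \<times> real" where
  "parallel3_germ \<kappa> \<delta> t = parallel3 \<kappa> \<delta> t - parallel3 \<kappa> \<delta> 0"

end

theory Submission
  imports Defs
begin

text \<open>
  The condition \<open>E\<^bsub>6k\<^esub>\<close> or \<open>E\<^bsub>6k+2\<^esub>\<close> is read off jets modulo 3: after a reparametrization making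
  the first component a cube, the second component has, up to \<open>\<A>\<close>-equivalence, a first exponent \<open>p + 6\<close> of
  residue \<open>e\<close> and a first exponent \<open>q + 6\<close> of the other nonzero residue \<open>2e mod 3\<close>; exponents beyond
  \<open>2p + 6\<close> are irrelevant. These two exponents, and the coefficients there, are controlled by the coefficients of \<open>\<theta>\<close>
  of orders \<open>p + 3\<close> and \<open>q + 3\<close>, and conversely. The derivative of the parallel curve is
  \<open>(t\<^sup>2/2 - \<delta> \<theta>')(cos \<theta>, sin \<theta>)\<close>, so replacing \<open>\<phi>\<^sub>3\<close> by it changes the speed only, and the change enters
  the coefficients of order at most \<open>q\<close> linearly unless \<open>q = 2p\<close>, where one quadratic term appears: the formula for \<open>\<delta>\<close>.
  If \<open>\<delta>\<theta>\<^sub>3 = 1\<close>, the speed vanishes to order at least 5 while \<open>\<theta>\<close> vanishes to order 3, so the germ has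
  multiplicity at least 6 and its second component order at least 9; adding monomials of degrees 5 to 9 gives
  one-parameter families with an invariant of the 9-jet that separates their members.
\<close>

text \<open>For m <= n <= 2m the series in \<open>res_class e m n\<close> form an algebra: two terms
  of residue e multiply to residue 2e in degree at least 2m >= n, two terms of residue 2e to residue
  e in degree at least 2n >= m. At the first exponents left free, taking the coefficient is a
  derivation on this algebra, so powers, roots and compositions obey linear formulas there. A
  reparametrisation t w(t) shifts both bounds by 3, because a positive exponent divisible by 3 is at
  least 3.

  Why \<delta> drops out: in the parameter s with x = c s^3 the second component has derivative 3c
  s^2 tan \<Theta>, where \<Theta> is the angle as a function of s, and the decisive coefficients of
  \<Theta> are those of \<theta> divided by 6c. The factor c cancels; only for q = 2p does a term
  with 1/c survive.

  Why the normal forms stop: for leading exponent m, degree 2m - 3 is removed by a shear x + \<mu> y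
  and degree 2m by y - W(x) y^2, after which the remainder is an exact triangular expression in
  t^3.\<close>

section \<open>Calculus of functions of class C^n on open sets\<close>

lemma C_on_cong:
  assumes "open S" "\<And>x. x \<in> S \<Longrightarrow> f x = g x" "C_on n S f"
  shows "C_on n S g"
  using assms
proof (induction n arbitrary: f g)
  case 0
  then show ?case by (simp cong: continuous_on_cong)
next
  case (Suc n)
  have d: "f differentiable (at x)" if "x \<in> S" for x using Suc.prems that by simp
  have eq: "frechet_derivative f (at x) = frechet_derivative g (at x)" if "x \<in> S" for x
    using frechet_derivative_transform_within_open[OF d[OF that] Suc.prems(1) that] Suc.prems(2) by blast
  have "g differentiable (at x)" if "x \<in> S" for x
    using d[OF that] Suc.prems(1,2) that
    unfolding differentiable_def by (meson has_derivative_transform_within_open)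
  moreover have "C_on n S (\<lambda>x. frechet_derivative g (at x) v)" for v
  proof (rule Suc.IH[OF Suc.prems(1)])
    show "C_on n S (\<lambda>x. frechet_derivative f (at x) v)" using Suc.prems by simp
  qed (simp add: eq)
  ultimately show ?case by simp
qed

text \<open>Replaces \<open>frechet_derivative\<close> in the recursion by whatever derivative is at
  hand.\<close>

lemma C_on_SucI:
  assumes "open S" "\<And>x. x \<in> S \<Longrightarrow> (f has_derivative f' x) (at x)" "\<And>v. C_on n S (\<lambda>x. f' x v)"
  shows "C_on (Suc n) S f"
proof -
  have "C_on n S (\<lambda>x. frechet_derivative f (at x) v)" for v
    by (rule C_on_cong[OF assms(1) _ assms(3)[of v]]) (simp add: frechet_derivative_at[OF assms(2)])
  then show ?thesis using assms(2) by (auto simp: differentiable_def)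
qed

lemma C_on_SucE:
  assumes "C_on (Suc n) S f"
  obtains f' where "\<And>x. x \<in> S \<Longrightarrow> (f has_derivative f' x) (at x)" "\<And>v. C_on n S (\<lambda>x. f' x v)"
  using assms that[of "\<lambda>x. frechet_derivative f (at x)"]
  by (auto simp: frechet_derivative_works)

lemma C_on_Suc_imp: "open S \<Longrightarrow> C_on (Suc n) S f \<Longrightarrow> C_on n S f"
proof (induction n arbitrary: f)
  case 0
  then show ?case
    by (auto simp: differentiable_imp_continuous_within intro!: continuous_at_imp_continuous_on)
next
  case (Suc n)
  then show ?case by (metis C_on.simps(2))
qed

lemma C_on_subset: "S \<subseteq> T \<Longrightarrow> C_on n T f \<Longrightarrow> C_on n S f"
  by (induction n arbitrary: f) (auto intro: continuous_on_subset)

lemma C_on_const: "open S \<Longrightarrow> C_on n S (\<lambda>x. c)"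
proof (induction n arbitrary: c)
  case (Suc n)
  show ?case
    by (rule C_on_SucI[where f' = "\<lambda>_ _. 0", OF Suc.prems]) (auto intro: Suc)
qed simp

lemma C_on_linear: "open S \<Longrightarrow> bounded_linear L \<Longrightarrow> C_on n S L"
proof (cases n)
  case 0
  assume "bounded_linear L"
  then show ?thesis using 0 by (simp add: linear_continuous_on)
next
  case (Suc m)
  assume "open S" "bounded_linear L"
  then show ?thesis unfolding Suc
    by (intro C_on_SucI[where f' = "\<lambda>_. L"])
       (auto intro: C_on_const bounded_linear_imp_has_derivative)
qed

lemma C_on_add:
  "open S \<Longrightarrow> C_on n S f \<Longrightarrow> C_on n S g \<Longrightarrow> C_on n S (\<lambda>x. f x + g x)"
proof (induction n arbitrary: f g)
  case 0
  then show ?case by (simp add: continuous_on_add)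
next
  case (Suc n)
  obtain f' where f': "\<And>x. x \<in> S \<Longrightarrow> (f has_derivative f' x) (at x)" "\<And>v. C_on n S (\<lambda>x. f' x v)"
    using Suc.prems(2) by (rule C_on_SucE) blast
  obtain g' where g': "\<And>x. x \<in> S \<Longrightarrow> (g has_derivative g' x) (at x)" "\<And>v. C_on n S (\<lambda>x. g' x v)"
    using Suc.prems(3) by (rule C_on_SucE) blast
  show ?case
    by (rule C_on_SucI[where f' = "\<lambda>x h. f' x h + g' x h", OF Suc.prems(1)])
       (auto intro!: has_derivative_add Suc f' g')
qed

lemma C_on_bilinear:
  assumes "bounded_bilinear B" "open S" "C_on n S f" "C_on n S g"
  shows "C_on n S (\<lambda>x. B (f x) (g x))"
  using assms(3,4)
proof (induction n arbitrary: f g)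
  case 0
  then show ?case using bounded_bilinear.continuous_on[OF assms(1)] by simp
next
  case (Suc n)
  obtain f' where f': "\<And>x. x \<in> S \<Longrightarrow> (f has_derivative f' x) (at x)" "\<And>v. C_on n S (\<lambda>x. f' x v)"
    using Suc.prems(1) by (rule C_on_SucE) blast
  obtain g' where g': "\<And>x. x \<in> S \<Longrightarrow> (g has_derivative g' x) (at x)" "\<And>v. C_on n S (\<lambda>x. g' x v)"
    using Suc.prems(2) by (rule C_on_SucE) blast
  have fg: "C_on n S f" "C_on n S g" using Suc.prems C_on_Suc_imp[OF assms(2)] by blast+
  show ?case
    by (rule C_on_SucI[where f' = "\<lambda>x h. B (f x) (g' x h) + B (f' x h) (g x)", OF assms(2)])
       (auto intro!: bounded_bilinear.FDERIV[OF assms(1)] C_on_add Suc.IH f' g' fg assms(2))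
qed

lemma C_on_sum:
  "open S \<Longrightarrow> (\<And>i. i \<in> I \<Longrightarrow> C_on n S (f i)) \<Longrightarrow> C_on n S (\<lambda>x. \<Sum>i\<in>I. f i x)"
  by (induction I rule: infinite_finite_induct) (auto intro: C_on_const C_on_add)

text \<open>The derivative v |-> f'(g x)(g' x v) does not fit the recursion, because the direction
  g' x v depends on x. Expanding it in \<open>Basis\<close> gives a finite sum of scalar functions
  times derivatives of f in fixed directions.\<close>

lemma C_on_compose:
  fixes f :: "'b::euclidean_space \<Rightarrow> 'c::real_normed_vector" and g :: "'a::real_normed_vector \<Rightarrow> 'b"
  assumes "open S" "open T" "g ` S \<subseteq> T" "C_on n T f" "C_on n S g"
  shows "C_on n S (\<lambda>x. f (g x))"
  using assms(4,5)
proof (induction n arbitrary: f)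
  case 0
  then show ?case using assms(3) continuous_on_compose2 by auto
next
  case (Suc n)
  obtain f' where f': "\<And>x. x \<in> T \<Longrightarrow> (f has_derivative f' x) (at x)" "\<And>v. C_on n T (\<lambda>x. f' x v)"
    using Suc.prems(1) by (rule C_on_SucE) blast
  obtain g' where g': "\<And>x. x \<in> S \<Longrightarrow> (g has_derivative g' x) (at x)" "\<And>v. C_on n S (\<lambda>x. g' x v)"
    using Suc.prems(2) by (rule C_on_SucE) blast
  have gn: "C_on n S g" using Suc.prems C_on_Suc_imp[OF assms(1)] by blast
  show ?case
  proof (rule C_on_SucI[OF assms(1)])
    fix x assume x: "x \<in> S"
    then have "f' (g x) (g' x h) = (\<Sum>i\<in>Basis. (g' x h \<bullet> i) *\<^sub>R f' (g x) i)" for h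
      using f'(1)[of "g x"] assms(3)
      by (subst euclidean_representation[symmetric, of "g' x h"])
         (auto simp: image_subset_iff linear_sum linear_cmul
           dest!: has_derivative_bounded_linear bounded_linear.linear)
    moreover have "((\<lambda>x. f (g x)) has_derivative (\<lambda>h. f' (g x) (g' x h))) (at x)"
      using has_derivative_compose[OF g'(1)[OF x] f'(1)] x assms(3) by auto
    ultimately show "((\<lambda>x. f (g x)) has_derivative (\<lambda>h. \<Sum>i\<in>Basis. (g' x h \<bullet> i) *\<^sub>R f' (g x) i)) (at x)"
      by simp
  next
    fix v
    have "C_on n S (\<lambda>x. (g' x v \<bullet> i) *\<^sub>R f' (g x) i)" for i
    proof (rule C_on_bilinear[OF bounded_bilinear_scaleR assms(1)])
      show "C_on n S (\<lambda>x. g' x v \<bullet> i)"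
        by (rule C_on_bilinear[OF bounded_bilinear_inner assms(1) g'(2) C_on_const[OF assms(1)]])
      show "C_on n S (\<lambda>x. f' (g x) i)"
        using Suc.IH[OF f'(2) gn] .
    qed
    then show "C_on n S (\<lambda>x. \<Sum>i\<in>Basis. (g' x v \<bullet> i) *\<^sub>R f' (g x) i)"
      by (intro C_on_sum assms(1))
  qed
qed

lemma C_on_bounded_linear:
  assumes "bounded_linear L" "open S" "C_on n S f"
  shows "C_on n S (\<lambda>x. L (f x))"
  using assms(3)
proof (induction n arbitrary: f)
  case 0
  then show ?case using bounded_linear.continuous_on[OF assms(1)] by simp
next
  case (Suc n)
  obtain f' where f': "\<And>x. x \<in> S \<Longrightarrow> (f has_derivative f' x) (at x)" "\<And>v. C_on n S (\<lambda>x. f' x v)"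
    using Suc.prems by (rule C_on_SucE) blast
  show ?case
    by (rule C_on_SucI[where f' = "\<lambda>x h. L (f' x h)", OF assms(2)])
       (auto intro!: bounded_linear.has_derivative[OF assms(1)] Suc.IH f')
qed

subsection \<open>Germs of smooth maps\<close>

lemma smooth_at_cong:
  assumes "eventually (\<lambda>x. f x = g x) (nhds a)" "smooth_at f a"
  shows "smooth_at g a"
proof -
  obtain V where V: "open V" "a \<in> V" "\<And>x. x \<in> V \<Longrightarrow> f x = g x"
    using assms(1) by (auto simp: eventually_nhds)
  obtain U where U: "open U" "a \<in> U" "\<And>n. C_on n U f"
    using assms(2) by (auto simp: smooth_at_def)
  have "C_on n (U \<inter> V) g" for n
    by (rule C_on_cong[where f = f]) (use U V in \<open>auto intro: C_on_subset[of _ U]\<close>)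
  then show ?thesis unfolding smooth_at_def using U V by (intro exI[of _ "U \<inter> V"]) auto
qed

lemma smooth_at_nearby:
  assumes "smooth_at f a" shows "eventually (\<lambda>x. smooth_at f x) (nhds a)"
  using assms by (auto simp: smooth_at_def eventually_nhds)

lemma smooth_at_const [simp]: "smooth_at (\<lambda>x. c) a"
  unfolding smooth_at_def by (intro exI[of _ UNIV]) (auto intro: C_on_const)

lemma smooth_at_linear: "bounded_linear L \<Longrightarrow> smooth_at L a"
  unfolding smooth_at_def by (intro exI[of _ UNIV]) (auto intro: C_on_linear)

lemma smooth_at_ident [simp]: "smooth_at (\<lambda>x. x) a"
  by (rule smooth_at_linear[OF bounded_linear_ident])

lemma smooth_at_bilinear:
  assumes "bounded_bilinear B" "smooth_at f a" "smooth_at g a"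
  shows "smooth_at (\<lambda>x. B (f x) (g x)) a"
proof -
  obtain U where U: "open U" "a \<in> U" "\<And>n. C_on n U f"
    using assms(2) by (auto simp: smooth_at_def)
  obtain V where V: "open V" "a \<in> V" "\<And>n. C_on n V g"
    using assms(3) by (auto simp: smooth_at_def)
  show ?thesis unfolding smooth_at_def using U V
    by (intro exI[of _ "U \<inter> V"])
       (auto intro!: C_on_bilinear[OF assms(1)] intro: C_on_subset[of _ U] C_on_subset[of _ V])
qed

lemma smooth_at_bounded_linear:
  assumes "bounded_linear L" "smooth_at f a"
  shows "smooth_at (\<lambda>x. L (f x)) a"
proof -
  obtain U where U: "open U" "a \<in> U" "\<And>n. C_on n U f"
    using assms(2) by (auto simp: smooth_at_def)
  then show ?thesis unfolding smooth_at_def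
    by (intro exI[of _ U]) (auto intro!: C_on_bounded_linear[OF assms(1)])
qed

lemma smooth_at_add:
  assumes "smooth_at f a" "smooth_at g a"
  shows "smooth_at (\<lambda>x. f x + g x) a"
proof -
  obtain U where U: "open U" "a \<in> U" "\<And>n. C_on n U f"
    using assms(1) by (auto simp: smooth_at_def)
  obtain V where V: "open V" "a \<in> V" "\<And>n. C_on n V g"
    using assms(2) by (auto simp: smooth_at_def)
  show ?thesis unfolding smooth_at_def using U V
    by (intro exI[of _ "U \<inter> V"])
       (auto intro!: C_on_add intro: C_on_subset[of _ U] C_on_subset[of _ V])
qed

lemmas smooth_at_scaleR = smooth_at_bilinear[OF bounded_bilinear_scaleR]

lemma smooth_at_mult:
  fixes f g :: "_ \<Rightarrow> real"
  assumes "smooth_at f a" "smooth_at g a" shows "smooth_at (\<lambda>x. f x * g x) a"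
  by (rule smooth_at_bilinear[OF bounded_bilinear_mult assms])

lemma smooth_at_uminus: "smooth_at f a \<Longrightarrow> smooth_at (\<lambda>x. - f x) a"
  by (rule smooth_at_bounded_linear[OF bounded_linear_minus[OF bounded_linear_ident]])

lemma smooth_at_diff: "smooth_at f a \<Longrightarrow> smooth_at g a \<Longrightarrow> smooth_at (\<lambda>x. f x - g x) a"
  using smooth_at_add[OF _ smooth_at_uminus, of f a g] by simp

lemma smooth_at_power:
  fixes f :: "_ \<Rightarrow> real"
  assumes "smooth_at f a" shows "smooth_at (\<lambda>x. f x ^ n) a"
  by (induction n) (auto intro: smooth_at_mult assms)

lemma smooth_at_fst: "smooth_at f a \<Longrightarrow> smooth_at (\<lambda>x. fst (f x)) a"
  by (rule smooth_at_bounded_linear[OF bounded_linear_fst])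

lemma smooth_at_snd: "smooth_at f a \<Longrightarrow> smooth_at (\<lambda>x. snd (f x)) a"
  by (rule smooth_at_bounded_linear[OF bounded_linear_snd])

lemma smooth_at_Pair:
  assumes "smooth_at f a" "smooth_at g a" shows "smooth_at (\<lambda>x. (f x, g x)) a"
proof -
  have "smooth_at (\<lambda>x. (f x, 0) + (0, g x)) a"
    by (intro smooth_at_add smooth_at_bounded_linear[OF _ assms(1)] smooth_at_bounded_linear[OF _ assms(2)]
        bounded_linear_Pair bounded_linear_ident bounded_linear_zero)
  then show ?thesis by simp
qed

lemma smooth_at_sum:
  "(\<And>i. i \<in> I \<Longrightarrow> smooth_at (f i) a) \<Longrightarrow> smooth_at (\<lambda>x. \<Sum>i\<in>I. f i x) a"
  by (induction I rule: infinite_finite_induct) (auto intro: smooth_at_add)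

lemma C_on_continuous_on: "(\<And>n. C_on n U f) \<Longrightarrow> continuous_on U f"
  using C_on.simps(1) by blast

lemma smooth_at_isCont: "smooth_at f a \<Longrightarrow> isCont f a"
  unfolding smooth_at_def
  by (metis C_on_continuous_on continuous_on_eq_continuous_at)

lemma smooth_at_compose:
  fixes f :: "'b::euclidean_space \<Rightarrow> 'c::real_normed_vector" and g :: "'a::real_normed_vector \<Rightarrow> 'b"
  assumes "smooth_at f (g a)" "smooth_at g a"
  shows "smooth_at (\<lambda>x. f (g x)) a"
proof -
  obtain U where U: "open U" "a \<in> U" "\<And>n. C_on n U g"
    using assms(2) by (auto simp: smooth_at_def)
  obtain V where V: "open V" "g a \<in> V" "\<And>n. C_on n V f"
    using assms(1) by (auto simp: smooth_at_def)
  have o: "open (U \<inter> g -` V)"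
    using C_on_continuous_on[OF U(3)] U(1) V(1) by (simp add: continuous_open_preimage)
  have "C_on n (U \<inter> g -` V) (\<lambda>x. f (g x))" for n
    by (rule C_on_compose[OF o V(1) _ V(3)]) (use U in \<open>auto intro: C_on_subset[of _ U]\<close>)
  then show ?thesis unfolding smooth_at_def using U V o by blast
qed

lemma smooth_at_frechet:
  assumes "smooth_at f a"
  shows "smooth_at (\<lambda>x. frechet_derivative f (at x) v) a"
  using assms unfolding smooth_at_def by (metis C_on.simps(2))

lemma smooth_at_has_derivative:
  assumes "smooth_at f a"
  shows "(f has_derivative frechet_derivative f (at a)) (at a)"
  using assms unfolding smooth_at_def by (metis C_on.simps(2) frechet_derivative_works)

lemma smooth_at_has_real_derivative:
  fixes f :: "real \<Rightarrow> real"
  assumes "smooth_at f a" shows "(f has_real_derivative deriv f a) (at a)"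
  using smooth_at_has_derivative[OF assms] DERIV_deriv_iff_real_differentiable differentiable_def by blast

lemma smooth_at_deriv:
  fixes f :: "real \<Rightarrow> real"
  assumes "smooth_at f a" shows "smooth_at (deriv f) a"
proof (rule smooth_at_cong[OF _ smooth_at_frechet[OF assms, of 1]])
  show "\<forall>\<^sub>F x in nhds a. frechet_derivative f (at x) 1 = deriv f x"
    using smooth_at_nearby[OF assms]
  proof eventually_elim
    case (elim x)
    have "(f has_derivative (*) (deriv f x)) (at x)"
      using smooth_at_has_real_derivative[OF elim] by (simp add: has_field_derivative_def)
    then show ?case by (simp add: frechet_derivative_at[symmetric])
  qed
qed

lemma smooth_at_of_derivative:
  fixes f :: "real \<Rightarrow> 'b::real_normed_vector"
  assumes "\<forall>\<^sub>F x in nhds a. (f has_vector_derivative f' x) (at x)" "smooth_at f' a"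
  shows "smooth_at f a"
proof -
  obtain V where V: "open V" "a \<in> V" "\<And>x. x \<in> V \<Longrightarrow> (f has_vector_derivative f' x) (at x)"
    using assms(1) by (auto simp: eventually_nhds)
  obtain U where U: "open U" "a \<in> U" "\<And>n. C_on n U f'"
    using assms(2) by (auto simp: smooth_at_def)
  have o: "open (U \<inter> V)" using U V by auto
  have S: "C_on (Suc n) (U \<inter> V) f" for n
    by (rule C_on_SucI[OF o, where f' = "\<lambda>x h. h *\<^sub>R f' x"])
       (use V U o in \<open>auto simp: has_vector_derivative_def
          intro!: C_on_bilinear[OF bounded_bilinear_scaleR] C_on_const intro: C_on_subset[of _ U]\<close>)
  then have "C_on n (U \<inter> V) f" for n using C_on_Suc_imp[OF o] by blast
  then show ?thesis unfolding smooth_at_def using U V o by blast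
qed

text \<open>For functions whose derivatives of all orders are given explicitly, as formulas,
  integrals or series: one induction on the order treats all members of the tower at once.\<close>

lemma smooth_at_tower:
  fixes F :: "nat \<Rightarrow> real \<Rightarrow> 'b::real_normed_vector"
  assumes "open U" "a \<in> U" "\<And>n x. x \<in> U \<Longrightarrow> (F n has_vector_derivative F (Suc n) x) (at x)"
  shows "smooth_at (F n) a"
proof -
  have "C_on m U (F n)" for m n
  proof (induction m arbitrary: n)
    case 0
    show ?case using assms(3)
      by (auto intro!: continuous_at_imp_continuous_on intro: has_vector_derivative_continuous)
  next
    case (Suc m)
    show ?case
      by (rule C_on_SucI[OF assms(1), where f' = "\<lambda>x h. h *\<^sub>R F (Suc n) x"])
         (use assms Suc in \<open>auto simp: has_vector_derivative_def
            intro!: C_on_bilinear[OF bounded_bilinear_scaleR] C_on_const\<close>)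
  qed
  then show ?thesis unfolding smooth_at_def using assms by blast
qed

section \<open>Smoothness of elementary functions\<close>

lemma smooth_at_sin: "smooth_at (sin :: real \<Rightarrow> real) a"
proof -
  \<comment> \<open>Each derivative of sin is a shift by a quarter turn.\<close>
  have "smooth_at ((\<lambda>n x. sin (x + real n * (pi / 2))) 0) a"
    by (rule smooth_at_tower[where U = UNIV])
       (auto intro!: derivative_eq_intros simp: has_real_derivative_iff_has_vector_derivative[symmetric]
         sin_add cos_add distrib_right add_divide_distrib)
  then show ?thesis by simp
qed

lemma smooth_at_cos: "smooth_at (cos :: real \<Rightarrow> real) a"
proof -
  have "smooth_at (\<lambda>x. sin (x + pi / 2)) a"
    by (rule smooth_at_compose[OF smooth_at_sin]) (simp add: smooth_at_add)
  then show ?thesis by (simp add: sin_add)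
qed

lemma smooth_at_powr:
  assumes "(a::real) > 0" shows "smooth_at (\<lambda>x. x powr r) a"
proof -
  have "smooth_at ((\<lambda>n x. (\<Prod>j<n. r - real j) * x powr (r - real n)) 0) a"
    by (rule smooth_at_tower[where U = "{0<..}"])
       (use assms in \<open>auto intro!: derivative_eq_intros
         simp: has_real_derivative_iff_has_vector_derivative[symmetric] algebra_simps\<close>)
  then show ?thesis by simp
qed

lemma smooth_at_inverse:
  fixes f :: "'a::real_normed_vector \<Rightarrow> real"
  assumes "smooth_at f a" "f a \<noteq> 0"
  shows "smooth_at (\<lambda>x. inverse (f x)) a"
proof (rule smooth_at_compose[where f = inverse, OF _ assms(1)])
  \<comment> \<open>Writing 1/x as x (x^2)^(-1) reduces both signs of x to \<open>powr\<close> with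
    a positive base.\<close>
  have "smooth_at (\<lambda>x. (x\<^sup>2) powr (-1)) (f a)"
    using assms(2) by (intro smooth_at_compose[where g = "\<lambda>x. x\<^sup>2" and f = "\<lambda>x::real. x powr (-1)"]
      smooth_at_powr smooth_at_power smooth_at_ident) auto
  then have "smooth_at (\<lambda>x::real. x * (x\<^sup>2) powr (-1)) (f a)"
    by (intro smooth_at_mult smooth_at_ident)
  moreover have "x * (x\<^sup>2) powr (-1) = inverse x" for x :: real
    by (cases "x = 0") (auto simp: powr_minus power2_eq_square field_simps)
  ultimately show "smooth_at (inverse :: real \<Rightarrow> real) (f a)" by simp
qed

lemma smooth_at_divide:
  fixes f g :: "'a::real_normed_vector \<Rightarrow> real"
  assumes "smooth_at f a" "smooth_at g a" "g a \<noteq> 0"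
  shows "smooth_at (\<lambda>x. f x / g x) a"
  unfolding divide_inverse by (intro smooth_at_mult smooth_at_inverse assms)

lemma smooth_at_powr':
  fixes f :: "'a::real_normed_vector \<Rightarrow> real"
  assumes "smooth_at f a" "f a > 0"
  shows "smooth_at (\<lambda>x. f x powr r) a"
  by (rule smooth_at_compose[where f = "\<lambda>x. x powr r", OF smooth_at_powr assms(1)]) (use assms in auto)

lemma smooth_at_sqrt:
  fixes f :: "'a::real_normed_vector \<Rightarrow> real"
  assumes "smooth_at f a" "f a > 0"
  shows "smooth_at (\<lambda>x. sqrt (f x)) a"
proof (rule smooth_at_cong[OF _ smooth_at_powr'[OF assms, of "1/2"]])
  have "\<forall>\<^sub>F x in nhds a. f x > 0"
    using smooth_at_isCont[OF assms(1)] assms(2)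
    by (metis isCont_def order_tendstoD(1) tendsto_at_iff_tendsto_nhds)
  then show "\<forall>\<^sub>F x in nhds a. f x powr (1 / 2) = sqrt (f x)"
    by eventually_elim (simp add: powr_half_sqrt)
qed

lemma smooth_at_arctan: "smooth_at arctan a"
proof (rule smooth_at_of_derivative[where f' = "\<lambda>x. inverse (1 + x\<^sup>2)"])
  show "\<forall>\<^sub>F x in nhds a. (arctan has_vector_derivative inverse (1 + x\<^sup>2)) (at x)"
    by (simp add: DERIV_arctan has_real_derivative_iff_has_vector_derivative[symmetric])
  have "1 + a\<^sup>2 > 0" by (rule add_pos_nonneg) auto
  then show "smooth_at (\<lambda>x. inverse (1 + x\<^sup>2)) a"
    by (intro smooth_at_inverse smooth_at_add smooth_at_power) auto
qed

lemma smooth_at_tan: "cos a \<noteq> 0 \<Longrightarrow> smooth_at (tan :: real \<Rightarrow> real) a"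
  unfolding tan_def[abs_def] by (intro smooth_at_divide smooth_at_sin smooth_at_cos)

unbundle no vec_syntax
unbundle fps_syntax

lemma C_on_if_smooth_at:
  assumes "\<And>x. x \<in> S \<Longrightarrow> smooth_at f x"
  shows "C_on n S f"
  using assms
proof (induction n arbitrary: f)
  case 0
  then show ?case by (auto intro!: continuous_at_imp_continuous_on smooth_at_isCont)
next
  case (Suc n)
  have "f differentiable (at x)" if "x \<in> S" for x
    using smooth_at_has_derivative[OF Suc.prems[OF that]] by (auto simp: differentiable_def)
  then show ?case using Suc.prems by (auto intro!: Suc.IH smooth_at_frechet)
qed

lemma smooth_germ_tendsto: "smooth_germ h \<Longrightarrow> filterlim h (nhds 0) (nhds 0)"
  unfolding smooth_germ_def
  by (metis isCont_def smooth_at_isCont tendsto_at_iff_tendsto_nhds)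

lemma eventually_germ:
  "smooth_germ h \<Longrightarrow> \<forall>\<^sub>F y in nhds 0. P y \<Longrightarrow> \<forall>\<^sub>F x in nhds 0. P (h x)"
  using smooth_germ_tendsto filterlim_iff by blast

lemma eventually_nhds_nonzero:
  fixes f :: "'a::real_normed_vector \<Rightarrow> real"
  assumes "smooth_at f a" "f a \<noteq> 0" shows "\<forall>\<^sub>F x in nhds a. f x \<noteq> 0"
  using smooth_at_isCont[OF assms(1)] assms(2)
  by (metis isCont_def tendsto_at_iff_tendsto_nhds tendsto_imp_eventually_ne)

lemma eventually_nhds_pos:
  fixes f :: "'a::real_normed_vector \<Rightarrow> real"
  assumes "smooth_at f a" "f a > 0" shows "\<forall>\<^sub>F x in nhds a. f x > 0"
  using smooth_at_isCont[OF assms(1)] assms(2)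
  by (metis isCont_def tendsto_at_iff_tendsto_nhds order_tendstoD(1))

lemma smooth_germ_compose:
  fixes f :: "'b::euclidean_space \<Rightarrow> 'c::real_normed_vector" and g :: "'a::real_normed_vector \<Rightarrow> 'b"
  shows "smooth_germ f \<Longrightarrow> smooth_germ g \<Longrightarrow> smooth_germ (\<lambda>x. f (g x))"
  unfolding smooth_germ_def using smooth_at_compose[of f g 0] by simp

lemma smooth_germ_ident [simp]: "smooth_germ (\<lambda>x. x)"
  by (simp add: smooth_germ_def)

lemma diffeo_germI:
  assumes "smooth_germ h" "smooth_germ g"
    "\<forall>\<^sub>F x in nhds 0. g (h x) = x" "\<forall>\<^sub>F y in nhds 0. h (g y) = y"
  shows "diffeo_germ h"
  using assms unfolding diffeo_germ_def by blast

lemma diffeo_germ_smooth: "diffeo_germ h \<Longrightarrow> smooth_germ h"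
  by (simp add: diffeo_germ_def)

lemma diffeo_germ_ident [simp]: "diffeo_germ (\<lambda>x. x)"
  by (rule diffeo_germI[where g = "\<lambda>x. x"]) auto

lemma diffeo_germ_inverse:
  assumes "diffeo_germ h"
  obtains g where "diffeo_germ g" "\<forall>\<^sub>F x in nhds 0. g (h x) = x" "\<forall>\<^sub>F y in nhds 0. h (g y) = y"
  using assms unfolding diffeo_germ_def by blast

lemma diffeo_germ_compose:
  fixes f g :: "'a::euclidean_space \<Rightarrow> 'a"
  assumes "diffeo_germ f" "diffeo_germ g" shows "diffeo_germ (\<lambda>x. f (g x))"
proof -
  obtain f' where f': "diffeo_germ f'" "\<forall>\<^sub>F x in nhds 0. f' (f x) = x" "\<forall>\<^sub>F y in nhds 0. f (f' y) = y"
    using assms(1) by (rule diffeo_germ_inverse)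
  obtain g' where g': "diffeo_germ g'" "\<forall>\<^sub>F x in nhds 0. g' (g x) = x" "\<forall>\<^sub>F y in nhds 0. g (g' y) = y"
    using assms(2) by (rule diffeo_germ_inverse)
  show ?thesis
  proof (rule diffeo_germI[where g = "\<lambda>x. g' (f' x)"])
    show "\<forall>\<^sub>F x in nhds 0. g' (f' (f (g x))) = x"
      using eventually_germ[OF diffeo_germ_smooth[OF assms(2)] f'(2)] g'(2) by eventually_elim simp
    show "\<forall>\<^sub>F y in nhds 0. f (g (g' (f' y))) = y"
      using eventually_germ[OF diffeo_germ_smooth[OF f'(1)] g'(3)] f'(3) by eventually_elim simp
    show "smooth_germ (\<lambda>x. f (g x))"
      by (rule smooth_germ_compose[OF diffeo_germ_smooth diffeo_germ_smooth, OF assms])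
    show "smooth_germ (\<lambda>x. g' (f' x))"
      by (rule smooth_germ_compose[OF diffeo_germ_smooth diffeo_germ_smooth, OF g'(1) f'(1)])
  qed
qed

section \<open>A-equivalence as an equivalence relation\<close>

lemma A_equiv_refl [simp]: "A_equiv f f"
  unfolding A_equiv_def by (rule exI[of _ "\<lambda>x. x"], rule exI[of _ "\<lambda>x. x"]) simp

lemma A_equivI:
  assumes "diffeo_germ h" "diffeo_germ \<psi>" "\<forall>\<^sub>F t in nhds 0. f (h t) = \<psi> (g t)"
  shows "A_equiv f g"
  using assms unfolding A_equiv_def by blast

lemma A_equiv_trans:
  assumes "A_equiv f1 f2" "A_equiv f2 f3" shows "A_equiv f1 f3"
proof -
  obtain h \<psi> where 1: "diffeo_germ h" "diffeo_germ \<psi>" "\<forall>\<^sub>F t in nhds 0. f1 (h t) = \<psi> (f2 t)"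
    using assms(1) unfolding A_equiv_def by blast
  obtain h' \<psi>' where 2: "diffeo_germ h'" "diffeo_germ \<psi>'" "\<forall>\<^sub>F t in nhds 0. f2 (h' t) = \<psi>' (f3 t)"
    using assms(2) unfolding A_equiv_def by blast
  show ?thesis
    by (rule A_equivI[OF diffeo_germ_compose[OF 1(1) 2(1)] diffeo_germ_compose[OF 1(2) 2(2)]])
       (use eventually_germ[OF diffeo_germ_smooth[OF 2(1)] 1(3)] 2(3) in \<open>eventually_elim, simp\<close>)
qed

text \<open>The inverse germ of \<psi> cancels \<psi> only near 0, so g has to send small parameters
  to small vectors; g(0) = 0 and continuity provide this.\<close>

lemma A_equiv_sym:
  assumes "A_equiv f g" "f 0 = 0" "g 0 = 0" "isCont g 0"
  shows "A_equiv g f"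
proof -
  obtain h \<psi> where 1: "diffeo_germ h" "diffeo_germ \<psi>" "\<forall>\<^sub>F t in nhds 0. f (h t) = \<psi> (g t)"
    using assms(1) unfolding A_equiv_def by blast
  obtain h' where h': "diffeo_germ h'" "\<forall>\<^sub>F x in nhds 0. h' (h x) = x" "\<forall>\<^sub>F y in nhds 0. h (h' y) = y"
    using 1(1) by (rule diffeo_germ_inverse)
  obtain \<psi>' where p': "diffeo_germ \<psi>'" "\<forall>\<^sub>F x in nhds 0. \<psi>' (\<psi> x) = x"
    using 1(2) by (rule diffeo_germ_inverse)
  have "filterlim g (nhds 0) (nhds 0)" using assms(3,4)
    by (metis isCont_def tendsto_at_iff_tendsto_nhds)
  then have "filterlim (\<lambda>t. g (h' t)) (nhds 0) (nhds 0)"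
    using smooth_germ_tendsto[OF diffeo_germ_smooth[OF h'(1)]] by (rule filterlim_compose)
  then have "\<forall>\<^sub>F t in nhds 0. \<psi>' (\<psi> (g (h' t))) = g (h' t)"
    using p'(2) filterlim_iff by fast
  then have "\<forall>\<^sub>F t in nhds 0. g (h' t) = \<psi>' (f t)"
    using eventually_germ[OF diffeo_germ_smooth[OF h'(1)] 1(3)] h'(3)
    by eventually_elim simp
  then show ?thesis using A_equivI h'(1) p'(1) by blast
qed

lemma A_equiv_cong:
  assumes "\<forall>\<^sub>F t in nhds 0. f t = g t" shows "A_equiv f g"
  by (rule A_equivI[where h = "\<lambda>x. x" and \<psi> = "\<lambda>x. x"]) (use assms in auto)

lemma A_equiv_target: "diffeo_germ \<psi> \<Longrightarrow> A_equiv (\<lambda>t. \<psi> (f t)) f"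
  by (rule A_equivI[where h = "\<lambda>x. x"]) auto

subsection \<open>Diffeomorphism germs of the line\<close>

text \<open>The inverse function theorem in dimension one. The mean value theorem gives injectivity,
  and g' = 1/(h' o g) raises the class of the inverse g by one at each step.\<close>

lemma diffeo_germ_real:
  fixes h :: "real \<Rightarrow> real"
  assumes "smooth_germ h" "deriv h 0 \<noteq> 0" shows "diffeo_germ h"
proof -
  have s: "smooth_at h 0" and h0: "h 0 = 0" using assms(1) by (auto simp: smooth_germ_def)
  obtain e where e: "e > 0" "\<And>x. dist x 0 < e \<Longrightarrow> smooth_at h x \<and> deriv h x \<noteq> 0"
    using eventually_conj[OF smooth_at_nearby[OF s] eventually_nhds_nonzero[OF smooth_at_deriv[OF s] assms(2)]]
    by (auto simp: eventually_nhds_metric)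
  define I where "I = ball (0::real) e"
  have I: "smooth_at h x" "deriv h x \<noteq> 0" if "x \<in> I" for x using e(2) that by (auto simp: I_def)
  have cont: "continuous_on I h"
    using I by (auto intro!: continuous_at_imp_continuous_on smooth_at_isCont)
  have inj: "inj_on h I"
  proof (rule ccontr)
    assume "\<not> inj_on h I"
    then obtain x y where xy: "x \<in> I" "y \<in> I" "x < y" "h x = h y"
      unfolding inj_on_def by (metis linorder_neqE_linordered_idom)
    have sub: "{x..y} \<subseteq> I" using xy by (auto simp: I_def dist_real_def abs_less_iff)
    have "\<exists>z>x. z < y \<and> h y - h x = (y - x) * deriv h z"
      by (rule MVT2[OF xy(3)]) (use sub I in \<open>auto intro!: smooth_at_has_real_derivative\<close>)
    then obtain z where z: "z > x" "z < y" "h y - h x = (y - x) * deriv h z" by blast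
    then have "z \<in> I" using sub by auto
    then show False using xy z I(2)[of z] by auto
  qed
  define J where "J = h ` I"
  have oI: "open I" by (simp add: I_def)
  have oJ: "open J" unfolding J_def
    by (rule invariance_of_domain[OF cont oI inj])
  define g where "g = inv_into I h"
  have gh: "g (h x) = x" if "x \<in> I" for x using that inj by (simp add: g_def)
  have hg: "h (g y) = y" and gI: "g y \<in> I" if "y \<in> J" for y
    using that by (auto simp: J_def g_def f_inv_into_f inv_into_into)
  have dg: "(g has_vector_derivative inverse (deriv h (g y))) (at y)" if y: "y \<in> J" for y
  proof -
    have "(g has_derivative (\<lambda>v. v * inverse (deriv h (g y)))) (at (h (g y)))"
    proof (rule has_derivative_inverse_strong[OF oI gI[OF y] cont gh])
      show "(h has_derivative (*) (deriv h (g y))) (at (g y))"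
        using smooth_at_has_real_derivative[OF I(1)[OF gI[OF y]]] by (simp add: has_field_derivative_def)
      show "(*) (deriv h (g y)) \<circ> (\<lambda>v. v * inverse (deriv h (g y))) = id"
        using I(2)[OF gI[OF y]] by (auto simp: fun_eq_iff)
    qed
    then show ?thesis by (simp add: has_vector_derivative_def hg[OF y])
  qed
  have "C_on n J g" for n
  proof (induction n)
    case 0
    show ?case using dg
      by (auto intro!: continuous_at_imp_continuous_on has_vector_derivative_continuous)
  next
    case (Suc n)
    have "C_on n J (\<lambda>y. inverse (deriv h (g y)))"
      by (rule C_on_compose[where f = "\<lambda>x. inverse (deriv h x)", OF oJ oI])
         (use gI Suc I in \<open>auto intro!: C_on_if_smooth_at smooth_at_inverse smooth_at_deriv\<close>)
    then show ?case
      using dg oJ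
      by (intro C_on_SucI[where f' = "\<lambda>y v. v *\<^sub>R inverse (deriv h (g y))"])
         (auto simp: has_vector_derivative_def intro!: C_on_bilinear[OF bounded_bilinear_mult] C_on_const)
  qed
  moreover have 0: "0 \<in> I" "0 \<in> J" using e(1) h0 by (force simp: I_def J_def)+
  ultimately have "smooth_germ g"
    using oJ gh[OF 0(1)] h0 by (auto simp: smooth_germ_def smooth_at_def)
  moreover have "\<forall>\<^sub>F x in nhds 0. g (h x) = x"
    using oI 0 gh by (auto simp: eventually_nhds)
  moreover have "\<forall>\<^sub>F y in nhds 0. h (g y) = y"
    using oJ 0 hg by (auto simp: eventually_nhds)
  ultimately show ?thesis using assms(1) diffeo_germI by blast
qed

lemma diffeo_germ_deriv_nonzero:
  fixes h :: "real \<Rightarrow> real"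
  assumes "diffeo_germ h" shows "deriv h 0 \<noteq> 0"
proof -
  obtain g where g: "diffeo_germ g" "\<forall>\<^sub>F x in nhds 0. g (h x) = x"
    using assms by (rule diffeo_germ_inverse)
  have s: "smooth_at h 0" "h 0 = 0" "smooth_at g 0"
    using assms g(1) by (auto simp: smooth_germ_def dest!: diffeo_germ_smooth)
  have "((\<lambda>x. g (h x)) has_real_derivative deriv g 0 * deriv h 0) (at 0)"
    using DERIV_chain2[of g _ h 0] smooth_at_has_real_derivative[OF s(1)]
      smooth_at_has_real_derivative[OF s(3)] s(2) by simp
  moreover have "((\<lambda>x. g (h x)) has_real_derivative 1) (at 0)"
    using DERIV_cong_ev[OF refl g(2) refl, of 1] by simp
  ultimately show ?thesis using DERIV_unique by fastforce
qed

subsection \<open>Taylor series as formal power series\<close>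

text \<open>Dividing by factorials makes \<open>jet\<close> turn products and compositions of germs
  into products and compositions of series; the numbers \<open>theta_coeff\<close> differ from its
  coefficients by these factorials.\<close>

definition jet :: "(real \<Rightarrow> real) \<Rightarrow> real fps" where
  "jet f = Abs_fps (\<lambda>n. (deriv ^^ n) f 0 / fact n)"

lemma higher_deriv_smooth: "smooth_at f a \<Longrightarrow> smooth_at ((deriv ^^ n) f) (a::real)"
  by (induction n) (auto intro: smooth_at_deriv)

lemma eventually_deriv_cong:
  fixes f g :: "real \<Rightarrow> real"
  assumes "\<forall>\<^sub>F x in nhds a. f x = g x" shows "\<forall>\<^sub>F x in nhds a. deriv f x = deriv g x"
  using eventually_eventually[THEN iffD2, OF assms]
  by eventually_elim (auto intro: deriv_cong_ev)

lemma jet_cong: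
  assumes "\<forall>\<^sub>F x in nhds 0. f x = g x" shows "jet f = jet g"
proof -
  have "\<forall>\<^sub>F x in nhds 0. (deriv ^^ n) f x = (deriv ^^ n) g x" for n
    by (induction n) (auto intro: assms eventually_deriv_cong)
  then have "(deriv ^^ n) f 0 = (deriv ^^ n) g 0" for n by (rule eventually_nhds_x_imp_x)
  then show ?thesis by (simp add: jet_def)
qed

lemma jet_nth_0 [simp]: "jet f $ 0 = f 0" by (simp add: jet_def)

lemma jet_nth_1: "jet f $ 1 = deriv f 0" by (simp add: jet_def)

lemma jet_deriv: "jet (deriv f) = fps_deriv (jet f)"
  by (rule fps_ext) (simp add: jet_def funpow_swap1 del: of_nat_Suc)

lemma jet_Suc: "jet f $ Suc n = jet (deriv f) $ n / real (Suc n)"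
  by (simp add: jet_deriv)

lemma jet_eqI:
  assumes "\<forall>\<^sub>F x in nhds 0. (f has_real_derivative f' x) (at x)"
  shows "jet f' = fps_deriv (jet f)"
  unfolding jet_deriv[symmetric]
  by (rule jet_cong) (use assms in \<open>eventually_elim, simp add: DERIV_imp_deriv\<close>)

lemma eventually_smooth_derivative:
  fixes f :: "real \<Rightarrow> real"
  assumes "smooth_at f a" shows "\<forall>\<^sub>F x in nhds a. (f has_real_derivative deriv f x) (at x)"
  using smooth_at_nearby[OF assms] by eventually_elim (rule smooth_at_has_real_derivative)

lemma jet_const: "jet (\<lambda>x. c) = fps_const c"
proof -
  have D: "deriv (\<lambda>x::real. b) = (\<lambda>x. 0)" for b :: real by (rule ext) (rule DERIV_imp_deriv, rule DERIV_const)
  have 0: "jet (\<lambda>x. 0) $ n = 0" for n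
  proof (induction n)
    case (Suc n)
    then show ?case by (simp only: jet_Suc D div_0)
  qed simp
  have "jet (\<lambda>x. c) $ n = fps_const c $ n" for n
  proof (cases n)
    case (Suc m)
    have "jet (\<lambda>x. c) $ Suc m = 0" by (simp only: jet_Suc D 0 div_0)
    then show ?thesis by (simp add: Suc)
  qed simp
  then show ?thesis by (rule fps_ext)
qed

lemma jet_ident: "jet (\<lambda>x. x) = fps_X"
proof -
  have "jet (\<lambda>x. 1) = fps_deriv (jet (\<lambda>x. x))" by (rule jet_eqI) simp
  then have "fps_deriv (jet (\<lambda>x. x)) = fps_deriv fps_X" unfolding jet_const by simp
  then show ?thesis unfolding fps_deriv_eq_iff by simp
qed

lemma jet_add:
  assumes "smooth_at f 0" "smooth_at g 0" shows "jet (\<lambda>x. f x + g x) = jet f + jet g"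
proof -
  have "jet (\<lambda>x. f x + g x) $ n = (jet f + jet g) $ n" for n
    using assms
  proof (induction n arbitrary: f g)
    case (Suc n)
    have ev: "\<forall>\<^sub>F x in nhds 0. deriv (\<lambda>x. f x + g x) x = deriv f x + deriv g x"
      using eventually_smooth_derivative[OF Suc.prems(1)] eventually_smooth_derivative[OF Suc.prems(2)]
      by eventually_elim (intro DERIV_imp_deriv DERIV_add)
    have "jet (\<lambda>x. f x + g x) $ Suc n = jet (\<lambda>x. deriv f x + deriv g x) $ n / real (Suc n)"
      by (simp only: jet_Suc jet_cong[OF ev])
    also have "\<dots> = (jet f + jet g) $ Suc n"
      using Suc.IH[OF smooth_at_deriv smooth_at_deriv, OF Suc.prems] by (simp add: jet_Suc add_divide_distrib)
    finally show ?case .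
  qed simp
  then show ?thesis by (rule fps_ext)
qed

lemma jet_mult:
  assumes "smooth_at f 0" "smooth_at g 0" shows "jet (\<lambda>x. f x * g x) = jet f * jet g"
proof -
  have "jet (\<lambda>x. f x * g x) $ n = (jet f * jet g) $ n" for n
    using assms
  proof (induction n arbitrary: f g)
    case (Suc n)
    note s = Suc.prems smooth_at_deriv[OF Suc.prems(1)] smooth_at_deriv[OF Suc.prems(2)]
    have ev: "\<forall>\<^sub>F x in nhds 0. deriv (\<lambda>x. f x * g x) x = deriv f x * g x + f x * deriv g x"
      using eventually_smooth_derivative[OF Suc.prems(1)] eventually_smooth_derivative[OF Suc.prems(2)]
      by eventually_elim (rule DERIV_imp_deriv, rule derivative_eq_intros, simp_all add: mult.commute)
    have "jet (\<lambda>x. f x * g x) $ Suc n = jet (\<lambda>x. deriv f x * g x + f x * deriv g x) $ n / real (Suc n)"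
      by (simp only: jet_Suc jet_cong[OF ev])
    also have "\<dots> = (fps_deriv (jet f) * jet g + jet f * fps_deriv (jet g)) $ n / real (Suc n)"
      using s by (simp add: jet_add smooth_at_mult Suc.IH jet_deriv)
    also have "\<dots> = fps_deriv (jet f * jet g) $ n / real (Suc n)"
      by (simp add: add.commute)
    also have "\<dots> = (jet f * jet g) $ Suc n" unfolding fps_deriv_nth by simp
    finally show ?case .
  qed simp
  then show ?thesis by (rule fps_ext)
qed

lemma jet_cmult: "smooth_at f 0 \<Longrightarrow> jet (\<lambda>x. c * f x) = fps_const c * jet f"
  by (simp add: jet_mult jet_const)

lemma jet_uminus: "smooth_at f 0 \<Longrightarrow> jet (\<lambda>x. - f x) = - jet f"
  using jet_cmult[of f "-1"] by (simp add: fps_const_neg[symmetric] del: fps_const_neg)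

lemma jet_diff: "smooth_at f 0 \<Longrightarrow> smooth_at g 0 \<Longrightarrow> jet (\<lambda>x. f x - g x) = jet f - jet g"
  using jet_add[of f "\<lambda>x. - g x"] by (simp add: jet_uminus smooth_at_uminus)

lemma jet_power: "smooth_at f 0 \<Longrightarrow> jet (\<lambda>x. f x ^ n) = jet f ^ n"
  by (induction n) (auto simp: jet_const jet_mult smooth_at_power)

text \<open>Degree n of f o h is governed by the degrees below n of (f' o h) h', where the induction
  hypothesis applies to f' in place of f.\<close>

lemma jet_compose:
  assumes "smooth_at f 0" "smooth_germ h" shows "jet (\<lambda>x. f (h x)) = jet f oo jet h"
proof -
  have h: "smooth_at h 0" "h 0 = 0" using assms(2) by (auto simp: smooth_germ_def)
  have "jet (\<lambda>x. f (h x)) $ n = (jet f oo jet h) $ n" for n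
    using assms(1)
  proof (induction n arbitrary: f rule: less_induct)
    case (less n)
    show ?case
    proof (cases n)
      case 0
      then show ?thesis using h(2) by simp
    next
      case (Suc m)
      have sf: "smooth_at f (h 0)" "smooth_at (deriv f) (h 0)"
        using less.prems smooth_at_deriv h(2) by auto
      have ev: "\<forall>\<^sub>F x in nhds 0. deriv (\<lambda>x. f (h x)) x = deriv f (h x) * deriv h x"
        using eventually_smooth_derivative[OF h(1)]
          eventually_germ[OF assms(2) eventually_smooth_derivative[OF less.prems]]
        by eventually_elim (rule DERIV_imp_deriv, rule DERIV_chain2)
      have "jet (\<lambda>x. f (h x)) $ n = jet (\<lambda>x. deriv f (h x) * deriv h x) $ m / real n"
        by (simp only: jet_Suc Suc jet_cong[OF ev])
      also have "\<dots> = (jet (\<lambda>x. deriv f (h x)) * jet (deriv h)) $ m / real n"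
        by (subst jet_mult) (use sf h in \<open>auto intro!: smooth_at_compose[where f = "deriv f"] smooth_at_deriv\<close>)
      also have "\<dots> = ((jet (deriv f) oo jet h) * jet (deriv h)) $ m / real n"
        using less.IH[OF _ smooth_at_deriv[OF less.prems]]
        by (auto simp: fps_mult_nth Suc intro!: sum.cong)
      also have "\<dots> = fps_deriv (jet f oo jet h) $ m / real n"
        using fps_compose_deriv[of "jet h" "jet f"] h(2) by (simp add: jet_deriv)
      also have "\<dots> = (jet f oo jet h) $ n" by (simp add: Suc)
      finally show ?thesis .
    qed
  qed
  then show ?thesis by (rule fps_ext)
qed

section \<open>Chain rule along plane curves\<close>

definition partial1 :: "(real \<times> real \<Rightarrow> real) \<Rightarrow> real \<times> real \<Rightarrow> real" where
  "partial1 H p = frechet_derivative H (at p) (1, 0)"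

definition partial2 :: "(real \<times> real \<Rightarrow> real) \<Rightarrow> real \<times> real \<Rightarrow> real" where
  "partial2 H p = frechet_derivative H (at p) (0, 1)"

lemma smooth_at_partial:
  "smooth_at H p \<Longrightarrow> smooth_at (partial1 H) p" "smooth_at H p \<Longrightarrow> smooth_at (partial2 H) p"
  unfolding partial1_def partial2_def by (auto intro: smooth_at_frechet)

text \<open>Stands in for a Taylor expansion in two variables: claims on the jet of H(f, g) are
  proved by induction on the degree, with the partial derivatives of H in the hypothesis.\<close>

lemma deriv_jet_plane:
  assumes "smooth_at H 0" "smooth_germ f" "smooth_germ g"
  shows "fps_deriv (jet (\<lambda>t. H (f t, g t))) =
    jet (\<lambda>t. partial1 H (f t, g t)) * fps_deriv (jet f) + jet (\<lambda>t. partial2 H (f t, g t)) * fps_deriv (jet g)"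
proof -
  have fg: "smooth_at f 0" "smooth_at g 0" "f 0 = 0" "g 0 = 0"
    using assms by (auto simp: smooth_germ_def)
  have germ: "smooth_germ (\<lambda>t. (f t, g t))"
    using fg by (auto simp: smooth_germ_def smooth_at_Pair zero_prod_def)
  have sP: "smooth_at (partial1 H) (f 0, g 0)" "smooth_at (partial2 H) (f 0, g 0)"
    using smooth_at_partial[OF assms(1)] fg by (simp_all add: zero_prod_def)
  have sm: "smooth_at (\<lambda>t. partial1 H (f t, g t)) 0" "smooth_at (\<lambda>t. partial2 H (f t, g t)) 0"
    by (auto intro!: smooth_at_compose[where f = "partial1 H"] smooth_at_compose[where f = "partial2 H"]
        sP smooth_at_Pair fg)
  have "\<forall>\<^sub>F t in nhds 0. ((\<lambda>t. H (f t, g t)) has_real_derivative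
      partial1 H (f t, g t) * deriv f t + partial2 H (f t, g t) * deriv g t) (at t)"
    using eventually_smooth_derivative[OF fg(1)] eventually_smooth_derivative[OF fg(2)]
      eventually_germ[OF germ smooth_at_nearby[OF assms(1)]]
  proof eventually_elim
    case (elim t)
    let ?D = "frechet_derivative H (at (f t, g t))"
    have D: "(H has_derivative ?D) (at (f t, g t))" by (rule smooth_at_has_derivative[OF elim(3)])
    have lin: "linear ?D" using D has_derivative_linear by blast
    have "((\<lambda>t. (f t, g t)) has_derivative (\<lambda>v. (deriv f t * v, deriv g t * v))) (at t)"
      using elim by (intro has_derivative_Pair) (simp_all add: has_field_derivative_def)
    then have "((\<lambda>t. H (f t, g t)) has_derivative (\<lambda>v. ?D (deriv f t * v, deriv g t * v))) (at t)"
      by (rule has_derivative_compose[where g = H and f = "\<lambda>t. (f t, g t)"]) (rule D)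
    moreover have "?D (deriv f t * v, deriv g t * v) =
       (partial1 H (f t, g t) * deriv f t + partial2 H (f t, g t) * deriv g t) * v" for v
    proof -
      have "(deriv f t * v, deriv g t * v) = (deriv f t * v) *\<^sub>R (1, 0) + (deriv g t * v) *\<^sub>R (0, 1)"
        by simp
      then show ?thesis unfolding partial1_def partial2_def
        by (simp only: linear_add[OF lin] linear_scale[OF lin]) (simp add: algebra_simps)
    qed
    ultimately show ?case by (simp add: has_field_derivative_def fun_eq_iff)
  qed
  then have "jet (\<lambda>t. partial1 H (f t, g t) * deriv f t + partial2 H (f t, g t) * deriv g t) =
      fps_deriv (jet (\<lambda>t. H (f t, g t)))"
    by (rule jet_eqI)
  then show ?thesis
    using sm fg by (simp add: jet_add jet_mult smooth_at_mult smooth_at_deriv jet_deriv)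
qed

subsection \<open>Power series with prescribed residue classes of exponents\<close>

text \<open>For e = 1 or 2 the residues e and \<open>2 * e mod 3\<close> are the two nonzero ones.
  Exponents divisible by 3 stay free: they form functions of t^3, which a change of target
  coordinates removes.\<close>

definition res_class :: "nat \<Rightarrow> nat \<Rightarrow> nat \<Rightarrow> real fps set" where
  "res_class e m n = {a. \<forall>i. (i mod 3 = e \<and> i < m \<longrightarrow> a $ i = 0) \<and>
                        (i mod 3 = 2 * e mod 3 \<and> i < n \<longrightarrow> a $ i = 0)}"

lemma res_classI:
  assumes "\<And>i. i mod 3 = e \<Longrightarrow> i < m \<Longrightarrow> a $ i = 0" "\<And>i. i mod 3 = 2 * e mod 3 \<Longrightarrow> i < n \<Longrightarrow> a $ i = 0"
  shows "a \<in> res_class e m n"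
  using assms by (auto simp: res_class_def)

lemma res_classD:
  assumes "a \<in> res_class e m n"
  shows "i mod 3 = e \<Longrightarrow> i < m \<Longrightarrow> a $ i = 0" "i mod 3 = 2 * e mod 3 \<Longrightarrow> i < n \<Longrightarrow> a $ i = 0"
  using assms by (auto simp: res_class_def)

lemma res_class_mono: "m' \<le> m \<Longrightarrow> n' \<le> n \<Longrightarrow> res_class e m n \<subseteq> res_class e m' n'"
  by (auto simp: res_class_def)

lemma res_class_add: "a \<in> res_class e m n \<Longrightarrow> b \<in> res_class e m n \<Longrightarrow> a + b \<in> res_class e m n"
  by (auto simp: res_class_def)

lemma res_class_diff: "a \<in> res_class e m n \<Longrightarrow> b \<in> res_class e m n \<Longrightarrow> a - b \<in> res_class e m n"
  by (auto simp: res_class_def)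

lemma res_class_cmult: "a \<in> res_class e m n \<Longrightarrow> fps_const c * a \<in> res_class e m n"
  by (auto simp: res_class_def)

lemma res_class_const: "e = 1 \<or> e = 2 \<Longrightarrow> fps_const c \<in> res_class e m n"
  by (auto simp: res_class_def)

lemma mod3_values: "(x::nat) mod 3 = 0 \<or> x mod 3 = 1 \<or> x mod 3 = 2"
proof -
  have "r = 0 \<or> r = 1 \<or> r = 2" if "r < 3" for r :: nat using that by linarith
  then show ?thesis by (metis mod_less_divisor zero_less_numeral)
qed

text \<open>Since 4e = e modulo 3, two nonzero residues add up to e only as 2e + 2e.\<close>

lemma mod3_split_e:
  assumes "e = 1 \<or> e = (2::nat)" "i mod 3 = e" "j \<le> i"
  shows "j mod 3 = 0 \<and> (i - j) mod 3 = e \<or> j mod 3 = e \<or>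
    j mod 3 = 2 * e mod 3 \<and> (i - j) mod 3 = 2 * e mod 3"
proof -
  have "(j mod 3 + (i - j) mod 3) mod 3 = e"
    using assms(2,3) by (simp only: mod_add_eq le_add_diff_inverse)
  then show ?thesis using assms(1) mod3_values[of j] mod3_values[of "i - j"] by (elim disjE) simp_all
qed

lemma mod3_split_2e:
  assumes "e = 1 \<or> e = (2::nat)" "i mod 3 = 2 * e mod 3" "j \<le> i"
  shows "j mod 3 = 0 \<and> (i - j) mod 3 = 2 * e mod 3 \<or> j mod 3 = 2 * e mod 3 \<or>
    j mod 3 = e \<and> (i - j) mod 3 = e"
proof -
  have "(j mod 3 + (i - j) mod 3) mod 3 = 2 * e mod 3"
    using assms(2,3) by (simp only: mod_add_eq le_add_diff_inverse)
  then show ?thesis using assms(1) mod3_values[of j] mod3_values[of "i - j"] by (elim disjE) simp_all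
qed

lemma mod3_pos:
  assumes "e = 1 \<or> e = (2::nat)" "i mod 3 = e \<or> i mod 3 = 2 * e mod 3" shows "i > 0"
  using assms by (intro gr0I) auto

text \<open>A mixed term of the Cauchy product contains either a coefficient of residue e below the
  bound m, or two of residue 2e, one of them below n because i < 2n. Only the two extreme terms
  remain.\<close>

lemma mult_nth_e:
  assumes he: "e = 1 \<or> e = 2" and a: "a \<in> res_class e m n" and b: "b \<in> res_class e m n"
    and i: "i mod 3 = e" "i \<le> m" "i < 2 * n"
  shows "(a * b) $ i = a $ 0 * b $ i + a $ i * b $ 0"
proof -
  have i0: "i > 0" using mod3_pos[OF he] i by blast
  have "(a * b) $ i = (\<Sum>j\<in>{0..i}. a $ j * b $ (i - j))" by (rule fps_mult_nth)
  also have "\<dots> = (\<Sum>j\<in>{0, i}. a $ j * b $ (i - j))"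
  proof (rule sum.mono_neutral_right)
    show "\<forall>j\<in>{0..i} - {0, i}. a $ j * b $ (i - j) = 0"
    proof
      fix j assume "j \<in> {0..i} - {0, i}"
      then have j: "0 < j" "j < i" by auto
      consider "(i - j) mod 3 = e" | "j mod 3 = e"
        | "j mod 3 = 2 * e mod 3" "(i - j) mod 3 = 2 * e mod 3"
        using mod3_split_e[OF he i(1), of j] j by auto
      then show "a $ j * b $ (i - j) = 0"
      proof cases
        case 1 with b j i show ?thesis by (auto simp: res_class_def)
      next
        case 2 with a j i show ?thesis by (auto simp: res_class_def)
      next
        case 3
        have "j < n \<or> i - j < n" using i(3) by auto
        with 3 a b show ?thesis by (auto simp: res_class_def)
      qed
    qed
  qed auto
  finally show ?thesis using i0 by simp
qed

lemma mult_nth_2e: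
  assumes he: "e = 1 \<or> e = 2" and a: "a \<in> res_class e m n" and b: "b \<in> res_class e m n"
    and i: "i mod 3 = 2 * e mod 3" "i \<le> n" "i < 2 * m"
  shows "(a * b) $ i = a $ 0 * b $ i + a $ i * b $ 0"
proof -
  have i0: "i > 0" using mod3_pos[OF he] i by blast
  have "(a * b) $ i = (\<Sum>j\<in>{0..i}. a $ j * b $ (i - j))" by (rule fps_mult_nth)
  also have "\<dots> = (\<Sum>j\<in>{0, i}. a $ j * b $ (i - j))"
  proof (rule sum.mono_neutral_right)
    show "\<forall>j\<in>{0..i} - {0, i}. a $ j * b $ (i - j) = 0"
    proof
      fix j assume "j \<in> {0..i} - {0, i}"
      then have j: "0 < j" "j < i" by auto
      consider "(i - j) mod 3 = 2 * e mod 3" | "j mod 3 = 2 * e mod 3"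
        | "j mod 3 = e" "(i - j) mod 3 = e"
        using mod3_split_2e[OF he i(1), of j] j by auto
      then show "a $ j * b $ (i - j) = 0"
      proof cases
        case 1 with b j i show ?thesis by (auto simp: res_class_def)
      next
        case 2 with a j i show ?thesis by (auto simp: res_class_def)
      next
        case 3
        have "j < m \<or> i - j < m" using i(3) by auto
        with 3 a b show ?thesis by (auto simp: res_class_def)
      qed
    qed
  qed auto
  finally show ?thesis using i0 by simp
qed

lemma res_class_mult:
  assumes he: "e = 1 \<or> e = 2" and mn: "m \<le> n" "n \<le> 2 * m"
    and a: "a \<in> res_class e m n" and b: "b \<in> res_class e m n"
  shows "a * b \<in> res_class e m n"
proof (rule res_classI)
  fix i assume i: "i mod 3 = e" "i < m"
  show "(a * b) $ i = 0"
    using mult_nth_e[OF he a b i(1)] i mn res_classD(1)[OF a i] res_classD(1)[OF b i] by simp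
next
  fix i assume i: "i mod 3 = 2 * e mod 3" "i < n"
  show "(a * b) $ i = 0"
    using mult_nth_2e[OF he a b i(1)] i mn res_classD(2)[OF a i] res_classD(2)[OF b i] by simp
qed

lemma res_class_power:
  assumes "e = 1 \<or> e = 2" "m \<le> n" "n \<le> 2 * m" "a \<in> res_class e m n"
  shows "a ^ k \<in> res_class e m n"
  by (induction k) (use assms res_class_const[OF assms(1), of 1] in \<open>auto intro: res_class_mult\<close>)

lemma power_nth_e:
  assumes he: "e = 1 \<or> e = 2" and mn: "m \<le> n" "n \<le> 2 * m" and a: "a \<in> res_class e m n" "a $ 0 = 1"
    and i: "i mod 3 = e" "i \<le> m"
  shows "(a ^ k) $ i = real k * a $ i"
proof (induction k)
  case 0
  then show ?case using mod3_pos[OF he] i by auto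
next
  case (Suc k)
  have "i < 2 * n" using i mn mod3_pos[OF he] by (metis add_gr_0 le_add1 mult_2 order.trans order_le_imp_less_or_eq linorder_neqE_nat not_less less_add_same_cancel1)
  then show ?case
    using mult_nth_e[OF he a(1) res_class_power[OF he mn a(1)] i] Suc a(2)
    by (simp add: fps_nth_power_0 algebra_simps)
qed

lemma res_class_compose:
  assumes he: "e = 1 \<or> e = 2" and mn: "m \<le> n" "n \<le> 2 * m" and a: "a \<in> res_class e m n"
  shows "f oo a \<in> res_class e m n"
proof (rule res_classI)
  note p = res_class_power[OF he mn a]
  show "(f oo a) $ i = 0" if "i mod 3 = e" "i < m" for i
    using res_classD(1)[OF p that] by (simp add: fps_compose_nth)
  show "(f oo a) $ i = 0" if "i mod 3 = 2 * e mod 3" "i < n" for i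
    using res_classD(2)[OF p that] by (simp add: fps_compose_nth)
qed

text \<open>As a has no constant term, the derivation rule kills the coefficient in question of
  every power of a but the first. The strict bound n < 2m keeps the square of the term of degree m
  away from degree n.\<close>

lemma compose_nth_leading:
  assumes he: "e = 1 \<or> e = 2" and mn: "m \<le> n" "n < 2 * m" and a: "a \<in> res_class e m n" "a $ 0 = 0"
    and i: "i mod 3 = e \<and> i = m \<or> i mod 3 = 2 * e mod 3 \<and> i = n"
  shows "(f oo a) $ i = f $ 1 * a $ i"
proof -
  have i0: "i > 0" using i mod3_pos[OF he] by blast
  have pw: "(a ^ k) $ i = 0" if "k \<noteq> 1" for k
  proof (cases k)
    case 0
    then show ?thesis using i0 by simp
  next
    case (Suc j)
    then have "j > 0" using that by auto
    have ak: "a ^ j \<in> res_class e m n" using res_class_power[OF he mn(1) _ a(1)] mn by simp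
    have "(a * a ^ j) $ i = a $ 0 * (a ^ j) $ i + a $ i * (a ^ j) $ 0"
      using mult_nth_e[OF he a(1) ak, of i] mult_nth_2e[OF he a(1) ak, of i] i mn i0 by auto
    then show ?thesis using Suc \<open>j > 0\<close> a(2) by (simp add: fps_nth_power_0)
  qed
  have "(f oo a) $ i = (\<Sum>k\<in>{0..i}. f $ k * (a ^ k) $ i)" by (rule fps_compose_nth)
  also have "\<dots> = (\<Sum>k\<in>{1}. f $ k * (a ^ k) $ i)"
    by (rule sum.mono_neutral_right) (use i0 pw in auto)
  finally show ?thesis by simp
qed

subsection \<open>Substitutions compatible with the residue classes\<close>

lemma compose_X_mult_nth:
  fixes a w :: "real fps"
  shows "(a oo (fps_X * w)) $ n = (\<Sum>i\<in>{0..n}. a $ i * (w ^ i) $ (n - i))"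
  unfolding fps_compose_nth by (rule sum.cong) (auto simp: power_mult_distrib fps_X_power_mult_nth)

text \<open>An exponent i that is divisible by 3 and positive leaves degree n - i <= p for w^i, with
  equality only for i = 3 and n = p + 3. All other i fall where a vanishes, or are 0, where w^0 has
  no term of positive degree.\<close>

lemma subst_term_e:
  assumes he: "e = 1 \<or> e = 2" and pq: "p \<le> q" "q \<le> 2 * p" and w: "w \<in> res_class e p q"
    and a: "\<And>j. j < n \<Longrightarrow> j mod 3 = e \<or> j mod 3 = 2 * e mod 3 \<Longrightarrow> a $ j = 0"
    and n: "n mod 3 = e" "n \<le> p + 3" and i: "i \<le> n" "i \<noteq> n" "i \<noteq> 3 \<or> n < p + 3"
  shows "a $ i * (w ^ i) $ (n - i) = 0"
proof -
  note wi = res_class_power[OF he pq w, of i]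
  consider "i = 0" | "i \<ge> 3" "i mod 3 = 0" "(n - i) mod 3 = e" | "i mod 3 = e" | "i mod 3 = 2 * e mod 3"
    using mod3_split_e[OF he n(1) i(1)] by (metis (no_types) mod_less not_less)
  then show ?thesis
  proof cases
    case 1
    then show ?thesis using i by simp
  next
    case 2
    then have "n - i < p" using n(2) i by (cases "i = 3") auto
    then show ?thesis using res_classD(1)[OF wi 2(3)] by simp
  qed (use a[of i] i in auto)
qed

text \<open>Residue 2e also arises from a coefficient of a of residue e times one of w^i of residue
  e. This product vanishes unless i = p + 3 and n = 2p + 3, and that exception is the source of the
  quadratic term.\<close>

lemma subst_term_2e:
  assumes he: "e = 1 \<or> e = 2" and pq: "p \<le> q" "q \<le> 2 * p" and w: "w \<in> res_class e p q"
    and a: "\<And>j. j < n \<Longrightarrow> j mod 3 = 2 * e mod 3 \<Longrightarrow> a $ j = 0"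
      "\<And>j. j < n \<Longrightarrow> j mod 3 = e \<Longrightarrow> j < p + 3 \<Longrightarrow> a $ j = 0"
    and n: "n mod 3 = 2 * e mod 3" "n \<le> q + 3"
    and i: "i \<le> n" "i \<noteq> n" "i \<noteq> 3 \<or> n < q + 3" "i \<noteq> p + 3 \<or> n < 2 * p + 3"
  shows "a $ i * (w ^ i) $ (n - i) = 0"
proof -
  note wi = res_class_power[OF he pq w, of i]
  consider "i = 0" | "i \<ge> 3" "i mod 3 = 0" "(n - i) mod 3 = 2 * e mod 3" | "i mod 3 = 2 * e mod 3"
    | "i mod 3 = e" "(n - i) mod 3 = e"
    using mod3_split_2e[OF he n(1) i(1)] by (metis (no_types) mod_less not_less)
  then show ?thesis
  proof cases
    case 1
    then show ?thesis using i by simp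
  next
    case 2
    then have "n - i < q" using n(2) i by (cases "i = 3") auto
    then show ?thesis using res_classD(2)[OF wi 2(3)] by simp
  next
    case 3
    then show ?thesis using a(1)[of i] i by simp
  next
    case 4
    show ?thesis
    proof (cases "i < p + 3")
      case True
      then show ?thesis using a(2)[of i] 4 i by simp
    next
      case False
      then have "n - i < p" using n(2) i pq by (cases "i = p + 3") auto
      then show ?thesis using res_classD(1)[OF wi 4(2)] by simp
    qed
  qed
qed

lemma res_class_subst:
  assumes he: "e = 1 \<or> e = 2" and pq: "p \<le> q" "q \<le> 2 * p" and w: "w \<in> res_class e p q"
    and a: "a \<in> res_class e (p + 3) (q + 3)"
  shows "a oo (fps_X * w) \<in> res_class e (p + 3) (q + 3)"
proof (rule res_classI)
  fix n assume n: "n mod 3 = e" "n < p + 3"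
  have "a $ i * (w ^ i) $ (n - i) = 0" if "i \<le> n" for i
  proof (cases "i = n")
    case True
    then show ?thesis using res_classD(1)[OF a n] by simp
  next
    case False
    show ?thesis
      by (rule subst_term_e[OF he pq w _ n(1)]) (use n that False pq in \<open>auto intro: res_classD[OF a]\<close>)
  qed
  then show "(a oo (fps_X * w)) $ n = 0" unfolding compose_X_mult_nth by (intro sum.neutral) auto
next
  fix n assume n: "n mod 3 = 2 * e mod 3" "n < q + 3"
  have "a $ i * (w ^ i) $ (n - i) = 0" if "i \<le> n" for i
  proof (cases "i = n")
    case True
    then show ?thesis using res_classD(2)[OF a n] by simp
  next
    case False
    show ?thesis
      by (rule subst_term_2e[OF he pq w _ _ n(1)]) (use n that False pq in \<open>auto intro: res_classD[OF a]\<close>)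
  qed
  then show "(a oo (fps_X * w)) $ n = 0" unfolding compose_X_mult_nth by (intro sum.neutral) auto
qed

text \<open>The first coefficient of \<open>a\<close> violating the conclusion would survive in the composition.\<close>

lemma res_class_subst_cancel:
  assumes he: "e = 1 \<or> e = 2" and pq: "p \<le> q" "q \<le> 2 * p" and w: "w \<in> res_class e p q" "w $ 0 \<noteq> 0"
    and aw: "a oo (fps_X * w) \<in> res_class e (p + 3) (q + 3)"
  shows "a \<in> res_class e (p + 3) (q + 3)"
proof -
  have "(n mod 3 = e \<and> n < p + 3 \<longrightarrow> a $ n = 0) \<and> (n mod 3 = 2 * e mod 3 \<and> n < q + 3 \<longrightarrow> a $ n = 0)" for n
  proof (induction n rule: less_induct)
    case (less n)
    have top: "a $ n = 0" if "\<And>i. i < n \<Longrightarrow> a $ i * (w ^ i) $ (n - i) = 0" "(a oo (fps_X * w)) $ n = 0"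
    proof -
      have "(a oo (fps_X * w)) $ n = (\<Sum>i\<in>{n}. a $ i * (w ^ i) $ (n - i))"
        unfolding compose_X_mult_nth by (rule sum.mono_neutral_right) (use that(1) in auto)
      then show ?thesis using that(2) w(2) by (simp add: fps_nth_power_0)
    qed
    show ?case
    proof (intro conjI impI; elim conjE)
      assume n: "n mod 3 = e" "n < p + 3"
      show "a $ n = 0"
      proof (rule top)
        show "(a oo (fps_X * w)) $ n = 0" by (rule res_classD(1)[OF aw n])
        show "a $ i * (w ^ i) $ (n - i) = 0" if "i < n" for i
          by (rule subst_term_e[OF he pq w(1) _ n(1)]) (use n that less pq in auto)
      qed
    next
      assume n: "n mod 3 = 2 * e mod 3" "n < q + 3"
      show "a $ n = 0"
      proof (rule top)
        show "(a oo (fps_X * w)) $ n = 0" by (rule res_classD(2)[OF aw n])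
        show "a $ i * (w ^ i) $ (n - i) = 0" if "i < n" for i
          by (rule subst_term_2e[OF he pq w(1) _ _ n(1)]) (use n that less pq in auto)
      qed
    qed
  qed
  then show ?thesis by (auto simp: res_class_def)
qed

text \<open>Beside the coefficient of a at p + 3 only i = 3 survives: the reparametrisation is felt
  through the cubic term alone.\<close>

lemma subst_nth_e:
  assumes he: "e = 1 \<or> e = 2" and pq: "0 < p" "p \<le> q" "q \<le> 2 * p" and w: "w \<in> res_class e p q" "w $ 0 = 1"
    and a: "a \<in> res_class e (p + 3) (q + 3)" and p: "p mod 3 = e"
  shows "(a oo (fps_X * w)) $ (p + 3) = a $ 3 * (w ^ 3) $ p + a $ (p + 3)"
proof -
  have "(a oo (fps_X * w)) $ (p + 3) = (\<Sum>i\<in>{3, p + 3}. a $ i * (w ^ i) $ (p + 3 - i))"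
    unfolding compose_X_mult_nth
  proof (rule sum.mono_neutral_right)
    show "\<forall>i\<in>{0..p + 3} - {3, p + 3}. a $ i * (w ^ i) $ (p + 3 - i) = 0"
    proof
      fix i assume i: "i \<in> {0..p + 3} - {3, p + 3}"
      have aj: "a $ j = 0" if "j < p + 3" "j mod 3 = e \<or> j mod 3 = 2 * e mod 3" for j
        using that res_classD[OF a, of j] pq by auto
      show "a $ i * (w ^ i) $ (p + 3 - i) = 0"
        by (rule subst_term_e[OF he pq(2,3) w(1) aj]) (use p i in simp_all)
    qed
  qed auto
  then show ?thesis using pq w(2) by (simp add: fps_nth_power_0)
qed

lemma subst_nth_2e:
  assumes he: "e = 1 \<or> e = 2" and pq: "0 < p" "p \<le> q" "q < 2 * p" and w: "w \<in> res_class e p q" "w $ 0 = 1"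
    and a: "a \<in> res_class e (p + 3) (q + 3)" and q: "q mod 3 = 2 * e mod 3"
  shows "(a oo (fps_X * w)) $ (q + 3) = a $ 3 * (w ^ 3) $ q + a $ (q + 3)"
proof -
  have "(a oo (fps_X * w)) $ (q + 3) = (\<Sum>i\<in>{3, q + 3}. a $ i * (w ^ i) $ (q + 3 - i))"
    unfolding compose_X_mult_nth
  proof (rule sum.mono_neutral_right)
    show "\<forall>i\<in>{0..q + 3} - {3, q + 3}. a $ i * (w ^ i) $ (q + 3 - i) = 0"
      using subst_term_2e[OF he pq(2) _ w(1), of "q + 3" a] q pq res_classD[OF a] by auto
  qed auto
  then show ?thesis using pq w(2) by (simp add: fps_nth_power_0)
qed

text \<open>At q = 2p the term i = p + 3 survives too and meets the coefficient of w^(p+3) at p,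
  which the derivation rule evaluates as (p + 3) w_p.\<close>

lemma subst_nth_2e_top:
  assumes he: "e = 1 \<or> e = 2" and p: "0 < p" "p mod 3 = e" and w: "w \<in> res_class e p (2 * p)" "w $ 0 = 1"
    and a: "a \<in> res_class e (p + 3) (2 * p + 3)"
  shows "(a oo (fps_X * w)) $ (2 * p + 3) =
    a $ 3 * (w ^ 3) $ (2 * p) + a $ (2 * p + 3) + a $ (p + 3) * (real (p + 3) * w $ p)"
proof -
  have q: "2 * p mod 3 = 2 * e mod 3" using p by (metis mod_mult_right_eq)
  have "(a oo (fps_X * w)) $ (2 * p + 3) = (\<Sum>i\<in>{3, p + 3, 2 * p + 3}. a $ i * (w ^ i) $ (2 * p + 3 - i))"
    unfolding compose_X_mult_nth
  proof (rule sum.mono_neutral_right)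
    show "\<forall>i\<in>{0..2 * p + 3} - {3, p + 3, 2 * p + 3}. a $ i * (w ^ i) $ (2 * p + 3 - i) = 0"
      using subst_term_2e[OF he _ _ w(1), of "2 * p + 3" a] q p res_classD[OF a] by auto
  qed auto
  then show ?thesis using p w power_nth_e[OF he _ _ w, of p "p + 3"] by (simp add: fps_nth_power_0)
qed

lemma res_class_shift: "fps_X ^ 3 * w \<in> res_class e (p + 3) (q + 3) \<longleftrightarrow> w \<in> res_class e p q"
proof
  assume a: "fps_X ^ 3 * w \<in> res_class e (p + 3) (q + 3)"
  show "w \<in> res_class e p q"
  proof (rule res_classI)
    show "w $ i = 0" if "i mod 3 = e" "i < p" for i
      using res_classD(1)[OF a, of "i + 3"] that by (simp add: fps_X_power_mult_nth)
    show "w $ i = 0" if "i mod 3 = 2 * e mod 3" "i < q" for i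
      using res_classD(2)[OF a, of "i + 3"] that by (simp add: fps_X_power_mult_nth)
  qed
next
  assume w: "w \<in> res_class e p q"
  have m: "(i - 3) mod 3 = i mod 3" if "\<not> i < 3" for i :: nat using that by (metis le_mod_geq linorder_not_less)
  show "fps_X ^ 3 * w \<in> res_class e (p + 3) (q + 3)"
    by (rule res_classI) (use w m in \<open>auto simp: fps_X_power_mult_nth res_class_def\<close>)
qed

text \<open>While the lower coefficients vanish, (w^3)_n = 3 (w_0)^2 w_n, so a first violation in w
  would show in w^3.\<close>

lemma res_class_cube_root:
  assumes he: "e = 1 \<or> e = 2" and pq: "p \<le> q" "q \<le> 2 * p" and w3: "w ^ 3 \<in> res_class e p q" and w0: "w $ 0 \<noteq> 0"
  shows "w \<in> res_class e p q"
proof -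
  have cube: "(w ^ 3) $ i = 3 * (w $ 0)\<^sup>2 * w $ i"
    if "(w * w) $ i = 2 * w $ 0 * w $ i" "(w * (w * w)) $ i = w $ 0 * (w * w) $ i + w $ i * (w * w) $ 0" for i
    using that by (simp add: power3_eq_cube mult.assoc) (simp add: power2_eq_square algebra_simps)
  have "(n mod 3 = e \<and> n < p \<longrightarrow> w $ n = 0) \<and> (n mod 3 = 2 * e mod 3 \<and> n < q \<longrightarrow> w $ n = 0)" for n
  proof (induction n rule: less_induct)
    case (less n)
    show ?case
    proof (intro conjI impI; elim conjE)
      assume n: "n mod 3 = e" "n < p"
      then have n0: "n > 0" using mod3_pos[OF he] by blast
      have w: "w \<in> res_class e n n" by (rule res_classI) (use less n pq in auto)
      have w2: "w * w \<in> res_class e n n" by (rule res_class_mult[OF he _ _ w w]) auto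
      have "(w ^ 3) $ n = 3 * (w $ 0)\<^sup>2 * w $ n"
        using mult_nth_e[OF he w w n(1)] mult_nth_e[OF he w w2 n(1)] n0 by (intro cube) simp_all
      then show "w $ n = 0" using res_classD(1)[OF w3 n] w0 by simp
    next
      assume n: "n mod 3 = 2 * e mod 3" "n < q"
      then have n0: "n > 0" using mod3_pos[OF he] by blast
      \<comment> \<open>The minimum keeps n below twice the first bound, both for n <= p and for p <
        n < q <= 2p.\<close>
      have w: "w \<in> res_class e (min p n) n" by (rule res_classI) (use less n pq in auto)
      have w2: "w * w \<in> res_class e (min p n) n"
        by (rule res_class_mult[OF he _ _ w w]) (use n pq in auto)
      have "n < 2 * min p n" using n pq n0 by auto
      then have "(w ^ 3) $ n = 3 * (w $ 0)\<^sup>2 * w $ n"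
        using mult_nth_2e[OF he w w n(1)] mult_nth_2e[OF he w w2 n(1)] by (intro cube) simp_all
      then show "w $ n = 0" using res_classD(2)[OF w3 n] w0 by simp
    qed
  qed
  then show ?thesis by (auto simp: res_class_def)
qed

text \<open>The factor X^2 and one integration shift degrees by 3; this is the distance between the
  exponent p + 3 of the angle and the exponent p + 6 of the curve.\<close>

lemma fps_nth_of_deriv:
  fixes Y B :: "real fps"
  assumes "fps_deriv Y = fps_const c * fps_X ^ 2 * B"
  shows "real (i + 3) * Y $ (i + 3) = c * B $ i" "Y $ 1 = 0" "Y $ 2 = 0"
proof -
  have n: "real (j + 1) * Y $ (j + 1) = (if j < 2 then 0 else c * B $ (j - 2))" for j
    using arg_cong[OF assms, of "\<lambda>a. a $ j"] by (simp add: mult.assoc fps_X_power_mult_nth)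
  show "real (i + 3) * Y $ (i + 3) = c * B $ i" using n[of "i + 2"] by (simp add: eval_nat_numeral)
  show "Y $ 1 = 0" using n[of 0] by simp
  show "Y $ 2 = 0" using n[of 1] by (simp add: eval_nat_numeral)
qed

lemma res_class_of_deriv:
  assumes he: "e = 1 \<or> e = 2" and d: "fps_deriv Y = fps_const c * fps_X ^ 2 * B" and B: "B \<in> res_class e p q"
  shows "Y \<in> res_class e (p + 3) (q + 3)"
proof -
  have Y: "Y $ i = 0" if "i > 0" "\<not> i < 3 \<longrightarrow> B $ (i - 3) = 0" for i
  proof (cases "i < 3")
    case True
    then have "i = 1 \<or> i = 2" using that by auto
    then show ?thesis using fps_nth_of_deriv(2,3)[OF d] by auto
  next
    case False
    then show ?thesis using fps_nth_of_deriv(1)[OF d, of "i - 3"] that by simp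
  qed
  have m: "(i - 3) mod 3 = i mod 3" if "\<not> i < 3" for i :: nat using that by (metis le_mod_geq linorder_not_less)
  show ?thesis
    by (rule res_classI) (use B m mod3_pos[OF he] in \<open>auto intro!: Y simp: res_class_def\<close>)
qed

lemma res_class_of_deriv_converse:
  assumes d: "fps_deriv Y = fps_const c * fps_X ^ 2 * B" and c: "c \<noteq> 0" and Y: "Y \<in> res_class e (p + 3) (q + 3)"
  shows "B \<in> res_class e p q"
proof (rule res_classI)
  show "B $ i = 0" if "i mod 3 = e" "i < p" for i
    using fps_nth_of_deriv(1)[OF d, of i] res_classD(1)[OF Y, of "i + 3"] that c by simp
  show "B $ i = 0" if "i mod 3 = 2 * e mod 3" "i < q" for i
    using fps_nth_of_deriv(1)[OF d, of i] res_classD(2)[OF Y, of "i + 3"] that c by simp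
qed

lemma fps_eq_X_mult: "(a::real fps) $ 0 = 0 \<Longrightarrow> a = fps_X * fps_shift 1 a"
  by (rule fps_ext) (auto simp: fps_X_mult_nth)

subsection \<open>The jet of the parallel curve in its normalised parameter\<close>

text \<open>Here s is the parameter with x = c s^3, H its series and T the inverse of H;
  \<open>cs\<close>, \<open>sc\<close>, \<open>tn\<close> stand for the series of cos, 1/cos and
  tan. In terms of s the speed has the primitive rho = T^3/6 - \<delta> \<Theta>. From rho' cos
  \<Theta> = 3c s^2 follow rho' = 3c s^2 sec \<Theta> and Y' = 3c s^2 tan \<Theta>, and comparing
  coefficients determines \<Theta> from \<theta>.\<close>

lemma parallel_jet:
  fixes \<theta> H T x Y :: "real fps" and c \<delta> :: real
  defines "\<Theta> \<equiv> \<theta> oo T"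
  assumes he: "e = 1 \<or> e = 2" and pq: "0 < p" "p \<le> q" "q \<le> 2 * p"
    and th: "\<theta> \<in> res_class e (p + 3) (q + 3)" "\<theta> $ 0 = 0"
    and c: "c = (1 - 6 * \<delta> * \<theta> $ 3) / 6" "c \<noteq> 0"
    and x: "fps_deriv x = (fps_const (1/2) * fps_X\<^sup>2 - fps_const \<delta> * fps_deriv \<theta>) * (cs oo \<theta>)"
    and H: "x = fps_const c * H ^ 3" "H $ 0 = 0" "H $ 1 \<noteq> 0"
    and T: "T oo H = fps_X" "T $ 0 = 0" "T $ 1 = 1"
    and rho: "fps_deriv (fps_const (1/6) * T ^ 3 - fps_const \<delta> * \<Theta>) = fps_const (3 * c) * fps_X\<^sup>2 * (sc oo \<Theta>)"
    and Y: "fps_deriv Y = fps_const (3 * c) * fps_X\<^sup>2 * (tn oo \<Theta>)" "tn $ 1 = 1"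
  shows "Y \<in> res_class e (p + 6) (q + 6)"
    and "p mod 3 = e \<Longrightarrow> real (p + 6) * Y $ (p + 6) = \<theta> $ (p + 3) / 2"
    and "q mod 3 = 2 * e mod 3 \<Longrightarrow> q < 2 * p \<Longrightarrow> real (q + 6) * Y $ (q + 6) = \<theta> $ (q + 3) / 2"
    and "p mod 3 = e \<Longrightarrow> q = 2 * p \<Longrightarrow>
      real (q + 6) * Y $ (q + 6) = (\<theta> $ (q + 3) + 2 * real (p + 3) * \<delta> * (\<theta> $ (p + 3))\<^sup>2 / (6 * c)) / 2"
proof -
  let ?R = "res_class e (p + 3) (q + 3)"
  have pq3: "p + 3 \<le> q + 3" "q + 3 \<le> 2 * (p + 3)" "q + 3 < 2 * (p + 3)" using pq by auto
  define h where "h = fps_shift 1 H"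
  have Hh: "H = fps_X * h" "h $ 0 \<noteq> 0" using fps_eq_X_mult[OF H(2)] H(3) by (auto simp: h_def)
  define w where "w = fps_shift 1 T"
  have Tw: "T = fps_X * w" "w $ 0 = 1" using fps_eq_X_mult[OF T(2)] T(3) by (auto simp: w_def)
  have X3: "(fps_X ^ 3 :: real fps) \<in> ?R" using he by (auto simp: res_class_def)
  \<comment> \<open>X d/dX multiplies the coefficient of degree i by i, so it respects the
    classes.\<close>
  have "x \<in> ?R"
  proof -
    define B where "B = fps_X * fps_deriv x"
    have "fps_X * fps_deriv \<theta> \<in> ?R" using th by (auto simp: res_class_def fps_X_mult_nth)
    then have "(fps_const (1/2) * fps_X ^ 3 - fps_const \<delta> * (fps_X * fps_deriv \<theta>)) * (cs oo \<theta>) \<in> ?R"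
      by (rule res_class_mult[OF he pq3(1,2) res_class_diff[OF res_class_cmult[OF X3] res_class_cmult]
          res_class_compose[OF he pq3(1,2) th(1)]])
    also have "(fps_const (1/2) * fps_X ^ 3 - fps_const \<delta> * (fps_X * fps_deriv \<theta>)) * (cs oo \<theta>) = B"
      by (simp add: B_def x power2_eq_square power3_eq_cube algebra_simps)
    finally have "B \<in> ?R" .
    moreover have "B $ i = real i * x $ i" for i by (cases i) (auto simp: B_def fps_X_mult_nth)
    ultimately show ?thesis using mod3_pos[OF he] by (auto simp: res_class_def)
  qed
  then have "fps_X ^ 3 * (fps_const c * h ^ 3) \<in> ?R"
    by (simp add: H(1) Hh(1) power_mult_distrib mult.left_commute)
  then have "fps_const c * h ^ 3 \<in> res_class e p q" by (simp only: res_class_shift)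
  then have "fps_const (1 / c) * (fps_const c * h ^ 3) \<in> res_class e p q" by (rule res_class_cmult)
  then have "h ^ 3 \<in> res_class e p q" using c(2) by (simp add: mult.assoc[symmetric])
  then have hR: "h \<in> res_class e p q" by (rule res_class_cube_root[OF he pq(2,3) _ Hh(2)])
  have Th: "T ^ 3 oo (fps_X * h) = fps_X ^ 3"
    unfolding Hh(1)[symmetric] using fps_compose_power[OF H(2), of T 3] T(1) by metis
  \<comment> \<open>The substitution by H is cancelled in T^3 o H = X^3, whose exponent is divisible
    by 3.\<close>
  have "T ^ 3 \<in> ?R" by (rule res_class_subst_cancel[OF he pq(2,3) hR Hh(2)]) (simp only: Th X3)
  then have "fps_X ^ 3 * w ^ 3 \<in> ?R" by (simp add: Tw(1) power_mult_distrib)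
  then have w3R: "w ^ 3 \<in> res_class e p q" by (simp only: res_class_shift)
  then have wR: "w \<in> res_class e p q" by (rule res_class_cube_root[OF he pq(2,3)]) (simp add: Tw)
  have ThR: "\<Theta> \<in> ?R" unfolding \<Theta>_def Tw(1) by (rule res_class_subst[OF he pq(2,3) wR th(1)])
  have Th0: "\<Theta> $ 0 = 0" by (simp add: \<Theta>_def th(2))
  have tR: "tn oo \<Theta> \<in> ?R" and sR: "sc oo \<Theta> \<in> ?R"
    using res_class_compose[OF he pq3(1,2) ThR] by blast+
  show "Y \<in> res_class e (p + 6) (q + 6)"
    using res_class_of_deriv[OF he Y(1) tR] by (simp add: add.commute)
  have T3: "(T ^ 3) $ (i + 3) = (w ^ 3) $ i" for i
    by (simp add: Tw(1) power_mult_distrib fps_X_power_mult_nth)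
  \<comment> \<open>Degree i + 3 of rho: where sec \<Theta> has no coefficient, the two summands of
    rho cancel each other.\<close>
  have rho0: "(w ^ 3) $ i = 6 * \<delta> * \<Theta> $ (i + 3)" if "(sc oo \<Theta>) $ i = 0" for i
    using fps_nth_of_deriv(1)[OF rho, of i] that T3[of i] by (simp del: of_nat_add of_nat_numeral)
  have Yi: "real (i + 6) * Y $ (i + 6) = 3 * c * \<Theta> $ (i + 3)"
    if "i mod 3 = e \<and> i = p \<or> i mod 3 = 2 * e mod 3 \<and> i = q" for i
  proof -
    have i6: "i + 3 + 3 = i + 6" by simp
    have "(tn oo \<Theta>) $ (i + 3) = \<Theta> $ (i + 3)"
      using compose_nth_leading[OF he pq3(1,3) ThR Th0, of "i + 3" tn] that Y(2) by simp
    then show ?thesis using fps_nth_of_deriv(1)[OF Y(1), of "i + 3"] unfolding i6 by simp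
  qed
  have c6: "1 - 6 * \<delta> * \<theta> $ 3 = 6 * c" using c(1) by simp
  \<comment> \<open>By \<open>rho0\<close> the cubic term returns 6 \<delta>
    \<open>\<theta> $ 3\<close> times the unknown itself. Solving this linear equation divides by
    6c, and the factor 3c of Y' then leaves 1/2, free of \<delta>.\<close>
  have Thp: "6 * c * \<Theta> $ (p + 3) = \<theta> $ (p + 3)" if p: "p mod 3 = e"
  proof -
    have "\<Theta> $ (p + 3) = \<theta> $ 3 * (6 * \<delta> * \<Theta> $ (p + 3)) + \<theta> $ (p + 3)"
      unfolding rho0[OF res_classD(1)[OF sR p less_add_same_cancel1[THEN iffD2]], symmetric, simplified]
      unfolding \<Theta>_def Tw(1) by (rule subst_nth_e[OF he pq wR Tw(2) th(1) p])
    then show ?thesis unfolding c6[symmetric] by (simp add: algebra_simps)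
  qed
  show Yp: "real (p + 6) * Y $ (p + 6) = \<theta> $ (p + 3) / 2" if p: "p mod 3 = e"
    using Yi[of p] Thp[OF p] p by simp
  show "real (q + 6) * Y $ (q + 6) = \<theta> $ (q + 3) / 2" if q: "q mod 3 = 2 * e mod 3" "q < 2 * p"
  proof -
    have "\<Theta> $ (q + 3) = \<theta> $ 3 * (6 * \<delta> * \<Theta> $ (q + 3)) + \<theta> $ (q + 3)"
      unfolding rho0[OF res_classD(2)[OF sR q(1) less_add_same_cancel1[THEN iffD2]], symmetric, simplified]
      unfolding \<Theta>_def Tw(1) by (rule subst_nth_2e[OF he pq(1,2) q(2) wR Tw(2) th(1) q(1)])
    then have "6 * c * \<Theta> $ (q + 3) = \<theta> $ (q + 3)" unfolding c6[symmetric] by (simp add: algebra_simps)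
    then show ?thesis using Yi[of q] q by simp
  qed
  show "real (q + 6) * Y $ (q + 6) = (\<theta> $ (q + 3) + 2 * real (p + 3) * \<delta> * (\<theta> $ (p + 3))\<^sup>2 / (6 * c)) / 2"
    if p: "p mod 3 = e" and q: "q = 2 * p"
  proof -
    have q3: "q mod 3 = 2 * e mod 3" using p q by (metis mod_mult_right_eq)
    have "(w ^ 3) $ p = 3 * w $ p"
      using power_nth_e[OF he pq(2,3) wR Tw(2) p] by simp
    moreover have "(w ^ 3) $ p = 6 * \<delta> * \<Theta> $ (p + 3)"
      by (rule rho0) (use res_classD(1)[OF sR p] in simp)
    \<comment> \<open>The first order effect of \<delta> on the parameter. Inserted into
      \<open>subst_nth_2e_top\<close> it produces the square of
      \<open>\<theta> $ (p + 3)\<close>.\<close>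
    ultimately have wp: "w $ p = 2 * \<delta> * \<Theta> $ (p + 3)" by simp
    have wq: "(w ^ 3) $ q = 6 * \<delta> * \<Theta> $ (q + 3)"
      by (rule rho0) (use res_classD(2)[OF sR q3] in simp)
    have "\<Theta> $ (q + 3) = \<theta> $ 3 * (w ^ 3) $ q + \<theta> $ (q + 3) + \<theta> $ (p + 3) * (real (p + 3) * w $ p)"
      using subst_nth_2e_top[OF he pq(1) p _ Tw(2), of \<theta>] wR th(1) q by (simp add: \<Theta>_def Tw(1))
    then have "6 * c * \<Theta> $ (q + 3) = \<theta> $ (q + 3) + \<theta> $ (p + 3) * (real (p + 3) * (2 * \<delta> * \<Theta> $ (p + 3)))"
      unfolding wp wq c6[symmetric] by (simp add: algebra_simps)
    moreover have "\<Theta> $ (p + 3) = \<theta> $ (p + 3) / (6 * c)" using Thp[OF p] c(2) by (simp add: field_simps)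
    ultimately have "6 * c * \<Theta> $ (q + 3) = \<theta> $ (q + 3) + 2 * real (p + 3) * \<delta> * (\<theta> $ (p + 3))\<^sup>2 / (6 * c)"
      by (simp add: power2_eq_square mult_ac del: of_nat_add)
    then show ?thesis using Yi[of q] q3 by simp
  qed
qed

text \<open>The same chain for \<delta> = 0, run backwards: Y gives tan \<Theta>, arctan gives
  \<Theta>, the derivative 3 s^2 sec \<Theta> gives T^3 and so T, and cancelling the substitution by
  T gives \<theta>.\<close>

lemma angle_jet_of_curve_jet:
  fixes \<theta> T Y :: "real fps"
  defines "\<Theta> \<equiv> \<theta> oo T"
  assumes he: "e = 1 \<or> e = 2" and pq: "p \<le> q" "q \<le> 2 * p"
    and T: "T $ 0 = 0" "T $ 1 = 1"
    and rho: "fps_deriv (T ^ 3) = fps_const 3 * fps_X\<^sup>2 * (sc oo \<Theta>)"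
    and Y: "fps_deriv Y = fps_const (1/2) * fps_X\<^sup>2 * (tn oo \<Theta>)" "atn oo (tn oo \<Theta>) = \<Theta>"
    and YR: "Y \<in> res_class e (p + 6) (q + 6)"
  shows "\<theta> \<in> res_class e (p + 3) (q + 3)"
proof -
  have pq3: "p + 3 \<le> q + 3" "q + 3 \<le> 2 * (p + 3)" using pq by auto
  define w where "w = fps_shift 1 T"
  have Tw: "T = fps_X * w" "w $ 0 = 1" using fps_eq_X_mult[OF T(1)] T(2) by (auto simp: w_def)
  have "tn oo \<Theta> \<in> res_class e (p + 3) (q + 3)"
    using YR by (intro res_class_of_deriv_converse[OF Y(1)]) (simp_all add: add.assoc)
  then have ThR: "\<Theta> \<in> res_class e (p + 3) (q + 3)"
    using res_class_compose[OF he pq3, of _ atn] Y(2) by metis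
  then have "sc oo \<Theta> \<in> res_class e (p + 3) (q + 3)" by (rule res_class_compose[OF he pq3])
  then have "T ^ 3 \<in> res_class e (p + 3 + 3) (q + 3 + 3)" by (rule res_class_of_deriv[OF he rho])
  then have "fps_X ^ 3 * w ^ 3 \<in> res_class e (p + 3) (q + 3)"
    using res_class_mono[of "p + 3" "p + 3 + 3" "q + 3" "q + 3 + 3" e] by (auto simp: Tw(1) power_mult_distrib)
  then have "w ^ 3 \<in> res_class e p q" by (simp only: res_class_shift)
  then have "w \<in> res_class e p q" by (rule res_class_cube_root[OF he pq]) (simp add: Tw)
  then show ?thesis
    by (rule res_class_subst_cancel[OF he pq]) (use ThR Tw(2) in \<open>simp_all add: Tw(1)[symmetric] \<Theta>_def[symmetric]\<close>)
qed

subsection \<open>Division of smooth functions by powers of the parameter\<close>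

lemma higher_deriv_tower:
  fixes F :: "nat \<Rightarrow> real \<Rightarrow> real"
  assumes "open U" "\<And>n x. x \<in> U \<Longrightarrow> (F n has_real_derivative F (Suc n) x) (at x)" "x \<in> U"
  shows "(deriv ^^ n) (F 0) x = F n x"
  using assms(3)
proof (induction n arbitrary: x)
  case (Suc n)
  have "\<forall>\<^sub>F y in nhds x. (deriv ^^ n) (F 0) y = F n y"
    using Suc assms(1) by (auto simp: eventually_nhds)
  then have "deriv ((deriv ^^ n) (F 0)) x = deriv (F n) x" by (rule deriv_cong_ev) simp
  also have "\<dots> = F (Suc n) x" by (rule DERIV_imp_deriv[OF assms(2)[OF Suc.prems]])
  finally show ?case by simp
qed simp

text \<open>Hadamard's lemma: g(t) is the integral of f'(s t) over 0 <= s <= 1. Differentiation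
  under the integral sign brings down a factor s each time, which explains the tower G.\<close>

lemma smooth_division:
  fixes f :: "real \<Rightarrow> real"
  assumes "smooth_at f 0" "f 0 = 0"
  obtains g where "smooth_at g 0" "\<forall>\<^sub>F t in nhds 0. f t = t * g t"
proof -
  obtain e where e: "e > 0" "\<And>x. dist x 0 < e \<Longrightarrow> smooth_at f x"
    using smooth_at_nearby[OF assms(1)] by (auto simp: eventually_nhds_metric)
  define U where "U = ball (0::real) e"
  have sU: "smooth_at ((deriv ^^ n) f) x" if "x \<in> U" for n x
    using e(2)[of x] that by (auto simp: U_def intro!: higher_deriv_smooth)
  have dU: "((deriv ^^ n) f has_real_derivative (deriv ^^ Suc n) f x) (at x)" if "x \<in> U" for n x
    using smooth_at_has_real_derivative[OF sU[OF that, of n]] by simp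
  have sx: "s * x \<in> U" if "x \<in> U" "s \<in> {0..1}" for s x
  proof -
    have "\<bar>s * x\<bar> \<le> 1 * \<bar>x\<bar>" unfolding abs_mult by (rule mult_right_mono) (use that in auto)
    then show ?thesis using that(1) by (simp add: U_def dist_real_def)
  qed
  define G where "G n t = integral (cbox 0 1) (\<lambda>s. s ^ n * (deriv ^^ Suc n) f (s * t))" for n t
  have cont: "continuous_on (U \<times> cbox 0 1) (\<lambda>(t, s). s ^ n * (deriv ^^ m) f (s * t))" for n m
  proof -
    have "continuous_on U ((deriv ^^ m) f)"
      using sU by (auto intro!: continuous_at_imp_continuous_on smooth_at_isCont)
    then have "continuous_on (U \<times> cbox 0 1) (\<lambda>p. (deriv ^^ m) f (snd p * fst p))"
      by (rule continuous_on_compose2) (auto intro!: continuous_intros sx)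
    then show ?thesis by (auto simp: case_prod_beta intro!: continuous_intros)
  qed
  have int: "(\<lambda>s. s ^ n * (deriv ^^ m) f (s * t)) integrable_on cbox 0 1" if "t \<in> U" for n m t
  proof (rule integrable_continuous)
    show "continuous_on (cbox 0 1) (\<lambda>s. s ^ n * (deriv ^^ m) f (s * t))"
    proof -
      have "continuous_on (cbox 0 1) (Pair t)" by (auto intro!: continuous_intros)
      moreover have "continuous_on (Pair t ` cbox 0 1) (\<lambda>(t, s). s ^ n * (deriv ^^ m) f (s * t))"
        by (rule continuous_on_subset[OF cont]) (use that in auto)
      ultimately show ?thesis using continuous_on_compose by (fastforce simp: o_def)
    qed
  qed
  have tower: "(G n has_real_derivative G (Suc n) t) (at t)" if t: "t \<in> U" for n t
  proof -
    have "(G n has_real_derivative G (Suc n) t) (at t within U)"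
      unfolding G_def
    proof (rule leibniz_rule_field_derivative)
      fix x s :: real assume xs: "x \<in> U" "s \<in> cbox 0 1"
      have "((\<lambda>x. (deriv ^^ Suc n) f (s * x)) has_real_derivative (deriv ^^ Suc (Suc n)) f (s * x) * s) (at x)"
        by (rule DERIV_chain2[OF dU]) (use xs sx in \<open>auto intro!: derivative_eq_intros\<close>)
      then have "((\<lambda>x. s ^ n * (deriv ^^ Suc n) f (s * x)) has_real_derivative
          s ^ n * ((deriv ^^ Suc (Suc n)) f (s * x) * s)) (at x)"
        by (rule DERIV_cmult)
      moreover have "s ^ n * (D * s) = s ^ Suc n * D" for D by simp
      ultimately show "((\<lambda>x. s ^ n * (deriv ^^ Suc n) f (s * x)) has_real_derivative
          s ^ Suc n * (deriv ^^ Suc (Suc n)) f (s * x)) (at x within U)"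
        by (simp only: has_field_derivative_at_within)
    next
      show "(\<lambda>s. s ^ n * (deriv ^^ Suc n) f (s * x)) integrable_on cbox 0 1" if "x \<in> U" for x
        by (rule int[OF that])
      show "continuous_on (U \<times> cbox 0 1) (\<lambda>(x, s). s ^ Suc n * (deriv ^^ Suc (Suc n)) f (s * x))"
        by (rule cont)
    qed (use t in \<open>auto simp: U_def\<close>)
    moreover have "open U" by (simp add: U_def)
    ultimately show ?thesis using at_within_open[OF t] by simp
  qed
  have "smooth_at (G 0) 0"
    by (rule smooth_at_tower[where U = U])
       (use tower e(1) in \<open>auto simp: U_def has_real_derivative_iff_has_vector_derivative[symmetric]\<close>)
  moreover have "f t = t * G 0 t" if t: "t \<in> U" for t
  proof -
    have "((\<lambda>s. t * deriv f (s * t)) has_integral (f (1 * t) - f (0 * t))) {0..1}"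
    proof (rule fundamental_theorem_of_calculus)
      fix s :: real assume s: "s \<in> {0..1}"
      have "((\<lambda>s. f (s * t)) has_real_derivative deriv f (s * t) * t) (at s)"
        by (rule DERIV_chain2[OF dU[of _ 0, simplified]]) (use s t sx in \<open>auto intro!: derivative_eq_intros\<close>)
      then show "((\<lambda>s. f (s * t)) has_vector_derivative t * deriv f (s * t)) (at s within {0..1})"
        unfolding has_real_derivative_iff_has_vector_derivative[symmetric] mult.commute[of t]
        by (rule has_field_derivative_at_within)
    qed simp
    moreover have "((\<lambda>s. t * deriv f (s * t)) has_integral t * G 0 t) {0..1}"
      using has_integral_mult_right[OF integrable_integral[OF int[OF t, of 0 1]], of t]
      by (simp add: G_def)
    ultimately have "f (1 * t) - f (0 * t) = t * G 0 t" by (rule has_integral_unique)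
    then show ?thesis using assms(2) by simp
  qed
  then have "\<forall>\<^sub>F t in nhds 0. f t = t * G 0 t"
    using e(1) eventually_nhds_in_open[of U 0] by (auto simp: U_def elim!: eventually_mono)
  ultimately show ?thesis using that by blast
qed

lemma smooth_division_power:
  fixes f :: "real \<Rightarrow> real"
  assumes "smooth_at f 0" "\<And>i. i < n \<Longrightarrow> jet f $ i = 0"
  obtains g where "smooth_at g 0" "\<forall>\<^sub>F t in nhds 0. f t = t ^ n * g t" "jet f = fps_X ^ n * jet g"
proof -
  have "\<exists>g. smooth_at g 0 \<and> (\<forall>\<^sub>F t in nhds 0. f t = t ^ n * g t)"
    using assms(2)
  proof (induction n)
    case 0
    then show ?case using assms(1) by auto
  next
    case (Suc n)
    then obtain g where g: "smooth_at g 0" "\<forall>\<^sub>F t in nhds 0. f t = t ^ n * g t" by auto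
    have "jet f = jet (\<lambda>t. t ^ n * g t)" by (rule jet_cong[OF g(2)])
    also have "\<dots> = fps_X ^ n * jet g" using g(1) by (simp add: jet_mult jet_power jet_ident smooth_at_power)
    finally have "g 0 = 0" using Suc.prems[of n] by (simp add: fps_X_power_mult_nth)
    then obtain h where h: "smooth_at h 0" "\<forall>\<^sub>F t in nhds 0. g t = t * h t"
      using smooth_division g(1) by blast
    have "\<forall>\<^sub>F t in nhds 0. f t = t ^ Suc n * h t" using g(2) h(2) by eventually_elim simp
    then show ?case using h(1) by blast
  qed
  then obtain g where g: "smooth_at g 0" "\<forall>\<^sub>F t in nhds 0. f t = t ^ n * g t" by blast
  have "jet f = jet (\<lambda>t. t ^ n * g t)" by (rule jet_cong[OF g(2)])
  also have "\<dots> = fps_X ^ n * jet g" using g(1) by (simp add: jet_mult jet_power jet_ident smooth_at_power)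
  finally show ?thesis using that g by blast
qed

subsection \<open>Borel's lemma\<close>

text \<open>The building blocks are iterated primitives of \<open>\<epsilon> sin (A x / \<epsilon>)\<close>.\<close>

lemma small_function_with_prescribed_derivative:
  fixes A \<epsilon> :: real
  assumes "\<epsilon> > 0"
  shows "\<exists>F :: nat \<Rightarrow> real \<Rightarrow> real. (\<forall>i x. (F i has_real_derivative F (Suc i) x) (at x)) \<and>
    (\<forall>i<k. F i 0 = 0) \<and> F k 0 = A \<and> (\<forall>i<k. \<forall>x. \<bar>x\<bar> \<le> 1 \<longrightarrow> \<bar>F i x\<bar> \<le> \<epsilon>)"
proof (induction k)
  case 0
  show ?case
    by (rule exI[of _ "\<lambda>i x. if i = 0 then A else 0"]) auto
next
  case (Suc k)
  show ?case
  proof (cases k)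
    case 0
    \<comment> \<open>The slope at 0 is A for every \<epsilon>, while the values stay within
      \<epsilon>.\<close>
    define b where "b = A / \<epsilon>"
    define F where "F i x = \<epsilon> * b ^ i * sin (b * x + real i * (pi / 2))" for i x
    have "(F i has_real_derivative F (Suc i) x) (at x)" for i x
      unfolding F_def
      by (auto intro!: derivative_eq_intros simp: sin_add cos_add ring_distribs add_divide_distrib mult_ac)
    moreover have "\<bar>F 0 x\<bar> \<le> \<epsilon>" for x
      using assms abs_sin_le_one[of "b * x"] by (simp add: F_def abs_mult)
    moreover have "F 0 0 = 0" "F 1 0 = A" using assms by (auto simp: F_def b_def)
    ultimately show ?thesis using 0 by (intro exI[of _ F]) auto
  next
    case (Suc j)
    obtain F :: "nat \<Rightarrow> real \<Rightarrow> real" where F': "(\<forall>i x. (F i has_real_derivative F (Suc i) x) (at x)) \<and>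
      (\<forall>i<k. F i 0 = 0) \<and> F k 0 = A \<and> (\<forall>i<k. \<forall>x. \<bar>x\<bar> \<le> 1 \<longrightarrow> \<bar>F i x\<bar> \<le> \<epsilon>)"
      using Suc.IH by (rule exE)
    then have F: "\<And>i x. (F i has_real_derivative F (Suc i) x) (at x)"
      "\<And>i. i < k \<Longrightarrow> F i 0 = 0" "F k 0 = A" "\<And>i x. i < k \<Longrightarrow> \<bar>x\<bar> \<le> 1 \<Longrightarrow> \<bar>F i x\<bar> \<le> \<epsilon>"
      by blast+
    have "\<exists>P. \<forall>x::real. - \<infinity> < ereal x \<longrightarrow> ereal x < \<infinity> \<longrightarrow> (P has_vector_derivative F 0 x) (at x)"
      by (rule einterval_antiderivative) (use F(1) in \<open>auto intro!: DERIV_isCont\<close>)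
    then obtain P where P: "\<And>x::real. (P has_real_derivative F 0 x) (at x)"
      by (auto simp: has_real_derivative_iff_has_vector_derivative)
    define Q where "Q x = P x - P 0" for x
    have Q: "(Q has_real_derivative F 0 x) (at x)" for x
      unfolding Q_def by (auto intro!: derivative_eq_intros P)
    \<comment> \<open>On [-1, 1] a primitive vanishing at 0 obeys the same bound as the
      function.\<close>
    have Qb: "\<bar>Q x\<bar> \<le> \<epsilon>" if "\<bar>x\<bar> \<le> 1" for x
    proof -
      have "norm (Q x - Q 0) \<le> \<epsilon> * norm (x - 0)"
      proof (rule field_differentiable_bound)
        show "(Q has_field_derivative F 0 z) (at z within {-1..1})" for z
          by (rule has_field_derivative_at_within[OF Q])
        show "norm (F 0 z) \<le> \<epsilon>" if "z \<in> {-1..1}" for z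
          using F(4)[of 0 z] that Suc by (simp add: abs_le_iff)
      qed (use that in auto)
      also have "\<dots> \<le> \<epsilon> * 1" using that assms by (intro mult_left_mono) auto
      finally show ?thesis by (simp add: Q_def)
    qed
    define G where "G i = (case i of 0 \<Rightarrow> Q | Suc j \<Rightarrow> F j)" for i
    have G: "G 0 = Q" "\<And>j. G (Suc j) = F j" by (simp_all add: G_def)
    have "(G i has_real_derivative G (Suc i) x) (at x)" for i x
      by (cases i) (simp_all only: G F(1) Q)
    moreover have "G i 0 = 0" if "i < Suc k" for i
      using that F(2) by (cases i) (auto simp: G Q_def)
    moreover have "G (Suc k) 0 = A" using F(3) by (simp only: G)
    moreover have "\<bar>G i x\<bar> \<le> \<epsilon>" if "i < Suc k" "\<bar>x\<bar> \<le> 1" for i x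
      using that F(4) Qb by (cases i) (auto simp: G)
    ultimately show ?thesis by blast
  qed
qed

text \<open>The summands are chosen one after another: u_k leaves the derivatives below order k at 0
  alone and corrects the one of order k for what the earlier summands contribute. The i-th
  derivatives are bounded by 2^(-k) on the unit ball as soon as k > i, so the series may be
  differentiated term by term.\<close>

lemma borel_lemma:
  fixes a :: "real fps"
  obtains f where "smooth_at f 0" "jet f = a"
proof -
  define P where "P f k F \<longleftrightarrow> (\<forall>i x. (F i has_real_derivative F (Suc i) x) (at x)) \<and>
    (\<forall>i<k. F i 0 = 0) \<and> F k 0 = fact k * a $ k - (\<Sum>j<k. f j k 0) \<and>
    (\<forall>i<k. \<forall>x. \<bar>x\<bar> \<le> 1 \<longrightarrow> \<bar>F i x\<bar> \<le> (1/2) ^ k)"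
    for f :: "nat \<Rightarrow> nat \<Rightarrow> real \<Rightarrow> real" and k F
  have "\<exists>u. \<forall>k. P u k (u k)"
  proof (rule dependent_wellorder_choice)
    show "P f k F = P g k F" if "\<And>y. y < k \<Longrightarrow> f y = g y" for F f g k
      using that by (simp add: P_def)
    show "\<exists>F. P f k F" for k f
      unfolding P_def by (rule small_function_with_prescribed_derivative) simp
  qed
  then obtain u where u: "\<And>k. P u k (u k)" by blast
  have u1: "(u k i has_real_derivative u k (Suc i) x) (at x)" for k i x using u[of k] by (simp add: P_def)
  have u2: "u k i 0 = 0" if "i < k" for k i using u[of k] that by (simp add: P_def)
  have u3: "u k k 0 = fact k * a $ k - (\<Sum>j<k. u j k 0)" for k using u[of k] by (simp add: P_def)
  have u4: "\<bar>u k i x\<bar> \<le> (1/2) ^ k" if "i < k" "\<bar>x\<bar> \<le> 1" for k i x using u[of k] that by (simp add: P_def)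
  define S where "S i x = (\<Sum>k. u k i x)" for i x
  have bound: "\<forall>\<^sub>F k in sequentially. \<forall>x\<in>ball 0 1. norm (u k i x) \<le> (1/2) ^ k" for i
    using eventually_gt_at_top[of i] by eventually_elim (auto intro!: u4)
  have geo: "summable (\<lambda>k. (1/2::real) ^ k)" by (rule summable_geometric) simp
  have D: "(S i has_real_derivative S (Suc i) x) (at x)" if "x \<in> ball 0 1" for i x
  proof -
    have uc: "uniformly_convergent_on (ball 0 1) (\<lambda>n x. \<Sum>k<n. u k (Suc i) x)"
      using Weierstrass_m_test_ev[OF bound geo] unfolding uniformly_convergent_on_def by blast
    have sm: "summable (\<lambda>k. u k i 0)"
      by (rule summable_comparison_test_ev[OF _ geo]) (use bound[of i] in \<open>eventually_elim, auto\<close>)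
    have "((\<lambda>x. \<Sum>k. u k i x) has_field_derivative (\<Sum>k. u k (Suc i) x)) (at x)"
    proof (rule has_field_derivative_series'(2)[of "ball 0 1" "\<lambda>k. u k i" "\<lambda>k. u k (Suc i)" 0 x, OF _ _ uc _ sm])
      show "(u k i has_real_derivative u k (Suc i) y) (at y within ball 0 1)" for k y
        by (rule has_field_derivative_at_within[OF u1])
    qed (use that in auto)
    then show ?thesis by (simp add: S_def[abs_def])
  qed
  have S0: "S i 0 = fact i * a $ i" for i
  proof -
    have "S i 0 = (\<Sum>k\<in>{..i}. u k i 0)" unfolding S_def by (rule suminf_finite) (auto intro!: u2)
    also have "\<dots> = fact i * a $ i" using u3[of i] by (simp flip: lessThan_Suc_atMost)
    finally show ?thesis .
  qed
  have "smooth_at (S 0) 0"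
    by (rule smooth_at_tower[where U = "ball 0 1"])
       (use D in \<open>auto simp: has_real_derivative_iff_has_vector_derivative[symmetric]\<close>)
  moreover have "(deriv ^^ n) (S 0) 0 = S n 0" for n
    by (rule higher_deriv_tower[of "ball 0 1"]) (use D in auto)
  then have "jet (S 0) = a" by (intro fps_ext) (simp add: jet_def S0)
  ultimately show ?thesis using that by blast
qed

subsection \<open>Decomposition of smooth functions over functions of the cube\<close>

text \<open>Outside 0 the derivative of D(root 3 x) is D2(root 3 x) with D2(t) = D'(t)/(3 t^2).
  Flatness makes D2 smooth and flat again, so an induction over all flat functions raises the
  class.\<close>

lemma smooth_at_flat_root:
  fixes D :: "real \<Rightarrow> real"
  assumes "smooth_at D 0" "jet D = 0"
  shows "smooth_at (\<lambda>x. D (root 3 x)) 0"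
proof -
  obtain e where e: "e > 0" "\<And>x. dist x 0 < e \<Longrightarrow> smooth_at D x"
    using smooth_at_nearby[OF assms(1)] by (auto simp: eventually_nhds_metric)
  define I where "I = ball (0::real) e"
  define U where "U = root 3 -` I"
  have oU: "open U" unfolding U_def
    by (rule open_vimage) (auto simp: I_def intro!: continuous_intros)
  have main: "C_on n U (\<lambda>x. D (root 3 x))" if "\<And>t. t \<in> I \<Longrightarrow> smooth_at D t" "jet D = 0" for n
    using that
  proof (induction n arbitrary: D)
    case 0
    have "continuous_on I D" using 0 by (auto intro!: continuous_at_imp_continuous_on smooth_at_isCont)
    then have "continuous_on U (\<lambda>x. D (root 3 x))"
      by (rule continuous_on_compose2) (auto simp: U_def intro!: continuous_intros)
    then show ?case by simp
  next
    case (Suc n)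
    have 0: "0 \<in> I" using e(1) by (simp add: I_def)
    have D0: "smooth_at D 0" using Suc.prems(1)[OF 0] .
    \<comment> \<open>Order 4 gives differentiability at 0: the difference quotient D(root 3 x)/x
      equals root 3 x times E(root 3 x) and tends to 0.\<close>
    obtain E where E: "smooth_at E 0" "\<forall>\<^sub>F t in nhds 0. D t = t ^ 4 * E t"
      using smooth_division_power[OF D0, of 4] Suc.prems(2) by auto
    have jd: "jet (deriv D) = 0" using Suc.prems(2) by (simp add: jet_deriv)
    obtain E2 where E2: "smooth_at E2 0" "\<forall>\<^sub>F t in nhds 0. deriv D t = t\<^sup>2 * E2 t"
      "jet (deriv D) = fps_X\<^sup>2 * jet E2"
      using smooth_division_power[OF smooth_at_deriv[OF D0], of 2] jd by auto
    have jE2: "jet E2 = 0" using E2(3) jd by simp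
    then have E20: "E2 0 = 0" by (metis jet_nth_0 fps_zero_nth)
    define D2 where "D2 t = (if t = 0 then 0 else deriv D t / (3 * t\<^sup>2))" for t
    have ev: "\<forall>\<^sub>F t in nhds 0. (1/3) * E2 t = D2 t"
      using E2(2) by eventually_elim (auto simp: D2_def E20)
    have "smooth_at D2 t" if t: "t \<in> I" for t
    proof (cases "t = 0")
      case True
      show ?thesis unfolding True
        by (rule smooth_at_cong[OF ev]) (intro smooth_at_mult smooth_at_const E2)
    next
      case False
      have "\<forall>\<^sub>F s in nhds t. s \<noteq> 0" using False by (simp add: t1_space_nhds)
      then have "\<forall>\<^sub>F s in nhds t. deriv D s / (3 * s\<^sup>2) = D2 s" by eventually_elim (simp add: D2_def)
      then show ?thesis
        by (rule smooth_at_cong) (use False Suc.prems(1)[OF t] in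
          \<open>auto intro!: smooth_at_divide smooth_at_deriv smooth_at_mult smooth_at_power\<close>)
    qed
    moreover have "jet D2 = 0"
      using jet_cong[OF ev] jet_cmult[OF E2(1), of "1/3"] jE2 by simp
    ultimately have IH: "C_on n U (\<lambda>x. D2 (root 3 x))" by (rule Suc.IH)
    have der: "((\<lambda>x. D (root 3 x)) has_real_derivative D2 (root 3 x)) (at x)" if x: "x \<in> U" for x
    proof (cases "x = 0")
      case True
      have r: "filterlim (root 3) (nhds 0) (at 0)"
        using isCont_real_root[of 0 3] by (simp add: isCont_def)
      have "\<forall>\<^sub>F x in at 0. D (root 3 x) = root 3 x ^ 4 * E (root 3 x)"
        using E(2) r filterlim_iff by fast
      then have ev0: "\<forall>\<^sub>F x in at 0. root 3 x * E (root 3 x) = (D (root 3 x) - D (root 3 0)) / (x - 0)"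
      proof (rule eventually_mp[rotated])
        have D00: "D 0 = 0" using Suc.prems(2) jet_nth_0[of D] by simp
        show "\<forall>\<^sub>F x in at 0. D (root 3 x) = root 3 x ^ 4 * E (root 3 x) \<longrightarrow>
          root 3 x * E (root 3 x) = (D (root 3 x) - D (root 3 0)) / (x - 0)"
          unfolding eventually_at_filter
        proof (intro always_eventually allI impI)
          fix x :: real assume x: "x \<noteq> 0" and Dx: "D (root 3 x) = root 3 x ^ 4 * E (root 3 x)"
          have "root 3 x ^ 3 = x" by (simp add: odd_real_root_pow)
          then have "root 3 x ^ 4 = x * root 3 x" by (simp add: eval_nat_numeral mult_ac)
          then show "root 3 x * E (root 3 x) = (D (root 3 x) - D (root 3 0)) / (x - 0)"
            using x by (simp add: Dx D00)
        qed
      qed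
      have "((\<lambda>x. root 3 x * E (root 3 x)) \<longlongrightarrow> 0 * E 0) (at 0)"
        by (intro tendsto_mult r isCont_tendsto_compose[OF smooth_at_isCont[OF E(1)]])
      then have "((\<lambda>x. (D (root 3 x) - D (root 3 0)) / (x - 0)) \<longlongrightarrow> 0) (at 0)"
        using tendsto_cong[OF ev0] by simp
      then show ?thesis unfolding True has_field_derivative_iff by (simp add: D2_def)
    next
      case False
      have "(D has_real_derivative deriv D (root 3 x)) (at (root 3 x))"
        using Suc.prems(1)[of "root 3 x"] x by (auto simp: U_def intro: smooth_at_has_real_derivative)
      moreover have "(root 3 has_real_derivative inverse (real 3 * root 3 x ^ (3 - Suc 0))) (at x)"
        by (rule DERIV_odd_real_root) (use False in auto)
      ultimately have "((\<lambda>x. D (root 3 x)) has_real_derivative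
          deriv D (root 3 x) * inverse (real 3 * root 3 x ^ (3 - Suc 0))) (at x)"
        by (rule DERIV_chain2)
      moreover have "D2 (root 3 x) = deriv D (root 3 x) * inverse (real 3 * root 3 x ^ (3 - Suc 0))"
      proof -
        have aux: "a / (3 * b\<^sup>2) = a * inverse (real 3 * b ^ (3 - Suc 0))" for a b :: real
        proof -
          have n: "3 - Suc 0 = 2" "real 3 = 3" by simp_all
          show ?thesis unfolding n by (rule divide_inverse)
        qed
        have r0: "root 3 x \<noteq> 0" using False by simp
        show ?thesis by (simp only: D2_def aux r0 if_False)
      qed
      ultimately show ?thesis by (simp only:)
    qed
    show ?case
    proof (rule C_on_SucI[OF oU])
      show "((\<lambda>x. D (root 3 x)) has_derivative (\<lambda>h. D2 (root 3 x) * h)) (at x)" if "x \<in> U" for x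
        using der[OF that] by (simp add: has_field_derivative_def)
      show "C_on n U (\<lambda>x. D2 (root 3 x) * v)" for v
        by (rule C_on_bilinear[OF bounded_bilinear_mult oU IH C_on_const[OF oU]])
    qed
  qed
  have "C_on n U (\<lambda>x. D (root 3 x))" for n
    by (rule main[OF e(2) assms(2)]) (simp add: I_def dist_commute)
  moreover have "0 \<in> U" using e(1) by (simp add: U_def I_def)
  ultimately show ?thesis unfolding smooth_at_def using oU by blast
qed

lemma jet_cube_compose:
  assumes "smooth_at P 0" shows "jet (\<lambda>t. P (t ^ 3)) $ i = (if 3 dvd i then jet P $ (i div 3) else 0)"
proof -
  have "smooth_germ (\<lambda>t::real. t ^ 3)" by (simp add: smooth_germ_def smooth_at_power)
  then have "jet (\<lambda>t. P (t ^ 3)) = jet P oo jet (\<lambda>t. t ^ 3)" by (rule jet_compose[OF assms])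
  also have "jet (\<lambda>t::real. t ^ 3) = fps_X ^ 3" by (simp add: jet_power jet_ident)
  finally have "jet (\<lambda>t. P (t ^ 3)) $ i = (\<Sum>j\<in>{0..i}. if i = 3 * j then jet P $ j else 0)"
    by (simp add: fps_compose_nth power_mult[symmetric] fps_X_power_nth if_distrib cong: if_cong)
  also have "\<dots> = (\<Sum>j\<in>{0..i}. if j = i div 3 then (if 3 dvd i then jet P $ (i div 3) else 0) else 0)"
    by (rule sum.cong) auto
  also have "\<dots> = (if 3 dvd i then jet P $ (i div 3) else 0)" by simp
  finally show ?thesis .
qed

lemma smooth_at_cube_compose: "smooth_at P 0 \<Longrightarrow> smooth_at (\<lambda>t::real. P (t ^ 3)) (0::real)"
  by (rule smooth_at_compose[where f = P]) (auto intro: smooth_at_power)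

text \<open>An elementary substitute for the preparation theorem. Borel's lemma realises the three
  residue parts of the Taylor series by functions of t^3; the error is flat, hence itself a smooth
  function of t^3, and is absorbed into P.\<close>

lemma cube_decomposition:
  fixes Y :: "real \<Rightarrow> real"
  assumes he: "e = 1 \<or> e = 2" and Y: "smooth_at Y 0" "jet Y \<in> res_class e m n"
    and m: "m mod 3 = e" and n: "n mod 3 = 2 * e mod 3"
  obtains P Q R where "smooth_at P 0" "smooth_at Q 0" "smooth_at R 0"
    "\<forall>\<^sub>F t in nhds 0. Y t = P (t ^ 3) + t ^ m * Q (t ^ 3) + t ^ n * R (t ^ 3)"
    "P 0 = Y 0" "Q 0 = jet Y $ m" "R 0 = jet Y $ n"
proof -
  obtain P where P: "smooth_at P 0" "jet P = Abs_fps (\<lambda>i. jet Y $ (3 * i))" by (rule borel_lemma)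
  obtain Q where Q: "smooth_at Q 0" "jet Q = Abs_fps (\<lambda>i. jet Y $ (m + 3 * i))" by (rule borel_lemma)
  obtain R where R: "smooth_at R 0" "jet R = Abs_fps (\<lambda>i. jet Y $ (n + 3 * i))" by (rule borel_lemma)
  define D where "D t = Y t - (P (t ^ 3) + t ^ m * Q (t ^ 3) + t ^ n * R (t ^ 3))" for t
  note sm = smooth_at_diff smooth_at_add smooth_at_mult smooth_at_power smooth_at_cube_compose P(1) Q(1) R(1) Y(1)
  have sD: "smooth_at D 0" unfolding D_def by (intro sm smooth_at_ident)
  have jD: "jet D = jet Y - (jet (\<lambda>t. P (t ^ 3)) + fps_X ^ m * jet (\<lambda>t. Q (t ^ 3)) + fps_X ^ n * jet (\<lambda>t. R (t ^ 3)))"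
    unfolding D_def
    by (simp add: jet_diff jet_add jet_mult jet_power jet_ident sm)
  have dvd: "3 dvd (i - j) \<longleftrightarrow> i mod 3 = j mod 3" if "j \<le> i" for i j :: nat
    using that by (metis mod_eq_dvd_iff_nat)
  have "jet D $ i = 0" for i
  proof -
    have k: "i = j + 3 * ((i - j) div 3)" if "3 dvd (i - j)" "j \<le> i" for j using that by simp
    have "(fps_X ^ m * jet (\<lambda>t. Q (t ^ 3))) $ i = (if i mod 3 = e \<and> m \<le> i then jet Y $ i else 0)"
      using dvd[of m i] k[of m] m by (auto simp: fps_X_power_mult_nth jet_cube_compose Q)
    moreover have "(fps_X ^ n * jet (\<lambda>t. R (t ^ 3))) $ i = (if i mod 3 = 2 * e mod 3 \<and> n \<le> i then jet Y $ i else 0)"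
      using dvd[of n i] k[of n] n by (auto simp: fps_X_power_mult_nth jet_cube_compose R)
    moreover have "jet (\<lambda>t. P (t ^ 3)) $ i = (if i mod 3 = 0 then jet Y $ i else 0)"
      using dvd[of 0 i] k[of 0] by (auto simp: jet_cube_compose P)
    moreover have "i mod 3 = e \<Longrightarrow> \<not> m \<le> i \<Longrightarrow> jet Y $ i = 0" "i mod 3 = 2 * e mod 3 \<Longrightarrow> \<not> n \<le> i \<Longrightarrow> jet Y $ i = 0"
      using Y(2) by (auto simp: res_class_def)
    ultimately show ?thesis using he mod3_values[of i] unfolding jD by auto
  qed
  then have jD0: "jet D = 0" by (simp add: fps_eq_iff)
  have sP: "smooth_at (\<lambda>x. P x + D (root 3 x)) 0"
    by (intro smooth_at_add P smooth_at_flat_root sD jD0)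
  have D0: "D 0 = 0" using jD0 jet_nth_0[of D] by simp
  have nz: "m > 0" "n > 0" using mod3_pos[OF he] m n by auto
  show ?thesis
  proof (rule that[OF sP Q(1) R(1)])
    show "\<forall>\<^sub>F t in nhds 0. Y t = P (t ^ 3) + D (root 3 (t ^ 3)) + t ^ m * Q (t ^ 3) + t ^ n * R (t ^ 3)"
      by (simp add: odd_real_root_power_cancel D_def)
    show "P 0 + D (root 3 0) = Y 0" using D0 nz by (simp add: D_def power_0_left)
    show "Q 0 = jet Y $ m" using Q(2) jet_nth_0[of Q] by simp
    show "R 0 = jet Y $ n" using R(2) jet_nth_0[of R] by simp
  qed
qed

subsection \<open>Coordinate changes\<close>

lemma smooth_at_fst_compose: "smooth_at P 0 \<Longrightarrow> smooth_at (\<lambda>p::real \<times> real. P (fst p)) 0"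
  for P :: "real \<Rightarrow> 'c::real_normed_vector"
  by (rule smooth_at_compose[where f = P]) (auto intro: smooth_at_fst)

lemma smooth_at_fst_snd [simp]: "smooth_at fst p" "smooth_at snd p"
  by (auto intro: smooth_at_linear bounded_linear_fst bounded_linear_snd)

lemma smooth_germ_plane:
  fixes F G :: "real \<times> real \<Rightarrow> real"
  assumes "smooth_at F 0" "smooth_at G 0" "F 0 = 0" "G 0 = 0"
  shows "smooth_germ (\<lambda>p. (F p, G p))"
  using assms by (auto simp: smooth_germ_def smooth_at_Pair zero_prod_def)

lemma diffeo_germ_linear_plane:
  assumes "a * d - b * c \<noteq> (0::real)"
  shows "diffeo_germ (\<lambda>p. (a * fst p + b * snd p, c * fst p + d * snd p))"
proof (rule diffeo_germI)
  let ?D = "a * d - b * c"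
  show "smooth_germ (\<lambda>p. (a * fst p + b * snd p, c * fst p + d * snd p))"
    by (rule smooth_germ_plane; (intro smooth_at_add smooth_at_mult smooth_at_const smooth_at_fst_snd)?) simp_all
  show "smooth_germ (\<lambda>p. (d / ?D * fst p + (- b / ?D) * snd p, (- c / ?D) * fst p + a / ?D * snd p))"
    by (rule smooth_germ_plane; (intro smooth_at_add smooth_at_mult smooth_at_const smooth_at_fst_snd)?) simp_all
  have e: "d / ?D * (a * x + b * y) + (- b / ?D) * (c * x + d * y) = x"
    "(- c / ?D) * (a * x + b * y) + a / ?D * (c * x + d * y) = y"
    "a * (d / ?D * x + (- b / ?D) * y) + b * ((- c / ?D) * x + a / ?D * y) = x"
    "c * (d / ?D * x + (- b / ?D) * y) + d * ((- c / ?D) * x + a / ?D * y) = y" for x y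
    using assms by (simp_all add: divide_simps) (simp_all add: algebra_simps)
  show "\<forall>\<^sub>F p in nhds 0. (\<lambda>p. (d / ?D * fst p + (- b / ?D) * snd p, (- c / ?D) * fst p + a / ?D * snd p))
      (a * fst p + b * snd p, c * fst p + d * snd p) = p"
    by (simp only: fst_conv snd_conv e prod.collapse) simp
  show "\<forall>\<^sub>F p in nhds 0. (a * fst (d / ?D * fst p + (- b / ?D) * snd p, (- c / ?D) * fst p + a / ?D * snd p)
      + b * snd (d / ?D * fst p + (- b / ?D) * snd p, (- c / ?D) * fst p + a / ?D * snd p),
      c * fst (d / ?D * fst p + (- b / ?D) * snd p, (- c / ?D) * fst p + a / ?D * snd p) +
      d * snd (d / ?D * fst p + (- b / ?D) * snd p, (- c / ?D) * fst p + a / ?D * snd p)) = p"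
    by (simp only: fst_conv snd_conv e prod.collapse) simp
qed

lemma A_equiv_triangular:
  assumes P: "smooth_at P 0" "P 0 = 0" and Q: "smooth_at Q 0" "Q 0 \<noteq> (0::real)" and x: "smooth_germ x"
  shows "A_equiv (\<lambda>t. (x t, y t)) (\<lambda>t. (x t, (y t - P (x t)) / Q (x t)))"
proof (rule A_equivI[OF diffeo_germ_ident])
  let ?f = "\<lambda>p::real \<times> real. (fst p, Q (fst p) * snd p + P (fst p))"
  let ?g = "\<lambda>p::real \<times> real. (fst p, (snd p - P (fst p)) / Q (fst p))"
  have nz: "\<forall>\<^sub>F p in nhds (0::real \<times> real). Q (fst p) \<noteq> 0"
    by (rule eventually_nhds_nonzero) (use Q in \<open>auto intro: smooth_at_fst_compose\<close>)
  show "diffeo_germ ?f"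
  proof (rule diffeo_germI)
    show "smooth_germ ?f"
      by (rule smooth_germ_plane) (use P Q in \<open>auto intro!: smooth_at_add smooth_at_mult smooth_at_fst_compose\<close>)
    show "smooth_germ ?g"
      by (rule smooth_germ_plane) (use P Q in \<open>auto intro!: smooth_at_diff smooth_at_divide smooth_at_fst_compose\<close>)
    show "\<forall>\<^sub>F p in nhds 0. ?g (?f p) = p" using nz by eventually_elim simp
    show "\<forall>\<^sub>F p in nhds 0. ?f (?g p) = p" using nz by eventually_elim simp
  qed
  show "\<forall>\<^sub>F t in nhds 0. (x t, y t) = ?f (x t, (y t - P (x t)) / Q (x t))"
    using eventually_germ[OF x eventually_nhds_nonzero[OF Q]] by eventually_elim simp
qed

lemma diffeo_germ_times:
  fixes r :: "real \<Rightarrow> real"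
  assumes "smooth_at r 0" "r 0 \<noteq> 0" shows "diffeo_germ (\<lambda>x. x * r x)" "deriv (\<lambda>x. x * r x) 0 = r 0"
proof -
  have "((\<lambda>x. x * r x) has_real_derivative 0 * deriv r 0 + 1 * r 0) (at 0)"
    by (rule DERIV_mult'[OF DERIV_ident smooth_at_has_real_derivative[OF assms(1)]])
  then show D: "deriv (\<lambda>x. x * r x) 0 = r 0" by (simp add: DERIV_imp_deriv)
  show "diffeo_germ (\<lambda>x. x * r x)"
    by (rule diffeo_germ_real) (use assms D in \<open>auto simp: smooth_germ_def intro: smooth_at_mult\<close>)
qed

lemma powr_root_power: "x > 0 \<Longrightarrow> n > 0 \<Longrightarrow> (x powr (1 / real n)) ^ n = x"
  by (simp add: powr_realpow[symmetric] powr_powr)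

text \<open>Write X = t^3 g with g(0) = c. The ratio g/c is near 1 for either sign of c, so its cube
  root r is smooth, and t r is the parameter.\<close>

lemma cube_root_parameter:
  fixes X :: "real \<Rightarrow> real"
  assumes X: "smooth_at X 0" "X 0 = 0" "jet X $ 1 = 0" "jet X $ 2 = 0" "jet X $ 3 = c" and c: "c \<noteq> 0"
  obtains h where "diffeo_germ h" "\<forall>\<^sub>F t in nhds 0. X t = c * h t ^ 3" "deriv h 0 = 1"
proof -
  have "jet X $ i = 0" if "i < 3" for i
  proof -
    have "i = 0 \<or> i = 1 \<or> i = 2" using that by linarith
    then show ?thesis using X by auto
  qed
  then obtain g where g: "smooth_at g 0" "\<forall>\<^sub>F t in nhds 0. X t = t ^ 3 * g t" "jet X = fps_X ^ 3 * jet g"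
    using smooth_division_power[OF X(1), of 3] by blast
  have g0: "g 0 = c" using g(3) X(5) by (simp add: fps_X_power_mult_nth)
  define r where "r t = (g t / c) powr (1 / real 3)" for t
  have r0: "r 0 = 1" using g0 c by (simp add: r_def)
  have sg: "smooth_at (\<lambda>t. g t / c) 0" using g(1) c by (intro smooth_at_divide) auto
  have sr: "smooth_at r 0" unfolding r_def by (rule smooth_at_powr'[OF sg]) (use g0 c in simp)
  have "\<forall>\<^sub>F t in nhds 0. g t / c > 0" by (rule eventually_nhds_pos[OF sg]) (use g0 c in simp)
  then have "\<forall>\<^sub>F t in nhds 0. X t = c * (t * r t) ^ 3"
    using g(2)
  proof eventually_elim
    case (elim t)
    then have "r t ^ 3 = g t / c" unfolding r_def by (intro powr_root_power) auto
    then show ?case using elim c by (simp add: power_mult_distrib)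
  qed
  then show ?thesis using that[of "\<lambda>t. t * r t"] diffeo_germ_times[OF sr] r0 by simp
qed

lemma cube_parametrisation:
  fixes X Y :: "real \<Rightarrow> real"
  assumes X: "smooth_at X 0" "X 0 = 0" "jet X $ 1 = 0" "jet X $ 2 = 0" "jet X $ 3 = c" and c: "c \<noteq> 0"
  obtains h k where "diffeo_germ h" "diffeo_germ k" "\<forall>\<^sub>F s in nhds 0. h (k s) = s" "\<forall>\<^sub>F t in nhds 0. k (h t) = t"
    "\<forall>\<^sub>F t in nhds 0. X t = c * h t ^ 3" "deriv h 0 = 1"
    "A_equiv (\<lambda>t. (X t, Y t)) (\<lambda>s. (s ^ 3, Y (k s)))"
proof -
  obtain h where h: "diffeo_germ h" "\<forall>\<^sub>F t in nhds 0. X t = c * h t ^ 3" "deriv h 0 = 1"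
    using cube_root_parameter[OF assms] .
  obtain k where k: "diffeo_germ k" "\<forall>\<^sub>F t in nhds 0. k (h t) = t" "\<forall>\<^sub>F s in nhds 0. h (k s) = s"
    using h(1) by (rule diffeo_germ_inverse)
  have "diffeo_germ (\<lambda>p. (c * fst p + 0 * snd p, 0 * fst p + 1 * snd p))"
    by (rule diffeo_germ_linear_plane) (use c in simp)
  moreover have "\<forall>\<^sub>F s in nhds 0. X (k s) = c * s ^ 3"
    using eventually_germ[OF diffeo_germ_smooth[OF k(1)] h(2)] k(3) by eventually_elim simp
  then have "\<forall>\<^sub>F s in nhds 0. (X (k s), Y (k s)) = (\<lambda>p. (c * fst p + 0 * snd p, 0 * fst p + 1 * snd p)) (s ^ 3, Y (k s))"
    by eventually_elim simp
  ultimately have "A_equiv (\<lambda>t. (X t, Y t)) (\<lambda>s. (s ^ 3, Y (k s)))"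
    by (rule A_equivI[OF k(1)])
  then show ?thesis using that h k by blast
qed

subsection \<open>Normal forms of curves of multiplicity three\<close>

lemma smooth_germ_power: "n > 0 \<Longrightarrow> smooth_germ (\<lambda>t::real. t ^ n)"
  by (simp add: smooth_germ_def smooth_at_power)

lemma smooth_germ_cube: "smooth_germ (\<lambda>t::real. t ^ 3)"
  by (rule smooth_germ_power) simp

text \<open>For q^(n-m) \<epsilon> = V the source change h(t) = t q(t^3) sends the binomial curve to
  (t^3 q^3, q^m (t^m + t^n V)). The extra factors are functions of t^3, so a target change undoes
  them.\<close>

lemma A_equiv_binomial:
  fixes V :: "real \<Rightarrow> real"
  assumes V: "smooth_at V 0" "V 0 \<noteq> 0" and mn: "0 < m" "m < n" and l: "l ^ (n - m) * \<epsilon> = V 0"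
  shows "A_equiv (\<lambda>t. (t ^ 3, t ^ m + t ^ n * V (t ^ 3))) (\<lambda>t. (t ^ 3, t ^ m + \<epsilon> * t ^ n))"
proof -
  define q where "q x = l * (V x / V 0) powr (1 / real (n - m))" for x
  have l0: "l \<noteq> 0" using l V(2) mn by (auto simp: power_0_left)
  have q0: "q 0 = l" using V by (simp add: q_def)
  have sV: "smooth_at (\<lambda>x. V x / V 0) 0" using V by (intro smooth_at_divide) auto
  have sq: "smooth_at q 0"
    unfolding q_def by (intro smooth_at_mult smooth_at_powr'[OF sV]) (use V in auto)
  have "\<forall>\<^sub>F x in nhds 0. V x / V 0 > 0" by (rule eventually_nhds_pos[OF sV]) (use V in simp)
  then have qV: "\<forall>\<^sub>F x in nhds 0. q x ^ (n - m) * \<epsilon> = V x"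
  proof eventually_elim
    case (elim x)
    have "((V x / V 0) powr (1 / real (n - m))) ^ (n - m) = V x / V 0"
      by (rule powr_root_power) (use elim mn in auto)
    then have "q x ^ (n - m) * \<epsilon> = (l ^ (n - m) * \<epsilon>) * (V x / V 0)" by (simp add: q_def power_mult_distrib)
    then show ?case using l V by simp
  qed
  define h where "h t = t * q (t ^ 3)" for t :: real
  have dh: "diffeo_germ h" unfolding h_def
    by (rule diffeo_germ_times) (use sq q0 l0 in \<open>auto intro: smooth_at_cube_compose\<close>)
  define \<xi> where "\<xi> x = x * q x ^ 3" for x
  have "diffeo_germ \<xi>" unfolding \<xi>_def
    by (rule diffeo_germ_times) (use sq q0 l0 in \<open>auto intro: smooth_at_power\<close>)
  then obtain \<eta> where \<eta>: "diffeo_germ \<eta>" "\<forall>\<^sub>F x in nhds 0. \<eta> (\<xi> x) = x" "\<forall>\<^sub>F x in nhds 0. \<xi> (\<eta> x) = x"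
    by (rule diffeo_germ_inverse)
  have s\<eta>: "smooth_at \<eta> 0" "\<eta> 0 = 0" using \<eta>(1) by (auto simp: smooth_germ_def dest: diffeo_germ_smooth)
  have sq\<eta>: "smooth_at (\<lambda>x. q (\<eta> x)) 0" by (rule smooth_at_compose[where f = q]) (use s\<eta> sq in auto)
  let ?f = "\<lambda>p::real \<times> real. (\<xi> (fst p), snd p * q (fst p) ^ m)"
  let ?g = "\<lambda>p::real \<times> real. (\<eta> (fst p), snd p / q (\<eta> (fst p)) ^ m)"
  have df: "diffeo_germ ?f"
  proof (rule diffeo_germI)
    have s\<xi>: "smooth_at \<xi> 0" unfolding \<xi>_def by (intro smooth_at_mult smooth_at_power sq smooth_at_ident)
    show "smooth_germ ?f"
      by (rule smooth_germ_plane)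
         (use s\<xi> sq in \<open>auto intro!: smooth_at_mult smooth_at_power smooth_at_fst_compose simp: \<xi>_def\<close>)
    show "smooth_germ ?g"
      by (rule smooth_germ_plane)
         (use s\<eta> sq\<eta> q0 l0 in \<open>auto intro!: smooth_at_divide smooth_at_power smooth_at_fst_compose\<close>)
    have fst0: "filterlim fst (nhds (0::real)) (nhds (0::real \<times> real))"
      using tendsto_fst[OF filterlim_ident, of "0 :: real \<times> real"] by simp
    have ev: "\<forall>\<^sub>F p in nhds (0::real \<times> real). Q (fst p)" if "\<forall>\<^sub>F x in nhds 0. Q x" for Q :: "real \<Rightarrow> bool"
      using fst0 that filterlim_iff by fast
    have "\<forall>\<^sub>F x in nhds 0. q x \<noteq> 0" by (rule eventually_nhds_nonzero[OF sq]) (use q0 l0 in simp)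
    from ev[OF this] ev[OF \<eta>(2)] show "\<forall>\<^sub>F p in nhds 0. ?g (?f p) = p" by eventually_elim simp
    have "\<forall>\<^sub>F x in nhds 0. q (\<eta> x) \<noteq> 0" by (rule eventually_nhds_nonzero[OF sq\<eta>]) (use s\<eta> q0 l0 in simp)
    from ev[OF this] ev[OF \<eta>(3)] show "\<forall>\<^sub>F p in nhds 0. ?f (?g p) = p" by eventually_elim simp
  qed
  have "\<forall>\<^sub>F t in nhds 0. (\<lambda>t. (t ^ 3, t ^ m + \<epsilon> * t ^ n)) (h t) = ?f (t ^ 3, t ^ m + t ^ n * V (t ^ 3))"
    using eventually_germ[OF smooth_germ_cube qV]
  proof eventually_elim
    case (elim t)
    let ?q = "q (t ^ 3)"
    have "n = m + (n - m)" using mn by simp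
    then have "?q ^ n * \<epsilon> = ?q ^ m * V (t ^ 3)" using elim[simplified] by (metis mult.assoc power_add)
    then have "\<epsilon> * h t ^ n = t ^ n * V (t ^ 3) * ?q ^ m"
      by (simp add: h_def power_mult_distrib mult_ac)
    then show ?case by (simp add: h_def \<xi>_def power_mult_distrib distrib_right)
  qed
  then have "A_equiv (\<lambda>t. (t ^ 3, t ^ m + \<epsilon> * t ^ n)) (\<lambda>t. (t ^ 3, t ^ m + t ^ n * V (t ^ 3)))"
    by (rule A_equivI[OF dh df])
  then show ?thesis
  proof (rule A_equiv_sym)
    have "smooth_at (\<lambda>t. (t ^ 3, t ^ m + t ^ n * V (t ^ 3))) 0"
      by (intro smooth_at_Pair smooth_at_add smooth_at_mult smooth_at_power smooth_at_ident smooth_at_cube_compose V)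
    then show "isCont (\<lambda>t. (t ^ 3, t ^ m + t ^ n * V (t ^ 3))) 0" by (rule smooth_at_isCont)
  qed (use mn in \<open>auto simp: zero_prod_def power_0_left\<close>)
qed

text \<open>In the decomposition over t^3 one subtracts P and divides by Q, a unit because Q(0) is
  the coefficient of degree m.\<close>

lemma A_equiv_cube_normalise:
  fixes Y :: "real \<Rightarrow> real"
  assumes he: "e = 1 \<or> e = 2" and Y: "smooth_germ Y" "jet Y \<in> res_class e m n" "jet Y $ m \<noteq> 0"
    and m: "m mod 3 = e" and n: "n mod 3 = 2 * e mod 3"
  obtains V where "smooth_at V 0" "V 0 = jet Y $ n / jet Y $ m"
    "A_equiv (\<lambda>t. (t ^ 3, Y t)) (\<lambda>t. (t ^ 3, t ^ m + t ^ n * V (t ^ 3)))"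
proof -
  have Y0: "smooth_at Y 0" "Y 0 = 0" using Y(1) by (auto simp: smooth_germ_def)
  obtain P Q R where PQR: "smooth_at P 0" "smooth_at Q 0" "smooth_at R 0"
    "\<forall>\<^sub>F t in nhds 0. Y t = P (t ^ 3) + t ^ m * Q (t ^ 3) + t ^ n * R (t ^ 3)"
    "P 0 = Y 0" "Q 0 = jet Y $ m" "R 0 = jet Y $ n"
    using cube_decomposition[OF he Y0(1) Y(2) m n] .
  have Q0: "Q 0 \<noteq> 0" using PQR(6) Y(3) by simp
  have "A_equiv (\<lambda>t. (t ^ 3, Y t)) (\<lambda>t. (t ^ 3, (Y t - P (t ^ 3)) / Q (t ^ 3)))"
    by (rule A_equiv_triangular[OF PQR(1) _ PQR(2) Q0 smooth_germ_power]) (use PQR(5) Y0 in auto)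
  also have "\<forall>\<^sub>F t in nhds 0. (t ^ 3, (Y t - P (t ^ 3)) / Q (t ^ 3)) = (t ^ 3, t ^ m + t ^ n * (R (t ^ 3) / Q (t ^ 3)))"
    using PQR(4) eventually_germ[OF smooth_germ_cube eventually_nhds_nonzero[OF PQR(2) Q0], simplified]
    by eventually_elim (simp add: field_simps)
  note A_equiv_trans[OF calculation A_equiv_cong[OF this]]
  moreover have "smooth_at (\<lambda>x. R x / Q x) 0" by (rule smooth_at_divide[OF PQR(3,2) Q0])
  ultimately show ?thesis using that[of "\<lambda>x. R x / Q x"] PQR(6,7) by simp
qed

text \<open>Scaling t by l multiplies the ratio of the two coefficients by a power of l with
  exponent n - m in absolute value, so for odd n - m even its sign can be scaled away.\<close>

lemma A_equiv_binomial_exists: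
  fixes Y :: "real \<Rightarrow> real"
  assumes he: "e = 1 \<or> e = 2" and Y: "smooth_germ Y" "jet Y \<in> res_class e m n" "jet Y $ m \<noteq> 0" "jet Y $ n \<noteq> 0"
    and m: "m mod 3 = e" and n: "n mod 3 = 2 * e mod 3" "m < n"
  shows "A_equiv (\<lambda>t. (t ^ 3, Y t))
    (\<lambda>t. (t ^ 3, t ^ m + (if odd (n - m) then 1 else sgn (jet Y $ n / jet Y $ m)) * t ^ n))"
proof -
  let ?r = "jet Y $ n / jet Y $ m" and ?e = "if odd (n - m) then 1 else sgn (jet Y $ n / jet Y $ m)"
  obtain V where V: "smooth_at V 0" "V 0 = ?r"
    "A_equiv (\<lambda>t. (t ^ 3, Y t)) (\<lambda>t. (t ^ 3, t ^ m + t ^ n * V (t ^ 3)))"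
    by (rule A_equiv_cube_normalise[OF he Y(1-3) m n(1)])
  define l where "l = (if odd (n - m) then root (n - m) ?r else root (n - m) \<bar>?r\<bar>)"
  have "l ^ (n - m) * ?e = V 0"
  proof (cases "odd (n - m)")
    case True
    then show ?thesis by (simp add: l_def V(2) odd_real_root_pow)
  next
    case False
    then have "l ^ (n - m) = \<bar>?r\<bar>" using n(2) by (simp add: l_def real_root_pow_pos2 del: abs_divide)
    then show ?thesis using False abs_mult_sgn[of ?r] V(2) by (simp del: abs_divide sgn_divide)
  qed
  moreover have "m > 0" using mod3_pos[OF he] m by blast
  ultimately show ?thesis
    using A_equiv_trans[OF V(3) A_equiv_binomial[OF V(1), of m n l ?e]] V(2) Y n(2) by simp
qed

text \<open>Replacing t^3 by t^3 + \<mu> y leads to a new parameter t w with w_p = \<mu>/3, and this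
  alters degree 2p + 3 of the second component by (p + 3) \<mu>/3. The hypothesis on y in that
  degree says that \<mu> is chosen to cancel it.\<close>

lemma shear_jet:
  fixes y a w :: "real fps"
  assumes he: "e = 1 \<or> e = 2" and p: "0 < p" "p mod 3 = e"
    and y: "y \<in> res_class e (p + 3) (2 * p + 3)" "y $ 0 = 0" "y $ 3 = 0" "y $ (p + 3) = 1"
      "y $ (2 * p + 3) = \<mu> * real (p + 3) / 3"
    and w: "fps_X ^ 3 * w ^ 3 = fps_X ^ 3 + fps_const \<mu> * y" and a: "a oo (fps_X * w) = y"
  shows "a \<in> res_class e (p + 3) (2 * p + 6)" "a $ (p + 3) = 1"
proof -
  have pq: "p \<le> 2 * p" "2 * p \<le> 2 * p" by auto
  have w3: "(w ^ 3) $ i = (if i = 0 then 1 else 0) + \<mu> * y $ (i + 3)" for i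
  proof -
    have "(w ^ 3) $ i = (fps_X ^ 3 * w ^ 3) $ (i + 3)" by (simp add: fps_X_power_mult_nth)
    then show ?thesis unfolding w by (simp add: fps_X_power_nth)
  qed
  have c0: "(w $ 0) ^ 3 = 1" using w3[of 0] y(3) by (simp add: fps_nth_power_0)
  have "w $ 0 = root 3 ((w $ 0) ^ 3)" by (simp add: odd_real_root_power_cancel)
  then have w0: "w $ 0 = 1" unfolding c0 by simp
  have "fps_X ^ 3 * w ^ 3 \<in> res_class e (p + 3) (2 * p + 3)"
    unfolding w by (intro res_class_add res_class_cmult y(1)) (use he in \<open>auto simp: res_class_def\<close>)
  then have "w ^ 3 \<in> res_class e p (2 * p)" by (simp only: res_class_shift)
  then have wR: "w \<in> res_class e p (2 * p)" by (rule res_class_cube_root[OF he pq]) (simp add: w0)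
  have aR: "a \<in> res_class e (p + 3) (2 * p + 3)"
    by (rule res_class_subst_cancel[OF he pq wR]) (use w0 a y(1) in auto)
  have a12: "a $ 1 = 0" "a $ 2 = 0" using aR he p(1) by (auto simp: res_class_def)
  have "(a oo (fps_X * w)) $ 3 = (\<Sum>i\<in>{0..3}. a $ i * (w ^ i) $ (3 - i))" by (rule compose_X_mult_nth)
  also have "\<dots> = (\<Sum>i\<in>{3}. a $ i * (w ^ i) $ (3 - i))"
  proof (rule sum.mono_neutral_right)
    show "\<forall>i\<in>{0..3} - {3}. a $ i * (w ^ i) $ (3 - i) = 0"
    proof
      fix i :: nat assume "i \<in> {0..3} - {3}"
      then have "i = 0 \<or> i = 1 \<or> i = 2" by auto
      then show "a $ i * (w ^ i) $ (3 - i) = 0" using a12 by auto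
    qed
  qed auto
  finally have a3: "a $ 3 = 0" using a y(3) w0 by (simp add: fps_nth_power_0)
  show ap: "a $ (p + 3) = 1"
    using subst_nth_e[OF he p(1) pq wR w0 aR p(2)] a y(4) a3 by simp
  have "3 * w $ p = \<mu>" using power_nth_e[OF he pq wR w0 p(2), of 3] w3[of p] y(4) p(1) by simp
  then have a2: "a $ (2 * p + 3) = 0"
    using subst_nth_2e_top[OF he p wR w0 aR] a y(5) a3 ap by (simp add: field_simps)
  show "a \<in> res_class e (p + 3) (2 * p + 6)"
  proof (rule res_classI)
    fix i assume i: "i mod 3 = 2 * e mod 3" "i < 2 * p + 6"
    have q: "(2 * p + 3) mod 3 = 2 * e mod 3" using p by (metis mod_mult_right_eq mod_add_self2)
    \<comment> \<open>Exponents of one residue lie 3 apart, so 2p + 3 is the only new one below 2p +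
      6.\<close>
    have "i < 2 * p + 3 \<or> i = 2 * p + 3"
    proof (rule ccontr)
      assume "\<not> (i < 2 * p + 3 \<or> i = 2 * p + 3)"
      then have "2 * p + 3 < i" by simp
      then obtain j where j: "i = (2 * p + 3) + j" "0 < j" using less_imp_add_positive by metis
      have "j < 3" using j i(2) by simp
      have "(2 * p + 3 + j) mod 3 = (2 * p + 3) mod 3" using q i(1) unfolding j(1) by simp
      then have "3 dvd (2 * p + 3) + j - (2 * p + 3)" by (metis mod_eq_dvd_iff_nat le_add1)
      then show False using j \<open>j < 3\<close> by (auto dest: dvd_imp_le)
    qed
    then show "a $ i = 0" using a2 res_classD(2)[OF aR i(1)] by auto
  qed (rule res_classD(1)[OF aR])
qed

text \<open>The small root of a y^2 - y + v = 0, written so that a = 0 is allowed. The hypothesis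
  fixes the sign of the square root.\<close>

lemma solve_quadratic:
  fixes a b :: real
  assumes "1 - 2 * a * b > 0"
  shows "2 * (b - a * b\<^sup>2) / (1 + sqrt (1 - 4 * a * (b - a * b\<^sup>2))) = b"
proof -
  have "1 - 4 * a * (b - a * b\<^sup>2) = (1 - 2 * a * b)\<^sup>2" by (simp add: power2_eq_square algebra_simps)
  then have s: "sqrt (1 - 4 * a * (b - a * b\<^sup>2)) = 1 - 2 * a * b" using assms by simp
  have e: "1 + (1 - 2 * a * b) = 2 * (1 - a * b)" "b - a * b\<^sup>2 = b * (1 - a * b)"
    by (simp_all add: power2_eq_square algebra_simps)
  have "1 - a * b \<noteq> 0" using assms by auto
  then show ?thesis unfolding s unfolding e by (simp only: mult_divide_mult_cancel_left_if nonzero_mult_div_cancel_right) simp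
qed

text \<open>Here the leading exponent is m = p + 3. Degree 2m - 3 is removed by a shear of the
  target; everything of residue 2e from degree 2m on has the form t^(2m) W(t^3) and is removed by
  subtracting W(x) y^2.\<close>

lemma A_equiv_monomial:
  fixes Y :: "real \<Rightarrow> real"
  assumes he: "e = 1 \<or> e = 2" and p: "0 < p" "p mod 3 = e"
    and Y: "smooth_germ Y" "jet Y \<in> res_class e (p + 3) (2 * p + 3)" "jet Y $ (p + 3) \<noteq> 0"
  shows "A_equiv (\<lambda>t. (t ^ 3, Y t)) (\<lambda>t. (t ^ 3, t ^ (p + 3)))"
proof -
  define m where "m = p + 3"
  have m: "m mod 3 = e" using p by (simp add: m_def)
  have n: "(2 * p + 3) mod 3 = 2 * e mod 3" "(2 * m) mod 3 = 2 * e mod 3"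
    using p m by (metis mod_mult_right_eq mod_add_self2, metis mod_mult_right_eq)
  obtain V where V: "smooth_at V 0" "V 0 = jet Y $ (2 * p + 3) / jet Y $ m"
    "A_equiv (\<lambda>t. (t ^ 3, Y t)) (\<lambda>t. (t ^ 3, t ^ m + t ^ (2 * p + 3) * V (t ^ 3)))"
    using A_equiv_cube_normalise[OF he Y(1) Y(2)[folded m_def] Y(3)[folded m_def] m n(1)] .
  define y where "y t = t ^ m + t ^ (2 * p + 3) * V (t ^ 3)" for t
  have sy: "smooth_at y 0" unfolding y_def
    by (intro smooth_at_add smooth_at_mult smooth_at_power smooth_at_ident smooth_at_cube_compose V)
  have y0: "y 0 = 0" by (simp add: y_def m_def power_0_left)
  have jy: "jet y = fps_X ^ m + fps_X ^ (2 * p + 3) * jet (\<lambda>t. V (t ^ 3))"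
    unfolding y_def by (simp add: jet_add jet_mult jet_power jet_ident smooth_at_mult smooth_at_power smooth_at_cube_compose V)
  have ym: "jet y $ m = 1" using p(1) unfolding jy by (simp add: fps_X_power_nth fps_X_power_mult_nth m_def)
  have low: "jet y $ i = 0" if "i < m" for i
    using that p(1) unfolding jy by (simp add: fps_X_power_nth fps_X_power_mult_nth m_def)
  have yR: "jet y \<in> res_class e m (2 * p + 3)"
  proof (rule res_classI)
    fix i assume i: "i mod 3 = 2 * e mod 3" "i < 2 * p + 3"
    have "i \<noteq> m" using i(1) m he by auto
    then show "jet y $ i = 0" using i unfolding jy by (simp add: fps_X_power_nth fps_X_power_mult_nth)
  qed (use low in auto)
  define \<mu> where "\<mu> = 3 * jet y $ (2 * p + 3) / real m"
  define x where "x t = t ^ 3 + \<mu> * y t" for t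
  have sx: "smooth_at x 0" unfolding x_def by (intro smooth_at_add smooth_at_power smooth_at_mult sy) auto
  have jx: "jet x = fps_X ^ 3 + fps_const \<mu> * jet y"
    unfolding x_def by (simp add: jet_add jet_cmult jet_power jet_ident smooth_at_mult smooth_at_power sy)
  have m3: "m > 3" using p(1) by (simp add: m_def)
  have x3: "x 0 = 0" "jet x $ 1 = 0" "jet x $ 2 = 0" "jet x $ 3 = 1"
    using low m3 y0 unfolding jx by (auto simp: x_def fps_X_power_nth)
  obtain h k where hk: "diffeo_germ h" "diffeo_germ k" "\<forall>\<^sub>F s in nhds 0. h (k s) = s"
    "\<forall>\<^sub>F t in nhds 0. k (h t) = t" "\<forall>\<^sub>F t in nhds 0. x t = 1 * h t ^ 3" "deriv h 0 = 1"
    "A_equiv (\<lambda>t. (x t, y t)) (\<lambda>s. (s ^ 3, y (k s)))"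
    using cube_parametrisation[OF sx x3 , of y] by auto
  have sh: "smooth_germ h" "smooth_germ k" using hk by (auto dest: diffeo_germ_smooth)
  have k0: "smooth_at k 0" "k 0 = 0" using sh(2) by (simp_all add: smooth_germ_def)
  have syk: "smooth_at (\<lambda>s. y (k s)) 0" "y (k 0) = 0"
    using smooth_at_compose[of y k 0] k0 sy y0 by simp_all
  define w where "w = fps_shift 1 (jet h)"
  have hw: "jet h = fps_X * w"
    unfolding w_def by (rule fps_eq_X_mult) (use sh in \<open>simp add: smooth_germ_def\<close>)
  have "jet x = jet (\<lambda>t. h t ^ 3)" by (rule jet_cong) (use hk(5) in simp)
  then have w3: "fps_X ^ 3 * w ^ 3 = fps_X ^ 3 + fps_const \<mu> * jet y"
    using jx hw sh by (simp add: jet_power smooth_germ_def power_mult_distrib)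
  have "jet (\<lambda>t. y (k (h t))) = jet (\<lambda>s. y (k s)) oo jet h"
    by (rule jet_compose[OF syk(1) sh(1)])
  moreover have "jet (\<lambda>t. y (k (h t))) = jet y"
    by (rule jet_cong) (use hk(4) in \<open>eventually_elim, simp\<close>)
  ultimately have yw: "jet (\<lambda>s. y (k s)) oo (fps_X * w) = jet y" unfolding hw by simp
  have y03: "jet y $ 0 = 0" "jet y $ 3 = 0" using low m3 y0 by auto
  have "jet y $ (2 * p + 3) = \<mu> * real (p + 3) / 3" using m3 by (simp add: \<mu>_def m_def)
  note R = shear_jet[OF he p yR[unfolded m_def] y03 ym[unfolded m_def] this w3 yw]
  have 2: "A_equiv (\<lambda>t. (t ^ 3, y t)) (\<lambda>t. (x t, y t))"
  proof -
    have "diffeo_germ (\<lambda>q. (1 * fst q + (- \<mu>) * snd q, 0 * fst q + 1 * snd q))"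
      by (rule diffeo_germ_linear_plane) simp
    from A_equiv_target[OF this, of "\<lambda>t. (x t, y t)"] show ?thesis by (simp add: x_def)
  qed
  have R': "jet (\<lambda>s. y (k s)) \<in> res_class e m (2 * m)" "jet (\<lambda>s. y (k s)) $ m \<noteq> 0"
    using R by (simp_all add: m_def)
  have gyk: "smooth_germ (\<lambda>s. y (k s))" using syk by (simp add: smooth_germ_def)
  obtain W where W: "smooth_at W 0" "W 0 = jet (\<lambda>s. y (k s)) $ (2 * m) / jet (\<lambda>s. y (k s)) $ m"
    "A_equiv (\<lambda>s. (s ^ 3, y (k s))) (\<lambda>t. (t ^ 3, t ^ m + t ^ (2 * m) * W (t ^ 3)))"
    using A_equiv_cube_normalise[OF he gyk R' m n(2)] .
  define z where "z t = t ^ m + t ^ (2 * m) * W (t ^ 3)" for t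
  have sz: "smooth_at z 0" unfolding z_def
    by (intro smooth_at_add smooth_at_mult smooth_at_power smooth_at_ident smooth_at_cube_compose W)
  \<comment> \<open>\<open>?g\<close> inverts \<open>?f\<close> by the quadratic formula.\<close>
  let ?f = "\<lambda>q::real \<times> real. (fst q, snd q - W (fst q) * (snd q)\<^sup>2)"
  let ?g = "\<lambda>q::real \<times> real. (fst q, 2 * snd q / (1 + sqrt (1 - 4 * W (fst q) * snd q)))"
  have df: "diffeo_germ ?g"
  proof (rule diffeo_germI)
    have s1: "smooth_at (\<lambda>q::real \<times> real. 1 - 4 * W (fst q) * snd q) 0"
      by (intro smooth_at_diff smooth_at_mult smooth_at_const smooth_at_fst_compose W smooth_at_fst_snd)
    have s2: "smooth_at (\<lambda>q::real \<times> real. 1 - 2 * W (fst q) * snd q) 0"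
      by (intro smooth_at_diff smooth_at_mult smooth_at_const smooth_at_fst_compose W smooth_at_fst_snd)
    show "smooth_germ ?f"
      by (rule smooth_germ_plane)
         (auto intro!: smooth_at_diff smooth_at_mult smooth_at_power smooth_at_fst_compose W)
    show "smooth_germ ?g"
      by (rule smooth_germ_plane)
         (auto intro!: smooth_at_divide smooth_at_mult smooth_at_add smooth_at_sqrt s1)
    have "\<forall>\<^sub>F q in nhds (0::real \<times> real). 1 - 4 * W (fst q) * snd q > 0"
      by (rule eventually_nhds_pos[OF s1]) simp
    then show "\<forall>\<^sub>F q in nhds 0. ?f (?g q) = q"
    proof eventually_elim
      case (elim q)
      define a where "a = W (fst q)"
      define b where "b = snd q"
      define r where "r = sqrt (1 - 4 * a * b)"
      have r: "r\<^sup>2 = 1 - 4 * a * b" "r \<ge> 0" using elim by (auto simp: r_def a_def b_def)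
      have "2 * b / (1 + r) - a * (2 * b / (1 + r))\<^sup>2 = b * (2 * (1 + r) - 4 * a * b) / (1 + r)\<^sup>2"
      proof -
        have "2 * b / c - a * (2 * b / c)\<^sup>2 = b * (2 * c - 4 * a * b) / c\<^sup>2" if "c \<noteq> 0" for c
          using that by (simp add: field_simps power2_eq_square)
        then show ?thesis using r(2) by simp
      qed
      also have "2 * (1 + r) - 4 * a * b = (1 + r)\<^sup>2" using r(1) by (simp add: power2_eq_square algebra_simps)
      also have "b * (1 + r)\<^sup>2 / (1 + r)\<^sup>2 = b" using r(2) by simp
      finally show ?case by (simp add: a_def b_def r_def)
    qed
    have "\<forall>\<^sub>F q in nhds (0::real \<times> real). 1 - 2 * W (fst q) * snd q > 0"
      by (rule eventually_nhds_pos[OF s2]) simp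
    then show "\<forall>\<^sub>F q in nhds 0. ?g (?f q) = q"
    proof eventually_elim
      case (elim q)
      define a where "a = W (fst q)"
      define b where "b = snd q"
      have pos: "1 - 2 * a * b > 0" using elim by (simp add: a_def b_def)
      show ?case using solve_quadratic[OF pos] by (simp add: a_def b_def)
    qed
  qed
  have "\<forall>\<^sub>F t in nhds 0. ?g (t ^ 3, z t - W (t ^ 3) * (z t)\<^sup>2) = (t ^ 3, z t)"
  proof -
    have "smooth_at (\<lambda>t. 1 - 2 * W (t ^ 3) * z t) 0"
      by (intro smooth_at_diff smooth_at_mult smooth_at_const smooth_at_cube_compose W sz)
    then have "\<forall>\<^sub>F t in nhds 0. 1 - 2 * W (t ^ 3) * z t > 0"
      by (rule eventually_nhds_pos) (simp add: z_def m_def power_0_left)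
    then show ?thesis
    proof eventually_elim
      case (elim t)
      define a where "a = W (t ^ 3)"
      define b where "b = z t"
      have pos: "1 - 2 * a * b > 0" using elim by (simp add: a_def b_def)
      show ?case using solve_quadratic[OF pos] by (simp add: a_def b_def)
    qed
  qed
  then have "\<forall>\<^sub>F t in nhds 0. (t ^ 3, z t) = ?g (t ^ 3, z t - W (t ^ 3) * (z t)\<^sup>2)"
    by eventually_elim (rule sym)
  then have 3: "A_equiv (\<lambda>t. (t ^ 3, z t)) (\<lambda>t. (t ^ 3, z t - W (t ^ 3) * (z t)\<^sup>2))"
    by (rule A_equivI[OF diffeo_germ_ident df])
  \<comment> \<open>With b = t^m and z = b + W b^2 one finds z - W z^2 = b (1 - W^3 b^3) - 2 W^2
    b^3, and b^3 = (t^3)^m is a function of t^3. A triangular change therefore reaches t^m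
    exactly.\<close>
  let ?P = "\<lambda>x. - 2 * (W x)\<^sup>2 * x ^ m" and ?Q = "\<lambda>x. 1 - W x ^ 3 * x ^ m"
  have 4: "A_equiv (\<lambda>t. (t ^ 3, z t - W (t ^ 3) * (z t)\<^sup>2))
    (\<lambda>t. (t ^ 3, (z t - W (t ^ 3) * (z t)\<^sup>2 - ?P (t ^ 3)) / ?Q (t ^ 3)))"
    by (rule A_equiv_triangular)
       (use m3 in \<open>auto intro!: smooth_at_mult smooth_at_diff smooth_at_power smooth_germ_power smooth_at_uminus W simp: power_0_left\<close>)
  have nz: "\<forall>\<^sub>F t in nhds (0::real). ?Q (t ^ 3) \<noteq> 0"
    by (rule eventually_nhds_nonzero)
       (use m3 in \<open>auto intro!: smooth_at_cube_compose[where P = ?Q] smooth_at_diff smooth_at_mult smooth_at_power W simp: power_0_left\<close>)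
  have "\<forall>\<^sub>F t in nhds 0. (t ^ 3, (z t - W (t ^ 3) * (z t)\<^sup>2 - ?P (t ^ 3)) / ?Q (t ^ 3)) = (t ^ 3, t ^ m)"
    using nz
  proof eventually_elim
    case (elim t)
    define a where "a = W (t ^ 3)"
    define b where "b = t ^ m"
    have pw: "t ^ (2 * m) = b\<^sup>2" "(t ^ 3) ^ m = b ^ 3" by (simp_all add: b_def power_mult[symmetric] mult.commute)
    have "z t - W (t ^ 3) * (z t)\<^sup>2 - ?P (t ^ 3) = b * ?Q (t ^ 3)"
      unfolding z_def pw a_def[symmetric] b_def[symmetric] by (simp add: power2_eq_square power3_eq_cube algebra_simps)
    then show ?case using elim by (simp add: b_def)
  qed
  then have 5: "A_equiv (\<lambda>t. (t ^ 3, (z t - W (t ^ 3) * (z t)\<^sup>2 - ?P (t ^ 3)) / ?Q (t ^ 3))) (\<lambda>t. (t ^ 3, t ^ m))"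
    by (rule A_equiv_cong)
  have "A_equiv (\<lambda>t. (t ^ 3, Y t)) (\<lambda>t. (t ^ 3, t ^ m))"
    using A_equiv_trans[OF V(3)[folded y_def] A_equiv_trans[OF 2 A_equiv_trans[OF hk(7)
      A_equiv_trans[OF W(3)[folded z_def] A_equiv_trans[OF 3 A_equiv_trans[OF 4 5]]]]]] .
  then show ?thesis by (simp add: m_def)
qed

subsection \<open>Invariance of the residue classes\<close>

text \<open>Apply t d/dt to H(f, g). As t f' and t g' have no constant term, degree i involves the
  partial derivatives of H along the curve only in degrees below i, so the induction on i runs over
  all H simultaneously.\<close>

lemma jet_plane_res_class:
  assumes he: "e = 1 \<or> e = 2" and mn: "m \<le> n" "n \<le> 2 * m"
    and fg: "smooth_germ f" "smooth_germ g" "jet f \<in> res_class e m n" "jet g \<in> res_class e m n"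
    and H: "smooth_at H 0"
  shows "jet (\<lambda>t. H (f t, g t)) \<in> res_class e m n"
proof -
  have "(i mod 3 = e \<and> i < m \<longrightarrow> jet (\<lambda>t. H (f t, g t)) $ i = 0) \<and>
    (i mod 3 = 2 * e mod 3 \<and> i < n \<longrightarrow> jet (\<lambda>t. H (f t, g t)) $ i = 0)" for i
    using H
  proof (induction i arbitrary: H rule: less_induct)
    case (less i)
    \<comment> \<open>What the induction hypothesis provides: membership in the class, seen only
      below degree i.\<close>
    define good where "good a \<longleftrightarrow> (\<forall>j. (j mod 3 = e \<and> j < m \<and> j < i \<longrightarrow> a $ j = 0) \<and>
        (j mod 3 = 2 * e mod 3 \<and> j < n \<and> j < i \<longrightarrow> a $ j = 0))" for a :: "real fps"
    have g: "good (jet (\<lambda>t. K (f t, g t)))" if "smooth_at K 0" for K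
      using less.IH[OF _ that] by (simp add: good_def)
    have key: "(a * (fps_X * fps_deriv b)) $ i = 0"
      if i: "i mod 3 = e \<and> i < m \<or> i mod 3 = 2 * e mod 3 \<and> i < n" and a: "good a" and b: "b \<in> res_class e m n"
      for a b :: "real fps"
    proof -
      have b': "(fps_X * fps_deriv b) $ j = real j * b $ j" for j by (cases j) (auto simp: fps_X_mult_nth)
      have "a $ j * (fps_X * fps_deriv b) $ (i - j) = 0" if j: "j \<in> {0..i}" for j
      proof (cases "j = i")
        case True
        then show ?thesis by simp
      next
        case False
        then have ji: "j < i" "j \<le> i" using j by auto
        from i show ?thesis
        proof (elim disjE conjE)
          assume c: "i mod 3 = e" "i < m"
          consider "(i - j) mod 3 = e" | "j mod 3 = e" | "j mod 3 = 2 * e mod 3"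
            using mod3_split_e[OF he c(1) ji(2)] by blast
          then show ?thesis
          proof cases
            case 1
            then show ?thesis using res_classD(1)[OF b 1] c(2) unfolding b' by simp
          qed (use a ji c mn in \<open>auto simp: good_def\<close>)
        next
          assume c: "i mod 3 = 2 * e mod 3" "i < n"
          consider "(i - j) mod 3 = 2 * e mod 3" | "j mod 3 = 2 * e mod 3" | "j mod 3 = e" "(i - j) mod 3 = e"
            using mod3_split_2e[OF he c(1) ji(2)] by blast
          then show ?thesis
          proof cases
            case 1
            then show ?thesis using res_classD(2)[OF b 1] c(2) unfolding b' by simp
          next
            case 3
            have "j < m \<or> i - j < m" using c(2) mn by linarith
            then show ?thesis using 3 a ji res_classD(1)[OF b 3(2)] unfolding b' by (auto simp: good_def)
          qed (use a ji c mn in \<open>auto simp: good_def\<close>)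
        qed
      qed
      then show ?thesis unfolding fps_mult_nth by (intro sum.neutral) blast
    qed
    have "jet (\<lambda>t. H (f t, g t)) $ i = 0"
      if i: "i mod 3 = e \<and> i < m \<or> i mod 3 = 2 * e mod 3 \<and> i < n"
    proof -
      have i0: "i > 0" using i mod3_pos[OF he] by blast
      have "real i * jet (\<lambda>t. H (f t, g t)) $ i = (fps_X * fps_deriv (jet (\<lambda>t. H (f t, g t)))) $ i"
        using i0 by (simp add: fps_X_mult_nth)
      also have "fps_X * fps_deriv (jet (\<lambda>t. H (f t, g t))) =
          jet (\<lambda>t. partial1 H (f t, g t)) * (fps_X * fps_deriv (jet f)) +
          jet (\<lambda>t. partial2 H (f t, g t)) * (fps_X * fps_deriv (jet g))"
        unfolding deriv_jet_plane[OF less.prems fg(1,2)] by (simp add: algebra_simps)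
      also have "\<dots> $ i = 0"
        using key[OF i g[OF smooth_at_partial(1)[OF less.prems]] fg(3)]
          key[OF i g[OF smooth_at_partial(2)[OF less.prems]] fg(4)] by simp
      finally show ?thesis using i0 by simp
    qed
    then show ?case by blast
  qed
  then show ?thesis by (auto simp: res_class_def)
qed

text \<open>The equivalence expresses h^3 and Y o h as smooth functions of t^3 and Z, so both
  inherit the class. The first puts h/t into the class with bounds p and q, and then the
  substitution by h can be cancelled in the second.\<close>

lemma A_equiv_res_class:
  fixes Y Z :: "real \<Rightarrow> real"
  assumes he: "e = 1 \<or> e = 2" and pq: "0 < p" "p \<le> q" "q \<le> 2 * p"
    and Y: "smooth_germ Y" and Z: "smooth_germ Z" "jet Z \<in> res_class e (p + 3) (q + 3)"
    and eq: "A_equiv (\<lambda>t. (t ^ 3, Y t)) (\<lambda>t. (t ^ 3, Z t))"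
  shows "jet Y \<in> res_class e (p + 3) (q + 3)"
proof -
  obtain h \<psi> where h: "diffeo_germ h" "diffeo_germ \<psi>"
    "\<forall>\<^sub>F t in nhds 0. (h t ^ 3, Y (h t)) = \<psi> (t ^ 3, Z t)"
    using eq unfolding A_equiv_def by blast
  have sh: "smooth_germ h" using h(1) by (rule diffeo_germ_smooth)
  have s\<psi>: "smooth_at \<psi> 0" using h(2) by (auto simp: smooth_germ_def dest: diffeo_germ_smooth)
  let ?R = "res_class e (p + 3) (q + 3)"
  have X3: "jet (\<lambda>t::real. t ^ 3) \<in> ?R" using he by (auto simp: res_class_def jet_power jet_ident)
  have "jet (\<lambda>t. fst (\<psi> (t ^ 3, Z t))) \<in> ?R"
    by (rule jet_plane_res_class[OF he _ _ smooth_germ_power Z(1) X3 Z(2) smooth_at_fst[OF s\<psi>]]) (use pq in auto)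
  moreover have "jet (\<lambda>t. fst (\<psi> (t ^ 3, Z t))) = jet (\<lambda>t. h t ^ 3)"
    by (rule jet_cong) (use h(3) in \<open>eventually_elim, metis fst_conv\<close>)
  moreover have "jet (\<lambda>t. h t ^ 3) = jet h ^ 3" using sh by (simp add: jet_power smooth_germ_def)
  ultimately have H3: "jet h ^ 3 \<in> ?R" by simp
  have "jet (\<lambda>t. snd (\<psi> (t ^ 3, Z t))) \<in> ?R"
    by (rule jet_plane_res_class[OF he _ _ smooth_germ_power Z(1) X3 Z(2) smooth_at_snd[OF s\<psi>]]) (use pq in auto)
  moreover have "jet (\<lambda>t. snd (\<psi> (t ^ 3, Z t))) = jet (\<lambda>t. Y (h t))"
    by (rule jet_cong) (use h(3) in \<open>eventually_elim, metis snd_conv\<close>)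
  moreover have "jet (\<lambda>t. Y (h t)) = jet Y oo jet h"
    by (rule jet_compose[OF _ sh]) (use Y in \<open>simp add: smooth_germ_def\<close>)
  ultimately have Yh: "jet Y oo jet h \<in> ?R" by simp
  define w where "w = fps_shift 1 (jet h)"
  have hw: "jet h = fps_X * w"
    unfolding w_def by (rule fps_eq_X_mult) (use sh in \<open>simp add: smooth_germ_def\<close>)
  have w0: "w $ 0 \<noteq> 0" using diffeo_germ_deriv_nonzero[OF h(1)] by (simp add: w_def jet_nth_1[symmetric])
  have "w ^ 3 \<in> res_class e p q" using H3 unfolding hw power_mult_distrib res_class_shift .
  then have "w \<in> res_class e p q" by (rule res_class_cube_root[OF he pq(2,3) _ w0])
  from res_class_subst_cancel[OF he pq(2,3) this w0] Yh show ?thesis unfolding hw by blast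
qed

subsection \<open>The curve and its parallel curves\<close>

lemma interval_integral_has_vector_derivative:
  fixes f :: "real \<Rightarrow> 'a::euclidean_space"
  assumes "smooth_at f 0"
  shows "\<forall>\<^sub>F t in nhds 0. ((\<lambda>t. LBINT u=0..t. f u) has_vector_derivative f t) (at t)"
proof -
  obtain e where e: "e > 0" "\<And>x. dist x 0 < e \<Longrightarrow> smooth_at f x"
    using smooth_at_nearby[OF assms] by (auto simp: eventually_nhds_metric)
  have "((\<lambda>t. LBINT u=0..t. f u) has_vector_derivative f t) (at t)" if t: "dist t 0 < e" for t
  proof -
    obtain r where r: "\<bar>t\<bar> < r" "r < e" using dense[of "\<bar>t\<bar>" e] t by auto
    have "continuous_on {-r..r} f"
      using e(2) r by (auto intro!: continuous_at_imp_continuous_on smooth_at_isCont)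
    then have "((\<lambda>t. LBINT u=ereal 0..t. f u) has_vector_derivative f t) (at t within {-r..r})"
      using r by (intro interval_integral_FTC2) auto
    moreover have "at t within {-r..r} = at t"
      by (rule at_within_interior) (use r in \<open>auto simp: interior_atLeastAtMost_real\<close>)
    ultimately show ?thesis by (simp add: zero_ereal_def)
  qed
  then show ?thesis using e(1) unfolding eventually_nhds_metric by blast
qed

lemma smooth_at_cos_compose: "smooth_at f a \<Longrightarrow> smooth_at (\<lambda>x. cos (f x)) a" for f :: "real \<Rightarrow> real"
  by (rule smooth_at_compose[OF smooth_at_cos])

lemma smooth_at_sin_compose: "smooth_at f a \<Longrightarrow> smooth_at (\<lambda>x. sin (f x)) a" for f :: "real \<Rightarrow> real"
  by (rule smooth_at_compose[OF smooth_at_sin])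

lemma angle_0 [simp]: "angle \<kappa> 0 = 0"
  unfolding angle_def zero_ereal_def by (rule interval_integral_endpoints_same)

lemma phi3_0 [simp]: "phi3 \<kappa> 0 = 0"
  unfolding phi3_def zero_ereal_def by (rule interval_integral_endpoints_same)

lemma parallel3_germ_0 [simp]: "parallel3_germ \<kappa> \<delta> 0 = 0"
  by (simp add: parallel3_germ_def)

text \<open>Lets results on parallel curves be read for the curve itself.\<close>

lemma phi3_eq_parallel: "phi3 \<kappa> = parallel3_germ \<kappa> 0"
  by (simp add: fun_eq_iff parallel3_germ_def parallel3_def)

lemma theta_coeff_eq: "theta_coeff \<kappa> i = fact i * jet (angle \<kappa>) $ i"
  by (simp add: theta_coeff_def jet_def)

lemma angle_derivative:
  assumes "smooth_at \<kappa> 0"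
  shows "\<forall>\<^sub>F t in nhds 0. (angle \<kappa> has_real_derivative \<kappa> t) (at t)"
  using interval_integral_has_vector_derivative[OF assms]
  unfolding angle_def[abs_def] has_real_derivative_iff_has_vector_derivative .

lemma smooth_at_angle: "smooth_at \<kappa> 0 \<Longrightarrow> smooth_at (angle \<kappa>) 0"
  using smooth_at_of_derivative[of "angle \<kappa>" \<kappa> 0] angle_derivative[of \<kappa>]
  by (simp add: has_real_derivative_iff_has_vector_derivative)

lemma smooth_germ_angle: "smooth_at \<kappa> 0 \<Longrightarrow> smooth_germ (angle \<kappa>)"
  by (simp add: smooth_germ_def smooth_at_angle)

lemma parallel3_derivative:
  assumes "smooth_at \<kappa> 0"
  shows "\<forall>\<^sub>F t in nhds 0.
    ((\<lambda>t. fst (parallel3_germ \<kappa> \<delta> t)) has_real_derivative (t\<^sup>2 / 2 - \<delta> * \<kappa> t) * cos (angle \<kappa> t)) (at t) \<and>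
    ((\<lambda>t. snd (parallel3_germ \<kappa> \<delta> t)) has_real_derivative (t\<^sup>2 / 2 - \<delta> * \<kappa> t) * sin (angle \<kappa> t)) (at t)"
proof -
  have s: "smooth_at (\<lambda>u. (u\<^sup>2 / 2) *\<^sub>R tangent \<kappa> u) 0"
    unfolding tangent_def
    by (intro smooth_at_scaleR smooth_at_divide smooth_at_power smooth_at_ident smooth_at_const smooth_at_Pair
        smooth_at_cos_compose smooth_at_sin_compose smooth_at_angle assms) simp
  show ?thesis
    using interval_integral_has_vector_derivative[OF s] angle_derivative[OF assms]
  proof eventually_elim
    case (elim t)
    have D: "(phi3 \<kappa> has_vector_derivative (t\<^sup>2 / 2) *\<^sub>R tangent \<kappa> t) (at t)"
      using elim(1) unfolding phi3_def[abs_def] .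
    have f: "((\<lambda>t. fst (phi3 \<kappa> t)) has_real_derivative t\<^sup>2 / 2 * cos (angle \<kappa> t)) (at t)"
      using bounded_linear.has_vector_derivative[OF bounded_linear_fst D]
      by (simp add: tangent_def has_real_derivative_iff_has_vector_derivative)
    have g: "((\<lambda>t. snd (phi3 \<kappa> t)) has_real_derivative t\<^sup>2 / 2 * sin (angle \<kappa> t)) (at t)"
      using bounded_linear.has_vector_derivative[OF bounded_linear_snd D]
      by (simp add: tangent_def has_real_derivative_iff_has_vector_derivative)
    have nf: "((\<lambda>t. - sin (angle \<kappa> t)) has_real_derivative - (cos (angle \<kappa> t) * \<kappa> t)) (at t)"
      by (rule DERIV_minus[OF DERIV_fun_sin[OF elim(2)]])
    have ng: "((\<lambda>t. cos (angle \<kappa> t)) has_real_derivative - sin (angle \<kappa> t) * \<kappa> t) (at t)"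
      by (rule DERIV_fun_cos[OF elim(2)])
    have "((\<lambda>t. fst (phi3 \<kappa> t) + \<delta> * (- sin (angle \<kappa> t)) - fst (parallel3 \<kappa> \<delta> 0)) has_real_derivative
        t\<^sup>2 / 2 * cos (angle \<kappa> t) + \<delta> * - (cos (angle \<kappa> t) * \<kappa> t) - 0) (at t)"
      by (intro DERIV_diff DERIV_add f DERIV_cmult nf DERIV_const)
    moreover have "((\<lambda>t. snd (phi3 \<kappa> t) + \<delta> * cos (angle \<kappa> t) - snd (parallel3 \<kappa> \<delta> 0)) has_real_derivative
        t\<^sup>2 / 2 * sin (angle \<kappa> t) + \<delta> * (- sin (angle \<kappa> t) * \<kappa> t) - 0) (at t)"
      by (intro DERIV_diff DERIV_add g DERIV_cmult ng DERIV_const)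
    ultimately show ?case
      by (simp add: parallel3_germ_def parallel3_def normal_vec_def algebra_simps)
  qed
qed

lemma smooth_germ_parallel3:
  assumes "smooth_at \<kappa> 0"
  shows "smooth_germ (\<lambda>t. fst (parallel3_germ \<kappa> \<delta> t))" "smooth_germ (\<lambda>t. snd (parallel3_germ \<kappa> \<delta> t))"
proof -
  note sm = smooth_at_mult smooth_at_diff smooth_at_divide smooth_at_power smooth_at_ident smooth_at_const assms
    smooth_at_cos_compose smooth_at_sin_compose smooth_at_angle
  have "smooth_at (\<lambda>t. fst (parallel3_germ \<kappa> \<delta> t)) 0"
  proof (rule smooth_at_of_derivative)
    show "\<forall>\<^sub>F t in nhds 0. ((\<lambda>t. fst (parallel3_germ \<kappa> \<delta> t)) has_vector_derivative
      (t\<^sup>2 / 2 - \<delta> * \<kappa> t) * cos (angle \<kappa> t)) (at t)"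
      using parallel3_derivative[OF assms, of \<delta>]
      by eventually_elim (simp add: has_real_derivative_iff_has_vector_derivative)
    show "smooth_at (\<lambda>t. (t\<^sup>2 / 2 - \<delta> * \<kappa> t) * cos (angle \<kappa> t)) 0" by (intro sm) simp
  qed
  then show "smooth_germ (\<lambda>t. fst (parallel3_germ \<kappa> \<delta> t))" by (simp add: smooth_germ_def)
  have "smooth_at (\<lambda>t. snd (parallel3_germ \<kappa> \<delta> t)) 0"
  proof (rule smooth_at_of_derivative)
    show "\<forall>\<^sub>F t in nhds 0. ((\<lambda>t. snd (parallel3_germ \<kappa> \<delta> t)) has_vector_derivative
      (t\<^sup>2 / 2 - \<delta> * \<kappa> t) * sin (angle \<kappa> t)) (at t)"
      using parallel3_derivative[OF assms, of \<delta>]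
      by eventually_elim (simp add: has_real_derivative_iff_has_vector_derivative)
    show "smooth_at (\<lambda>t. (t\<^sup>2 / 2 - \<delta> * \<kappa> t) * sin (angle \<kappa> t)) 0" by (intro sm) simp
  qed
  then show "smooth_germ (\<lambda>t. snd (parallel3_germ \<kappa> \<delta> t))" by (simp add: smooth_germ_def)
qed

lemma jet_curvature: "smooth_at \<kappa> 0 \<Longrightarrow> jet \<kappa> = fps_deriv (jet (angle \<kappa>))"
  by (rule jet_eqI[OF angle_derivative])

lemma jet_parallel3:
  assumes "smooth_at \<kappa> 0"
  defines "\<theta> \<equiv> jet (angle \<kappa>)"
  shows "fps_deriv (jet (\<lambda>t. fst (parallel3_germ \<kappa> \<delta> t))) =
      (fps_const (1/2) * fps_X\<^sup>2 - fps_const \<delta> * fps_deriv \<theta>) * (jet cos oo \<theta>)"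
    and "fps_deriv (jet (\<lambda>t. snd (parallel3_germ \<kappa> \<delta> t))) =
      (fps_const (1/2) * fps_X\<^sup>2 - fps_const \<delta> * fps_deriv \<theta>) * (jet sin oo \<theta>)"
proof -
  have s: "smooth_at (\<lambda>t. t\<^sup>2 / 2 - \<delta> * \<kappa> t) 0"
    by (intro smooth_at_diff smooth_at_divide smooth_at_mult smooth_at_power smooth_at_ident smooth_at_const assms) simp
  have "jet (\<lambda>t. t\<^sup>2 / 2 - \<delta> * \<kappa> t) = jet (\<lambda>t. (1/2) * t\<^sup>2 - \<delta> * \<kappa> t)" by (rule arg_cong[where f = jet]) auto
  also have "\<dots> = fps_const (1/2) * fps_X\<^sup>2 - fps_const \<delta> * fps_deriv \<theta>"
    unfolding \<theta>_def jet_curvature[OF assms(1), symmetric]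
    by (simp only: jet_diff[OF smooth_at_mult[OF smooth_at_const smooth_at_power[OF smooth_at_ident]]
        smooth_at_mult[OF smooth_at_const assms(1)]] jet_cmult[OF smooth_at_power[OF smooth_at_ident]]
        jet_cmult[OF assms(1)] jet_power[OF smooth_at_ident] jet_ident)
  finally have j: "jet (\<lambda>t. t\<^sup>2 / 2 - \<delta> * \<kappa> t) = fps_const (1/2) * fps_X\<^sup>2 - fps_const \<delta> * fps_deriv \<theta>" .
  have g: "smooth_germ (angle \<kappa>)" by (rule smooth_germ_angle[OF assms(1)])
  have jc: "jet (\<lambda>t. cos (angle \<kappa> t)) = jet cos oo \<theta>" "jet (\<lambda>t. sin (angle \<kappa> t)) = jet sin oo \<theta>"
    unfolding \<theta>_def by (rule jet_compose[OF smooth_at_cos g], rule jet_compose[OF smooth_at_sin g])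
  have sc: "smooth_at (\<lambda>t. cos (angle \<kappa> t)) 0" "smooth_at (\<lambda>t. sin (angle \<kappa> t)) 0"
    by (rule smooth_at_cos_compose[OF smooth_at_angle[OF assms(1)]],
        rule smooth_at_sin_compose[OF smooth_at_angle[OF assms(1)]])
  have "jet (\<lambda>t. (t\<^sup>2 / 2 - \<delta> * \<kappa> t) * cos (angle \<kappa> t)) = fps_deriv (jet (\<lambda>t. fst (parallel3_germ \<kappa> \<delta> t)))"
    by (rule jet_eqI) (use parallel3_derivative[OF assms(1), of \<delta>] in \<open>eventually_elim, blast\<close>)
  then show "fps_deriv (jet (\<lambda>t. fst (parallel3_germ \<kappa> \<delta> t))) =
      (fps_const (1/2) * fps_X\<^sup>2 - fps_const \<delta> * fps_deriv \<theta>) * (jet cos oo \<theta>)"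
    unfolding jet_mult[OF s sc(1)] j jc by simp
  have "jet (\<lambda>t. (t\<^sup>2 / 2 - \<delta> * \<kappa> t) * sin (angle \<kappa> t)) = fps_deriv (jet (\<lambda>t. snd (parallel3_germ \<kappa> \<delta> t)))"
    by (rule jet_eqI) (use parallel3_derivative[OF assms(1), of \<delta>] in \<open>eventually_elim, blast\<close>)
  then show "fps_deriv (jet (\<lambda>t. snd (parallel3_germ \<kappa> \<delta> t))) =
      (fps_const (1/2) * fps_X\<^sup>2 - fps_const \<delta> * fps_deriv \<theta>) * (jet sin oo \<theta>)"
    unfolding jet_mult[OF s sc(2)] j jc by simp
qed

text \<open>The conditions are on the products of \<delta> with the first two coefficients, so for
  \<delta> = 0 they hold for every \<kappa>. In this way \<phi>_3 can be parametrised before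
  anything is known about its angle.\<close>

lemma curve_parametrisation:
  fixes \<kappa> :: "real \<Rightarrow> real" and \<delta> c :: real
  defines "\<theta> \<equiv> jet (angle \<kappa>)"
  assumes k: "smooth_at \<kappa> 0" and d: "\<delta> * \<theta> $ 1 = 0" "\<delta> * \<theta> $ 2 = 0"
    and c: "c = (1 - 6 * \<delta> * \<theta> $ 3) / 6" "c \<noteq> 0"
  obtains H T :: "real fps" and Y where "smooth_germ Y" "A_equiv (parallel3_germ \<kappa> \<delta>) (\<lambda>s. (s ^ 3, Y s))"
    "jet (\<lambda>t. fst (parallel3_germ \<kappa> \<delta> t)) = fps_const c * H ^ 3" "H $ 0 = 0" "H $ 1 = 1"
    "T oo H = fps_X" "T $ 0 = 0" "T $ 1 = 1"
    "fps_deriv (fps_const (1/6) * T ^ 3 - fps_const \<delta> * (\<theta> oo T)) =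
      fps_const (3 * c) * fps_X\<^sup>2 * (jet (\<lambda>x. inverse (cos x)) oo (\<theta> oo T))"
    "fps_deriv (jet Y) = fps_const (3 * c) * fps_X\<^sup>2 * (jet tan oo (\<theta> oo T))"
proof -
  define X where "X t = fst (parallel3_germ \<kappa> \<delta> t)" for t
  define Z where "Z t = snd (parallel3_germ \<kappa> \<delta> t)" for t
  have sX: "smooth_germ X" "smooth_germ Z"
    using smooth_germ_parallel3[OF k, of \<delta>] unfolding X_def[abs_def] Z_def[abs_def] by auto
  have sX': "smooth_at X 0" "X 0 = 0" "smooth_at Z 0" "Z 0 = 0" using sX by (auto simp: smooth_germ_def)
  let ?A = "fps_const (1/2) * fps_X\<^sup>2 - fps_const \<delta> * fps_deriv \<theta>"
  have dX: "fps_deriv (jet X) = ?A * (jet cos oo \<theta>)"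
    using jet_parallel3(1)[OF k, of \<delta>] unfolding X_def[abs_def] \<theta>_def .
  \<comment> \<open>The speed begins with 3c t^2, so c is the coefficient of t^3 in X.\<close>
  have A: "?A $ 0 = 0" "?A $ 1 = 0" "?A $ 2 = 3 * c"
    using d c by (auto simp: fps_X_power_nth fps_deriv_nth eval_nat_numeral field_simps)
  have C0: "(jet cos oo \<theta>) $ 0 = 1" by simp
  have gen: "(a * b) $ 0 = 0 \<and> (a * b) $ 1 = 0 \<and> (a * b) $ 2 = a $ 2 * b $ 0" if "a $ 0 = 0" "a $ 1 = 0"
    for a b :: "real fps" using that by (simp add: fps_mult_nth numeral_2_eq_2)
  have "(?A * (jet cos oo \<theta>)) $ 0 = 0" "(?A * (jet cos oo \<theta>)) $ 1 = 0" "(?A * (jet cos oo \<theta>)) $ 2 = 3 * c"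
    using gen[OF A(1,2), of "jet cos oo \<theta>"] unfolding A(3) C0 by auto
  then have X123: "jet X $ 1 = 0" "jet X $ 2 = 0" "jet X $ 3 = c"
    unfolding dX[symmetric] by (auto simp: fps_deriv_nth numeral_2_eq_2 numeral_3_eq_3)
  obtain h g where hg: "diffeo_germ h" "diffeo_germ g" "\<forall>\<^sub>F s in nhds 0. h (g s) = s"
    "\<forall>\<^sub>F t in nhds 0. g (h t) = t" "\<forall>\<^sub>F t in nhds 0. X t = c * h t ^ 3" "deriv h 0 = 1"
    "A_equiv (\<lambda>t. (X t, Z t)) (\<lambda>s. (s ^ 3, Z (g s)))"
    using cube_parametrisation[OF sX'(1,2) X123 c(2), of Z] by blast
  have sh: "smooth_germ h" "smooth_germ g" using hg by (auto dest: diffeo_germ_smooth)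
  have sh': "smooth_at h 0" "h 0 = 0" "smooth_at g 0" "g 0 = 0" using sh by (auto simp: smooth_germ_def)
  define H where "H = jet h"
  define T where "T = jet g"
  have H: "H $ 0 = 0" "H $ 1 = 1" using hg(6) sh' by (simp_all add: H_def jet_nth_1[symmetric])
  have TH: "T oo H = fps_X"
  proof -
    have "jet (\<lambda>t. g (h t)) = T oo H" unfolding T_def H_def by (rule jet_compose[OF sh'(3) sh(1)])
    moreover have "jet (\<lambda>t. g (h t)) = jet (\<lambda>t. t)" by (rule jet_cong[OF hg(4)])
    ultimately show ?thesis by (simp add: jet_ident)
  qed
  have "(T oo H) $ 1 = T $ 1 * H $ 1" using H(1) by (simp add: fps_compose_nth)
  then have T: "T $ 0 = 0" "T $ 1 = 1" using TH H sh' by (simp_all add: T_def)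
  have xH: "jet X = fps_const c * H ^ 3"
  proof -
    have "jet X = jet (\<lambda>t. c * h t ^ 3)" by (rule jet_cong[OF hg(5)])
    then show ?thesis using sh' by (simp add: H_def jet_cmult jet_power smooth_at_power)
  qed
  have ga: "smooth_germ (angle \<kappa>)" by (rule smooth_germ_angle[OF k])
  define \<Theta> where "\<Theta> s = angle \<kappa> (g s)" for s
  have g\<Theta>: "smooth_germ \<Theta>" unfolding \<Theta>_def by (rule smooth_germ_compose[OF ga sh(2)])
  have s\<Theta>: "smooth_at \<Theta> 0" "\<Theta> 0 = 0" using g\<Theta> by (auto simp: smooth_germ_def)
  have j\<Theta>: "jet \<Theta> = \<theta> oo T" unfolding \<Theta>_def \<theta>_def T_def by (rule jet_compose[OF smooth_at_angle[OF k] sh(2)])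
  define \<rho> where "\<rho> s = (1/6) * g s ^ 3 - \<delta> * \<Theta> s" for s
  have j\<rho>: "jet \<rho> = fps_const (1/6) * T ^ 3 - fps_const \<delta> * (\<theta> oo T)"
    unfolding \<rho>_def j\<Theta>[symmetric]
    by (simp only: jet_diff[OF smooth_at_mult[OF smooth_at_const smooth_at_power[OF sh'(3)]]
        smooth_at_mult[OF smooth_at_const s\<Theta>(1)]] jet_cmult[OF smooth_at_power[OF sh'(3)]]
        jet_cmult[OF s\<Theta>(1)] jet_power[OF sh'(3)] T_def)
  \<comment> \<open>The derivative of \<rho>. Differentiating X(g s) = c s^3 gives v cos \<Theta> =
    3c s^2, which is solved for v because cos \<Theta> is near 1.\<close>
  define v where "v s = ((g s)\<^sup>2 / 2 - \<delta> * \<kappa> (g s)) * deriv g s" for s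
  have "\<forall>\<^sub>F s in nhds 0. X (g s) = c * s ^ 3"
    using eventually_germ[OF sh(2) hg(5)] hg(3) by eventually_elim simp
  then have dXg: "\<forall>\<^sub>F s in nhds 0. deriv (\<lambda>s. X (g s)) s = deriv (\<lambda>s. c * s ^ 3) s"
    by (rule eventually_deriv_cong)
  have cosnz: "\<forall>\<^sub>F s in nhds 0. cos (\<Theta> s) \<noteq> 0"
    by (rule eventually_nhds_nonzero) (use s\<Theta> in \<open>auto intro: smooth_at_cos_compose\<close>)
  have all: "\<forall>\<^sub>F s in nhds 0. v s = 3 * c * s\<^sup>2 * inverse (cos (\<Theta> s)) \<and>
      (\<rho> has_real_derivative v s) (at s) \<and>
      ((\<lambda>s. Z (g s)) has_real_derivative 3 * c * s\<^sup>2 * tan (\<Theta> s)) (at s)"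
    using dXg cosnz eventually_smooth_derivative[OF sh'(3)]
      eventually_germ[OF sh(2) parallel3_derivative[OF k, of \<delta>]]
      eventually_germ[OF sh(2) angle_derivative[OF k]]
  proof eventually_elim
    case (elim s)
    have "((\<lambda>s. X (g s)) has_real_derivative ((g s)\<^sup>2 / 2 - \<delta> * \<kappa> (g s)) * cos (\<Theta> s) * deriv g s) (at s)"
      unfolding X_def \<Theta>_def by (rule DERIV_chain2[OF _ elim(3)]) (use elim(4) in blast)
    then have "deriv (\<lambda>s. X (g s)) s = v s * cos (\<Theta> s)" by (simp add: DERIV_imp_deriv v_def)
    moreover have "((\<lambda>s. c * s ^ 3) has_real_derivative 3 * c * s\<^sup>2) (at s)"
      by (auto intro!: derivative_eq_intros)
    then have "deriv (\<lambda>s. c * s ^ 3) s = 3 * c * s\<^sup>2" by (rule DERIV_imp_deriv)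
    ultimately have vc: "v s * cos (\<Theta> s) = 3 * c * s\<^sup>2" using elim(1) by simp
    have v: "v s = 3 * c * s\<^sup>2 * inverse (cos (\<Theta> s))"
      unfolding vc[symmetric] using elim(2) by simp
    have D\<Theta>: "(\<Theta> has_real_derivative \<kappa> (g s) * deriv g s) (at s)"
      unfolding \<Theta>_def by (rule DERIV_chain2[OF elim(5) elim(3)])
    have D\<rho>: "(\<rho> has_real_derivative (1/6) * (3 * (deriv g s * (g s)\<^sup>2)) - \<delta> * (\<kappa> (g s) * deriv g s)) (at s)"
      unfolding \<rho>_def
      by (intro DERIV_diff DERIV_cmult D\<Theta>)
         (use DERIV_power[OF elim(3), of 3] in \<open>simp add: mult.assoc\<close>)
    have e1: "(1/6) * (3 * (deriv g s * (g s)\<^sup>2)) - \<delta> * (\<kappa> (g s) * deriv g s) = v s"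
      by (simp add: v_def field_simps)
    have DZ: "((\<lambda>s. Z (g s)) has_real_derivative ((g s)\<^sup>2 / 2 - \<delta> * \<kappa> (g s)) * sin (\<Theta> s) * deriv g s) (at s)"
      unfolding Z_def \<Theta>_def by (rule DERIV_chain2[OF _ elim(3)]) (use elim(4) in blast)
    have e2: "((g s)\<^sup>2 / 2 - \<delta> * \<kappa> (g s)) * sin (\<Theta> s) * deriv g s = v s * sin (\<Theta> s)" by (simp add: v_def)
    have e3: "v s * sin (\<Theta> s) = 3 * c * s\<^sup>2 * tan (\<Theta> s)"
      unfolding v by (simp add: tan_def divide_inverse)
    show ?case using v D\<rho>[unfolded e1] DZ[unfolded e2 e3] by blast
  qed
  have ssec: "smooth_at (\<lambda>x::real. inverse (cos x)) 0" by (rule smooth_at_inverse[OF smooth_at_cos]) simp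
  have stan: "smooth_at (tan :: real \<Rightarrow> real) 0" by (rule smooth_at_tan) simp
  have s2: "smooth_at (\<lambda>s. f (\<Theta> s)) 0" if "smooth_at f 0" for f :: "real \<Rightarrow> real"
    by (rule smooth_at_compose[where f = f]) (use that s\<Theta> in auto)
  have j2: "jet (\<lambda>s. 3 * c * s\<^sup>2 * f (\<Theta> s)) = fps_const (3 * c) * fps_X\<^sup>2 * (jet f oo (\<theta> oo T))"
    if "smooth_at f 0" for f :: "real \<Rightarrow> real"
  proof -
    have "jet (\<lambda>s. 3 * c * s\<^sup>2 * f (\<Theta> s)) = jet (\<lambda>s. 3 * c * s\<^sup>2) * jet (\<lambda>s. f (\<Theta> s))"
      by (rule jet_mult) (use s2[OF that] in \<open>simp_all add: smooth_at_mult smooth_at_power\<close>)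
    then show ?thesis
      by (simp add: jet_cmult jet_power jet_ident smooth_at_power jet_compose[OF that g\<Theta>] j\<Theta>)
  qed
  have rho: "fps_deriv (fps_const (1/6) * T ^ 3 - fps_const \<delta> * (\<theta> oo T)) =
      fps_const (3 * c) * fps_X\<^sup>2 * (jet (\<lambda>x. inverse (cos x)) oo (\<theta> oo T))"
    unfolding j\<rho>[symmetric] j2[OF ssec, symmetric]
    by (rule jet_eqI[symmetric]) (use all in \<open>eventually_elim, metis\<close>)
  have dY: "fps_deriv (jet (\<lambda>s. Z (g s))) = fps_const (3 * c) * fps_X\<^sup>2 * (jet tan oo (\<theta> oo T))"
    unfolding j2[OF stan, symmetric]
    by (rule jet_eqI[symmetric]) (use all in \<open>eventually_elim, metis\<close>)
  have "A_equiv (parallel3_germ \<kappa> \<delta>) (\<lambda>s. (s ^ 3, Z (g s)))"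
    using hg(7) by (simp add: X_def Z_def)
  then show ?thesis
    using that[of "\<lambda>s. Z (g s)" H T] smooth_germ_compose[OF sX(2) sh(2)] xH[unfolded X_def[abs_def]] H T TH rho dY by blast
qed

lemma jet_tan_1: "jet tan $ 1 = 1"
proof -
  have "(tan has_real_derivative 1) (at (0::real))" using DERIV_tan[of "0::real"] by simp
  then show ?thesis unfolding jet_nth_1 by (rule DERIV_imp_deriv)
qed

text \<open>The formal computation, instantiated with the jets of the curve. For \<delta> = 0 it has
  c = 1/6 and describes \<phi>_3 itself.\<close>

lemma parallel_curve_normal_parameter:
  fixes \<kappa> :: "real \<Rightarrow> real" and \<delta> c :: real
  defines "\<theta> \<equiv> jet (angle \<kappa>)"
  assumes he: "e = 1 \<or> e = 2" and pq: "0 < p" "p \<le> q" "q \<le> 2 * p" and k: "smooth_at \<kappa> 0"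
    and th: "\<theta> \<in> res_class e (p + 3) (q + 3)"
    and c: "c = (1 - 6 * \<delta> * \<theta> $ 3) / 6" "c \<noteq> 0"
  obtains Y where "smooth_germ Y" "A_equiv (parallel3_germ \<kappa> \<delta>) (\<lambda>s. (s ^ 3, Y s))"
    "jet Y \<in> res_class e (p + 6) (q + 6)"
    "p mod 3 = e \<longrightarrow> real (p + 6) * jet Y $ (p + 6) = \<theta> $ (p + 3) / 2"
    "q mod 3 = 2 * e mod 3 \<longrightarrow> q < 2 * p \<longrightarrow> real (q + 6) * jet Y $ (q + 6) = \<theta> $ (q + 3) / 2"
    "p mod 3 = e \<longrightarrow> q = 2 * p \<longrightarrow>
      real (q + 6) * jet Y $ (q + 6) = (\<theta> $ (q + 3) + 2 * real (p + 3) * \<delta> * (\<theta> $ (p + 3))\<^sup>2 / (6 * c)) / 2"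
proof -
  have "\<theta> $ 1 = 0" "\<theta> $ 2 = 0" using th he pq by (auto simp: res_class_def)
  then have d: "\<delta> * \<theta> $ 1 = 0" "\<delta> * \<theta> $ 2 = 0" by simp_all
  obtain H T :: "real fps" and Y where Y: "smooth_germ Y" "A_equiv (parallel3_germ \<kappa> \<delta>) (\<lambda>s. (s ^ 3, Y s))"
    "jet (\<lambda>t. fst (parallel3_germ \<kappa> \<delta> t)) = fps_const c * H ^ 3" "H $ 0 = 0" "H $ 1 = 1"
    "T oo H = fps_X" "T $ 0 = 0" "T $ 1 = 1"
    "fps_deriv (fps_const (1/6) * T ^ 3 - fps_const \<delta> * (\<theta> oo T)) =
      fps_const (3 * c) * fps_X\<^sup>2 * (jet (\<lambda>x. inverse (cos x)) oo (\<theta> oo T))"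
    "fps_deriv (jet Y) = fps_const (3 * c) * fps_X\<^sup>2 * (jet tan oo (\<theta> oo T))"
    using curve_parametrisation[OF k, folded \<theta>_def, OF d c] .
  have th0: "\<theta> $ 0 = 0" by (simp add: \<theta>_def)
  have H1: "H $ 1 \<noteq> 0" using Y(5) by simp
  note pj = parallel_jet[OF he pq th th0 c jet_parallel3(1)[OF k, of \<delta>, folded \<theta>_def] Y(3,4) H1 Y(6-10) jet_tan_1]
  show ?thesis by (rule that[OF Y(1,2) pj(1)]) (use pj(2-4) in blast)+
qed

text \<open>One and the same Y has to serve all classes: it is built from \<kappa> alone, and its
  class is found afterwards by comparison with a normal form.\<close>

lemma angle_classes_of_curve:
  assumes k: "smooth_at \<kappa> 0"
  obtains Y where "smooth_germ Y" "A_equiv (phi3 \<kappa>) (\<lambda>s. (s ^ 3, Y s))"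
    "\<forall>e p q. (e = 1 \<or> e = 2) \<longrightarrow> p \<le> q \<longrightarrow> q \<le> 2 * p \<longrightarrow> jet Y \<in> res_class e (p + 6) (q + 6) \<longrightarrow>
      jet (angle \<kappa>) \<in> res_class e (p + 3) (q + 3)"
proof -
  define \<theta> where "\<theta> = jet (angle \<kappa>)"
  obtain H T :: "real fps" and Y where Y: "smooth_germ Y" "A_equiv (parallel3_germ \<kappa> 0) (\<lambda>s. (s ^ 3, Y s))"
    "jet (\<lambda>t. fst (parallel3_germ \<kappa> 0 t)) = fps_const (1/6) * H ^ 3" "H $ 0 = 0" "H $ 1 = 1"
    "T oo H = fps_X" "T $ 0 = 0" "T $ 1 = 1"
    "fps_deriv (fps_const (1/6) * T ^ 3 - fps_const 0 * (\<theta> oo T)) =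
      fps_const (3 * (1/6)) * fps_X\<^sup>2 * (jet (\<lambda>x. inverse (cos x)) oo (\<theta> oo T))"
    "fps_deriv (jet Y) = fps_const (3 * (1/6)) * fps_X\<^sup>2 * (jet tan oo (\<theta> oo T))"
    by (rule curve_parametrisation[OF k, folded \<theta>_def, of 0 "1/6"]) simp_all
  define s where "s = jet (\<lambda>x::real. inverse (cos x)) oo (\<theta> oo T)"
  have "fps_const 6 * fps_deriv (fps_const (1/6) * T ^ 3) = fps_const 6 * (fps_const (1/2) * fps_X\<^sup>2 * s)"
    using Y(9) by (simp add: s_def)
  then have d3: "fps_deriv (T ^ 3) = fps_const 3 * fps_X\<^sup>2 * s"
    by (simp add: mult.assoc[symmetric] del: fps_deriv_power)
  have dY: "fps_deriv (jet Y) = fps_const (1/2) * fps_X\<^sup>2 * (jet tan oo (\<theta> oo T))" using Y(10) by simp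
  have stan: "smooth_germ (tan :: real \<Rightarrow> real)" by (simp add: smooth_germ_def smooth_at_tan)
  have "\<forall>\<^sub>F x in nhds (0::real). cos x > 0" by (rule eventually_nhds_pos[OF smooth_at_cos]) simp
  have "\<forall>\<^sub>F x in nhds (0::real). x \<in> {- (pi/2) <..< pi/2}" by (rule eventually_nhds_in_open) auto
  then have "\<forall>\<^sub>F x in nhds (0::real). arctan (tan x) = x" by eventually_elim (simp add: arctan_tan)
  then have "jet (\<lambda>x. arctan (tan x)) = fps_X" using jet_cong jet_ident by metis
  then have at: "jet arctan oo jet tan = fps_X" using jet_compose[OF smooth_at_arctan stan] by simp
  have T0: "(\<theta> oo T) $ 0 = 0" by (simp add: \<theta>_def)
  have "jet arctan oo (jet tan oo (\<theta> oo T)) = (jet arctan oo jet tan) oo (\<theta> oo T)"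
    by (rule fps_compose_assoc) (use T0 in simp_all)
  also have "\<dots> = \<theta> oo T" unfolding at using T0 by (simp add: fps_X_fps_compose_startby0)
  finally have at': "jet arctan oo (jet tan oo (\<theta> oo T)) = \<theta> oo T" .
  show ?thesis
  proof (rule that[OF Y(1)])
    show "A_equiv (phi3 \<kappa>) (\<lambda>s. (s ^ 3, Y s))" using Y(2) by (simp add: phi3_eq_parallel)
    have "jet (angle \<kappa>) \<in> res_class e (p + 3) (q + 3)"
      if "e = 1 \<or> e = 2" "p \<le> q" "q \<le> 2 * p" "jet Y \<in> res_class e (p + 6) (q + 6)" for e p q
      unfolding \<theta>_def[symmetric]
      by (rule angle_jet_of_curve_jet[OF that(1-3) Y(7,8) d3[unfolded s_def] dY at' that(4)])
    then show "\<forall>e p q. (e = 1 \<or> e = 2) \<longrightarrow> p \<le> q \<longrightarrow> q \<le> 2 * p \<longrightarrow> jet Y \<in> res_class e (p + 6) (q + 6) \<longrightarrow>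
      jet (angle \<kappa>) \<in> res_class e (p + 3) (q + 3)" by blast
  qed
qed

subsection \<open>The singularity of the parallel curves\<close>

lemma A_equiv_sym_cube:
  assumes "A_equiv f (\<lambda>s. (s ^ 3, Y s))" "f 0 = 0" "smooth_germ Y"
  shows "A_equiv (\<lambda>s. (s ^ 3, Y s)) f"
proof (rule A_equiv_sym[OF assms(1,2)])
  have "smooth_at (\<lambda>s. (s ^ 3, Y s)) 0"
    using assms(3) by (intro smooth_at_Pair smooth_at_power smooth_at_ident) (simp add: smooth_germ_def)
  then show "isCont (\<lambda>s. (s ^ 3, Y s)) 0" by (rule smooth_at_isCont)
qed (use assms(3) in \<open>simp add: smooth_germ_def zero_prod_def\<close>)

lemma mod3_add6: "(i + 6) mod 3 = i mod (3::nat)"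
  using mod_add_self2[of "i + 3" 3] mod_add_self2[of i 3] by (simp add: add.assoc)

text \<open>The class of \<theta> follows from invariance. If a leading coefficient of \<theta>
  vanished, the parametrisation Z would lie in a class with a larger bound, and so would W by
  invariance.\<close>

lemma angle_of_normal_form:
  fixes \<kappa> W :: "real \<Rightarrow> real"
  defines "\<theta> \<equiv> jet (angle \<kappa>)"
  assumes k: "smooth_at \<kappa> 0" and he: "e = 1 \<or> e = 2" and pq: "0 < p" "p mod 3 = e" "p < q" "q \<le> 2 * p"
    and W: "smooth_germ W" "jet W \<in> res_class e (p + 6) (q + 6)" "jet W $ (p + 6) \<noteq> 0"
    and eq: "A_equiv (phi3 \<kappa>) (\<lambda>t. (t ^ 3, W t))"
  shows "\<theta> \<in> res_class e (p + 3) (q + 3)" "\<theta> $ (p + 3) \<noteq> 0"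
    "q mod 3 = 2 * e mod 3 \<Longrightarrow> jet W $ (q + 6) \<noteq> 0 \<Longrightarrow> \<theta> $ (q + 3) \<noteq> 0"
proof -
  have n6: "i + 3 + 3 = i + 6" "i + 4 + 3 = i + 7" for i :: nat by simp_all
  obtain Y where Y': "smooth_germ Y" "A_equiv (phi3 \<kappa>) (\<lambda>s. (s ^ 3, Y s))"
    "\<forall>e p q. (e = 1 \<or> e = 2) \<longrightarrow> p \<le> q \<longrightarrow> q \<le> 2 * p \<longrightarrow> jet Y \<in> res_class e (p + 6) (q + 6) \<longrightarrow>
      jet (angle \<kappa>) \<in> res_class e (p + 3) (q + 3)"
    using angle_classes_of_curve[OF k] .
  note Y = Y'[rule_format]
  have eqv: "A_equiv (\<lambda>s. (s ^ 3, Z s)) (\<lambda>t. (t ^ 3, W t)) \<and> A_equiv (\<lambda>t. (t ^ 3, W t)) (\<lambda>s. (s ^ 3, Z s))"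
    if "smooth_germ Z" "A_equiv (phi3 \<kappa>) (\<lambda>s. (s ^ 3, Z s))" for Z
    using A_equiv_sym_cube[OF that(2) phi3_0 that(1)] A_equiv_sym_cube[OF eq phi3_0 W(1)] that(2) eq
      A_equiv_trans by blast
  have "jet Y \<in> res_class e (p + 3 + 3) (q + 3 + 3)"
    by (rule A_equiv_res_class[OF he _ _ _ Y(1) W(1)]) (use pq W(2) eqv[OF Y(1,2)] in \<open>auto simp: n6\<close>)
  then show th: "\<theta> \<in> res_class e (p + 3) (q + 3)"
    unfolding \<theta>_def n6 by (intro Y(3)[OF he]) (use pq in auto)
  have c: "1/6 = (1 - 6 * 0 * \<theta> $ 3) / 6" "1/6 \<noteq> (0::real)" by simp_all
  have pq': "p \<le> q" using pq by simp
  obtain Z where Z': "smooth_germ Z" "A_equiv (parallel3_germ \<kappa> 0) (\<lambda>s. (s ^ 3, Z s))"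
    "jet Z \<in> res_class e (p + 6) (q + 6)"
    "p mod 3 = e \<longrightarrow> real (p + 6) * jet Z $ (p + 6) = \<theta> $ (p + 3) / 2"
    "q mod 3 = 2 * e mod 3 \<longrightarrow> q < 2 * p \<longrightarrow> real (q + 6) * jet Z $ (q + 6) = \<theta> $ (q + 3) / 2"
    "p mod 3 = e \<longrightarrow> q = 2 * p \<longrightarrow>
      real (q + 6) * jet Z $ (q + 6) = (\<theta> $ (q + 3) + 2 * real (p + 3) * 0 * (\<theta> $ (p + 3))\<^sup>2 / (6 * (1/6))) / 2"
    using parallel_curve_normal_parameter[OF he pq(1) pq' pq(4) k th[unfolded \<theta>_def] c[unfolded \<theta>_def], folded \<theta>_def] .
  note Z = Z'[rule_format]
  have ZW: "A_equiv (\<lambda>t. (t ^ 3, W t)) (\<lambda>s. (s ^ 3, Z s))"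
    using eqv[OF Z(1)] Z(2) by (simp add: phi3_eq_parallel)
  show "\<theta> $ (p + 3) \<noteq> 0"
  proof
    assume "\<theta> $ (p + 3) = 0"
    then have Zp: "jet Z $ (p + 6) = 0" using Z(4) pq by simp
    \<comment> \<open>Both bounds become p + 7; for the second residue this is available since p <
      q.\<close>
    have "jet Z \<in> res_class e (p + 4 + 3) (p + 4 + 3)"
    proof (rule res_classI)
      show "jet Z $ i = 0" if "i mod 3 = e" "i < p + 4 + 3" for i
        using res_classD(1)[OF Z(3) that(1)] Zp that(2) by (cases "i = p + 6") auto
      show "jet Z $ i = 0" if "i mod 3 = 2 * e mod 3" "i < p + 4 + 3" for i
        using res_classD(2)[OF Z(3) that(1)] pq that(2) by auto
    qed
    then have "jet W \<in> res_class e (p + 4 + 3) (p + 4 + 3)"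
      by (intro A_equiv_res_class[OF he _ _ _ W(1) Z(1) _ ZW]) auto
    then have "jet W $ (p + 6) = 0" by (rule res_classD(1)) (use pq mod3_add6[of p] in auto)
    then show False using W(3) by simp
  qed
  show "\<theta> $ (q + 3) \<noteq> 0" if q: "q mod 3 = 2 * e mod 3" "jet W $ (q + 6) \<noteq> 0"
  proof
    assume "\<theta> $ (q + 3) = 0"
    then have "real (q + 6) * jet Z $ (q + 6) = 0" using Z(5,6) pq q by (cases "q = 2 * p") auto
    then have Zq: "jet Z $ (q + 6) = 0" by simp
    \<comment> \<open>Only the second bound grows, to q + 7. Invariance applies since q + 4 <= 2 (p
      + 3).\<close>
    have "jet Z \<in> res_class e (p + 3 + 3) (q + 4 + 3)"
    proof (rule res_classI)
      show "jet Z $ i = 0" if "i mod 3 = e" "i < p + 3 + 3" for i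
        using res_classD(1)[OF Z(3) that(1)] that(2) by auto
      show "jet Z $ i = 0" if "i mod 3 = 2 * e mod 3" "i < q + 4 + 3" for i
        using res_classD(2)[OF Z(3) that(1)] Zq that(2) by (cases "i = q + 6") auto
    qed
    then have "jet W \<in> res_class e (p + 3 + 3) (q + 4 + 3)"
      by (intro A_equiv_res_class[OF he _ _ _ W(1) Z(1) _ ZW]) (use pq in auto)
    then have "jet W $ (q + 6) = 0" by (rule res_classD(2)) (use q mod3_add6[of q] in auto)
    then show False using q(2) by simp
  qed
qed

text \<open>The next exponent with the residue of 2p + 6 is 2p + 9.\<close>

lemma res_class_extend:
  assumes he: "e = 1 \<or> e = 2" and p: "p mod 3 = e" and a: "a \<in> res_class e m (2 * p + 6)" "a $ (2 * p + 6) = 0"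
  shows "a \<in> res_class e m (2 * p + 9)"
proof (rule res_classI)
  fix i assume i: "i mod 3 = 2 * e mod 3" "i < 2 * p + 9"
  have q: "(2 * p + 6) mod 3 = 2 * e mod 3"
    using p mod3_add6[of "2 * p"] by (metis mod_mult_right_eq)
  show "a $ i = 0"
  proof (cases "i < 2 * p + 6")
    case True
    then show ?thesis by (rule res_classD(2)[OF a(1) i(1)])
  next
    case False
    then obtain j where j: "i = (2 * p + 6) + j" using le_Suc_ex not_less by metis
    have "(2 * p + 6 + j) mod 3 = (2 * p + 6) mod 3" using q i(1) unfolding j by simp
    then have "3 dvd (2 * p + 6) + j - (2 * p + 6)" by (metis mod_eq_dvd_iff_nat le_add1)
    moreover have "j < 3" using i(2) j by simp
    ultimately have "j = 0" by (auto dest: dvd_imp_le)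
    then show ?thesis using a(2) j by simp
  qed
qed (rule res_classD(1)[OF a(1)])

text \<open>The first exponent n <= 2p + 6 of residue 2e with nonzero coefficient becomes the second
  term of the normal form; it lies above p + 6 by the class of Y and by its residue. If there is
  none, the curve reduces to the monomial form.\<close>

lemma normal_form_exists:
  fixes Y :: "real \<Rightarrow> real"
  assumes he: "e = 1 \<or> e = 2" and p: "0 < p" "p mod 3 = e"
    and Y: "smooth_germ Y" "jet Y \<in> res_class e (p + 6) (p + 6)" "jet Y $ (p + 6) \<noteq> 0"
  shows "(\<exists>q \<epsilon>. p < q \<and> q \<le> 2 * p \<and> q mod 3 = 2 * e mod 3 \<and> (if odd (q - p) then \<epsilon> = 1 else \<epsilon> = 1 \<or> \<epsilon> = -1) \<and>
      A_equiv (\<lambda>t. (t ^ 3, Y t)) (\<lambda>t. (t ^ 3, t ^ (p + 6) + \<epsilon> * t ^ (q + 6)))) \<or>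
    A_equiv (\<lambda>t. (t ^ 3, Y t)) (\<lambda>t. (t ^ 3, t ^ (p + 6)))"
proof -
  define B where "B n \<longleftrightarrow> n mod 3 = 2 * e mod 3 \<and> n \<le> 2 * p + 6 \<and> jet Y $ n \<noteq> 0" for n
  show ?thesis
  proof (cases "\<exists>n. B n")
    case True
    define n where "n = (LEAST n. B n)"
    have n: "B n" unfolding n_def using True by (rule LeastI_ex)
    have least: "\<not> B i" if "i < n" for i using that not_less_Least unfolding n_def by blast
    have R: "jet Y \<in> res_class e (p + 6) n"
      by (rule res_classI) (use res_classD[OF Y(2)] least n in \<open>auto simp: B_def\<close>)
    have "n \<noteq> p + 6" using n p(2) mod3_add6[of p] he by (auto simp: B_def)
    moreover have "\<not> n < p + 6" using n res_classD(2)[OF Y(2)] by (auto simp: B_def)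
    ultimately have np: "p + 6 < n" by simp
    define q where "q = n - 6"
    have nq: "n = q + 6" using np by (simp add: q_def)
    have eq: "A_equiv (\<lambda>t. (t ^ 3, Y t)) (\<lambda>t. (t ^ 3, t ^ (p + 6) +
        (if odd (n - (p + 6)) then 1 else sgn (jet Y $ n / jet Y $ (p + 6))) * t ^ n))"
      by (rule A_equiv_binomial_exists[OF he Y(1) R Y(3)]) (use n np p mod3_add6 in \<open>auto simp: B_def\<close>)
    have "p < q" "q \<le> 2 * p" "q mod 3 = 2 * e mod 3" "n - (p + 6) = q - p"
      using np n nq mod3_add6[of q] by (auto simp: B_def)
    moreover have "sgn (jet Y $ n / jet Y $ (p + 6)) = 1 \<or> sgn (jet Y $ n / jet Y $ (p + 6)) = -1"
      using n Y(3) by (auto simp: B_def sgn_if)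
    moreover define \<epsilon> where "\<epsilon> = (if odd (q - p) then 1 else sgn (jet Y $ n / jet Y $ (p + 6)))"
    ultimately have "p < q \<and> q \<le> 2 * p \<and> q mod 3 = 2 * e mod 3 \<and> (if odd (q - p) then \<epsilon> = 1 else \<epsilon> = 1 \<or> \<epsilon> = -1) \<and>
      A_equiv (\<lambda>t. (t ^ 3, Y t)) (\<lambda>t. (t ^ 3, t ^ (p + 6) + \<epsilon> * t ^ (q + 6)))"
      using eq by (simp add: nq)
    then show ?thesis by blast
  next
    case False
    have q: "(2 * p + 6) mod 3 = 2 * e mod 3" using p mod3_add6[of "2 * p"] by (metis mod_mult_right_eq)
    have "jet Y \<in> res_class e (p + 6) (2 * p + 6)"
      by (rule res_classI) (use res_classD[OF Y(2)] False in \<open>auto simp: B_def\<close>)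
    then have "jet Y \<in> res_class e (p + 6) (2 * p + 9)"
      by (rule res_class_extend[OF he p(2)]) (use False q in \<open>auto simp: B_def\<close>)
    \<comment> \<open>For leading exponent m = p + 6 the bound 2p + 9 is 2m - 3, the one that
      \<open>A_equiv_monomial\<close> starts from.\<close>
    then have "jet Y \<in> res_class e (p + 3 + 3) (2 * (p + 3) + 3)" by (simp add: add.assoc)
    then have "A_equiv (\<lambda>t. (t ^ 3, Y t)) (\<lambda>t. (t ^ 3, t ^ (p + 3 + 3)))"
      by (intro A_equiv_monomial[OF he _ _ Y(1)]) (use p Y(3) in \<open>simp_all add: add.assoc\<close>)
    then show ?thesis by (simp add: add.assoc)
  qed
qed

text \<open>For q < 2p the coefficients of degrees p + 6 and q + 6 agree for \<delta> and for 0, so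
  both curves reduce to the same binomial with the same sign. For q = 2p the monomial form is
  equivalent to the vanishing of degree 2p + 6: by reduction in one direction, by invariance in the
  other.\<close>

lemma parallel_curve_singularity:
  fixes \<kappa> W :: "real \<Rightarrow> real" and \<delta> c :: real
  defines "\<theta> \<equiv> jet (angle \<kappa>)"
  assumes k: "smooth_at \<kappa> 0" and he: "e = 1 \<or> e = 2" and pq: "0 < p" "p mod 3 = e" "p < q" "q \<le> 2 * p"
    and c: "c = (1 - 6 * \<delta> * \<theta> $ 3) / 6" "c \<noteq> 0"
    and W: "smooth_germ W" "jet W \<in> res_class e (p + 6) (q + 6)" "jet W $ (p + 6) \<noteq> 0"
    and eq: "A_equiv (phi3 \<kappa>) (\<lambda>t. (t ^ 3, W t))"
  shows "(\<exists>q \<epsilon>. p < q \<and> q \<le> 2 * p \<and> q mod 3 = 2 * e mod 3 \<and> (if odd (q - p) then \<epsilon> = 1 else \<epsilon> = 1 \<or> \<epsilon> = -1) \<and>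
      A_equiv (parallel3_germ \<kappa> \<delta>) (\<lambda>t. (t ^ 3, t ^ (p + 6) + \<epsilon> * t ^ (q + 6)))) \<or>
    A_equiv (parallel3_germ \<kappa> \<delta>) (\<lambda>t. (t ^ 3, t ^ (p + 6)))" (is ?A)
    and "q mod 3 = 2 * e mod 3 \<Longrightarrow> q < 2 * p \<Longrightarrow> jet W $ (q + 6) \<noteq> 0 \<Longrightarrow> A_equiv (parallel3_germ \<kappa> \<delta>) (phi3 \<kappa>)"
    and "q = 2 * p \<Longrightarrow> A_equiv (parallel3_germ \<kappa> \<delta>) (\<lambda>t. (t ^ 3, t ^ (p + 6))) \<longleftrightarrow>
      \<theta> $ (q + 3) + 2 * real (p + 3) * \<delta> * (\<theta> $ (p + 3))\<^sup>2 / (6 * c) = 0"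
proof -
  note th = angle_of_normal_form[OF k he pq W eq, folded \<theta>_def]
  have pq': "p \<le> q" using pq by simp
  obtain Y where Y': "smooth_germ Y" "A_equiv (parallel3_germ \<kappa> \<delta>) (\<lambda>s. (s ^ 3, Y s))"
    "jet Y \<in> res_class e (p + 6) (q + 6)"
    "p mod 3 = e \<longrightarrow> real (p + 6) * jet Y $ (p + 6) = \<theta> $ (p + 3) / 2"
    "q mod 3 = 2 * e mod 3 \<longrightarrow> q < 2 * p \<longrightarrow> real (q + 6) * jet Y $ (q + 6) = \<theta> $ (q + 3) / 2"
    "p mod 3 = e \<longrightarrow> q = 2 * p \<longrightarrow>
      real (q + 6) * jet Y $ (q + 6) = (\<theta> $ (q + 3) + 2 * real (p + 3) * \<delta> * (\<theta> $ (p + 3))\<^sup>2 / (6 * c)) / 2"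
    using parallel_curve_normal_parameter[OF he pq(1) pq' pq(4) k th(1)[unfolded \<theta>_def] c[unfolded \<theta>_def], folded \<theta>_def] .
  note Y = Y'[rule_format]
  have Yp: "jet Y $ (p + 6) \<noteq> 0" using Y(4)[OF pq(2)] th(2) by auto
  have YR: "jet Y \<in> res_class e (p + 6) (p + 6)"
    using Y(3) res_class_mono[of "p + 6" "p + 6" "p + 6" "q + 6" e] pq by auto
  show ?A
    using normal_form_exists[OF he pq(1,2) Y(1) YR Yp] A_equiv_trans[OF Y(2)] by blast
  show "A_equiv (parallel3_germ \<kappa> \<delta>) (phi3 \<kappa>)"
    if q: "q mod 3 = 2 * e mod 3" "q < 2 * p" "jet W $ (q + 6) \<noteq> 0"
  proof -
    have c0: "1/6 = (1 - 6 * 0 * \<theta> $ 3) / 6" "1/6 \<noteq> (0::real)" by simp_all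
    obtain Z where Z': "smooth_germ Z" "A_equiv (parallel3_germ \<kappa> 0) (\<lambda>s. (s ^ 3, Z s))"
      "jet Z \<in> res_class e (p + 6) (q + 6)"
      "p mod 3 = e \<longrightarrow> real (p + 6) * jet Z $ (p + 6) = \<theta> $ (p + 3) / 2"
      "q mod 3 = 2 * e mod 3 \<longrightarrow> q < 2 * p \<longrightarrow> real (q + 6) * jet Z $ (q + 6) = \<theta> $ (q + 3) / 2"
      "p mod 3 = e \<longrightarrow> q = 2 * p \<longrightarrow>
        real (q + 6) * jet Z $ (q + 6) = (\<theta> $ (q + 3) + 2 * real (p + 3) * 0 * (\<theta> $ (p + 3))\<^sup>2 / (6 * (1/6))) / 2"
      using parallel_curve_normal_parameter[OF he pq(1) pq' pq(4) k th(1)[unfolded \<theta>_def] c0[unfolded \<theta>_def], folded \<theta>_def] .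
  note Z = Z'[rule_format]
    have tq: "\<theta> $ (q + 3) \<noteq> 0" by (rule th(3)[OF q(1,3)])
    have "real (p + 6) * jet Z $ (p + 6) = real (p + 6) * jet Y $ (p + 6)" by (simp only: Y(4)[OF pq(2)] Z(4)[OF pq(2)])
    then have ZYp: "jet Z $ (p + 6) = jet Y $ (p + 6)" by simp
    have "real (q + 6) * jet Z $ (q + 6) = real (q + 6) * jet Y $ (q + 6)" by (simp only: Y(5)[OF q(1,2)] Z(5)[OF q(1,2)])
    then have ZYq: "jet Z $ (q + 6) = jet Y $ (q + 6)" by simp
    have Yq: "jet Y $ (q + 6) \<noteq> 0" using Y(5)[OF q(1,2)] tq by auto
    let ?f = "\<lambda>t. (t ^ 3, t ^ (p + 6) +
      (if odd (q + 6 - (p + 6)) then 1 else sgn (jet Y $ (q + 6) / jet Y $ (p + 6))) * t ^ (q + 6))"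
    have eY: "A_equiv (\<lambda>t. (t ^ 3, Y t)) ?f"
      by (rule A_equiv_binomial_exists[OF he Y(1,3) Yp Yq]) (use pq q mod3_add6 in auto)
    have eZ: "A_equiv (\<lambda>t. (t ^ 3, Z t)) ?f"
      unfolding ZYp[symmetric] ZYq[symmetric]
      by (rule A_equiv_binomial_exists[OF he Z(1,3)]) (use pq q mod3_add6 ZYp ZYq Yp Yq in auto)
    have "A_equiv (phi3 \<kappa>) ?f" using A_equiv_trans[OF Z(2) eZ] by (simp add: phi3_eq_parallel)
    then have "A_equiv ?f (phi3 \<kappa>)"
      by (rule A_equiv_sym_cube)
         (auto simp: smooth_germ_def power_0_left intro!: smooth_at_add smooth_at_mult smooth_at_power)
    then show ?thesis using A_equiv_trans[OF Y(2) A_equiv_trans[OF eY]] by blast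
  qed
  show "A_equiv (parallel3_germ \<kappa> \<delta>) (\<lambda>t. (t ^ 3, t ^ (p + 6))) \<longleftrightarrow>
      \<theta> $ (q + 3) + 2 * real (p + 3) * \<delta> * (\<theta> $ (p + 3))\<^sup>2 / (6 * c) = 0" (is "?L \<longleftrightarrow> ?R = 0")
    if q: "q = 2 * p"
  proof -
    have n9: "p + 3 + 3 = p + 6" "2 * (p + 3) + 3 = 2 * p + 9" by simp_all
    have Yq: "real (q + 6) * jet Y $ (q + 6) = ?R / 2" by (rule Y(6)[OF pq(2) q])
    have "jet Y $ (q + 6) = 0 \<longleftrightarrow> ?R / 2 = 0" unfolding Yq[symmetric] by simp
    then have YR0: "?R = 0 \<longleftrightarrow> jet Y $ (2 * p + 6) = 0" unfolding q by simp
    show ?thesis unfolding YR0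
    proof
      assume ?L
      moreover have "A_equiv (\<lambda>s. (s ^ 3, Y s)) (parallel3_germ \<kappa> \<delta>)"
        by (rule A_equiv_sym_cube[OF Y(2) parallel3_germ_0 Y(1)])
      ultimately have e: "A_equiv (\<lambda>s. (s ^ 3, Y s)) (\<lambda>t. (t ^ 3, t ^ (p + 6)))" using A_equiv_trans by blast
      have g: "smooth_germ (\<lambda>t::real. t ^ (p + 6))" by (rule smooth_germ_power) simp
      \<comment> \<open>Up to the shift by 3 the bounds are p + 3 and 2 (p + 3), the extreme pair
        for which the class is invariant.\<close>
      have "jet (\<lambda>t::real. t ^ (p + 6)) \<in> res_class e (p + 3 + 3) (2 * p + 6 + 3)"
        unfolding jet_power[OF smooth_at_ident] jet_ident
      proof (rule res_classI)
        fix i assume i: "i mod 3 = 2 * e mod 3"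
        have "i \<noteq> p + 6" using i mod3_add6[of p] pq(2) he by auto
        then show "(fps_X ^ (p + 6) :: real fps) $ i = 0" by (simp add: fps_X_power_nth)
      qed (simp add: fps_X_power_nth)
      then have "jet Y \<in> res_class e (p + 3 + 3) (2 * p + 6 + 3)"
        by (intro A_equiv_res_class[OF he _ _ _ Y(1) g _ e]) auto
      then show "jet Y $ (2 * p + 6) = 0"
        by (rule res_classD(2)) (use mod3_add6[of "2 * p"] pq(2) in \<open>auto intro: mod_mult_right_eq[symmetric, of 2 p 3, THEN trans]\<close>)
    next
      assume "jet Y $ (2 * p + 6) = 0"
      then have "jet Y \<in> res_class e (p + 6) (2 * p + 9)"
        using Y(3) unfolding q by (intro res_class_extend[OF he pq(2)])
      then have "A_equiv (\<lambda>t. (t ^ 3, Y t)) (\<lambda>t. (t ^ 3, t ^ (p + 3 + 3)))"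
        by (intro A_equiv_monomial[OF he _ _ Y(1)]) (use pq Yp in \<open>simp_all only: n9, simp_all\<close>)
      then show ?L using A_equiv_trans[OF Y(2)] by (simp add: n9)
    qed
  qed
qed

subsection \<open>Multiplicity\<close>

lemma has_multiplicityI:
  fixes f :: "real \<Rightarrow> real \<times> real"
  assumes f: "smooth_at (\<lambda>t. fst (f t)) 0" "smooth_at (\<lambda>t. snd (f t)) 0"
    and low: "\<And>i. i < m \<Longrightarrow> jet (\<lambda>t. fst (f t)) $ i = 0" "\<And>i. i < m \<Longrightarrow> jet (\<lambda>t. snd (f t)) $ i = 0"
    and top: "jet (\<lambda>t. fst (f t)) $ m \<noteq> 0"
  shows "has_multiplicity f m"
proof -
  obtain g where g: "smooth_at g 0" "\<forall>\<^sub>F t in nhds 0. fst (f t) = t ^ m * g t"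
    "jet (\<lambda>t. fst (f t)) = fps_X ^ m * jet g"
    using smooth_division_power[OF f(1) low(1)] by blast
  obtain h where h: "smooth_at h 0" "\<forall>\<^sub>F t in nhds 0. snd (f t) = t ^ m * h t"
    using smooth_division_power[OF f(2) low(2)] by blast
  have g0: "g 0 \<noteq> 0" using top unfolding g(3) by (simp add: fps_X_power_mult_nth)
  show ?thesis unfolding has_multiplicity_def
  proof (intro exI conjI)
    show "smooth_at (\<lambda>t. (fact m * g t, fact m * h t)) 0"
      using g h by (intro smooth_at_Pair smooth_at_mult) auto
    show "(fact m * g 0, fact m * h 0) \<noteq> 0" using g0 by (simp add: zero_prod_def)
    show "\<forall>\<^sub>F t in nhds 0. f t = (t ^ m / fact m) *\<^sub>R (fact m * g t, fact m * h t)"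
      using g(2) h(2) by eventually_elim (simp add: prod_eq_iff)
  qed
qed

lemma compose_low_order:
  fixes f a :: "real fps"
  assumes "f $ 0 = 0" "\<And>i. i < d \<Longrightarrow> a $ i = 0" "i < d" shows "(f oo a) $ i = 0"
proof -
  have key: "f $ k * (a ^ k) $ i = 0" for k
  proof (cases k)
    case 0
    then show ?thesis using assms(1) by simp
  next
    case (Suc j)
    have "(a * a ^ j) $ i = 0" unfolding fps_mult_nth using assms by (intro sum.neutral) auto
    then show ?thesis using Suc by simp
  qed
  show ?thesis unfolding fps_compose_nth by (intro sum.neutral ballI key)
qed

lemma mult_low_order:
  fixes a b :: "real fps"
  assumes "\<And>i. i < m \<Longrightarrow> a $ i = 0" "\<And>i. i < n \<Longrightarrow> b $ i = 0"
  shows "i < m + n \<Longrightarrow> (a * b) $ i = 0" "(a * b) $ (m + n) = a $ m * b $ n"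
proof -
  show "(a * b) $ i = 0" if "i < m + n"
    unfolding fps_mult_nth
  proof (intro sum.neutral ballI)
    fix j assume "j \<in> {0..i}"
    then have "j < m \<or> i - j < n" using that by auto
    then show "a $ j * b $ (i - j) = 0" using assms by auto
  qed
  have "(a * b) $ (m + n) = (\<Sum>j\<in>{m}. a $ j * b $ (m + n - j))"
    unfolding fps_mult_nth
  proof (rule sum.mono_neutral_right)
    show "\<forall>j\<in>{0..m + n} - {m}. a $ j * b $ (m + n - j) = 0"
    proof
      fix j assume "j \<in> {0..m + n} - {m}"
      then have "j < m \<or> m + n - j < n" by auto
      then show "a $ j * b $ (m + n - j) = 0" using assms by auto
    qed
  qed auto
  then show "(a * b) $ (m + n) = a $ m * b $ n" by simp
qed

text \<open>A is the speed. The condition on \<delta> removes its term of degree 2, and the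
  vanishing coefficients of \<theta> remove the others below degree 5. Integration gives order at
  least 6 for x, and the factor sin \<theta> of order at least 3 gives order at least 9 for y. The
  nonzero coefficient at j makes the order finite, so that a multiplicity exists.\<close>

lemma degenerate_parallel_jets:
  fixes \<kappa> :: "real \<Rightarrow> real" and \<delta> :: real
  defines "\<theta> \<equiv> jet (angle \<kappa>)"
  assumes k: "smooth_at \<kappa> 0" and d: "\<delta> * (6 * \<theta> $ 3) = 1"
    and th: "\<theta> $ 1 = 0" "\<theta> $ 2 = 0" "\<theta> $ 4 = 0" "\<theta> $ 5 = 0" and nz: "j > 3" "\<theta> $ j \<noteq> 0"
  shows "\<exists>m\<ge>5. has_multiplicity (parallel3_germ \<kappa> \<delta>) m"
    and "\<And>i. i < 6 \<Longrightarrow> jet (\<lambda>t. fst (parallel3_germ \<kappa> \<delta> t)) $ i = 0"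
    and "\<And>i. i < 9 \<Longrightarrow> jet (\<lambda>t. snd (parallel3_germ \<kappa> \<delta> t)) $ i = 0"
    and "jet (\<lambda>t. fst (parallel3_germ \<kappa> \<delta> t)) $ 6 = 0 \<Longrightarrow> jet (\<lambda>t. snd (parallel3_germ \<kappa> \<delta> t)) $ 9 = 0"
proof -
  define A where "A = fps_const (1/2) * fps_X\<^sup>2 - fps_const \<delta> * fps_deriv \<theta>"
  define x where "x = jet (\<lambda>t. fst (parallel3_germ \<kappa> \<delta> t))"
  define y where "y = jet (\<lambda>t. snd (parallel3_germ \<kappa> \<delta> t))"
  have dx: "fps_deriv x = A * (jet cos oo \<theta>)" and dy: "fps_deriv y = A * (jet sin oo \<theta>)"
    unfolding x_def y_def A_def \<theta>_def by (rule jet_parallel3[OF k])+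
  have sg: "smooth_germ (\<lambda>t. fst (parallel3_germ \<kappa> \<delta> t))" "smooth_germ (\<lambda>t. snd (parallel3_germ \<kappa> \<delta> t))"
    by (rule smooth_germ_parallel3[OF k])+
  have x0: "x $ 0 = 0" "y $ 0 = 0" by (simp_all add: x_def y_def)
  have An: "A $ i = (if i = 2 then 1/2 else 0) - \<delta> * (real (i + 1) * \<theta> $ (i + 1))" for i
    by (simp add: A_def fps_X_power_nth fps_deriv_nth)
  have A_low: "A $ i = 0" if "i < 5" for i
  proof -
    have "i = 0 \<or> i = 1 \<or> i = 2 \<or> i = 3 \<or> i = 4" using that by linarith
    then show ?thesis unfolding An using d th by (auto simp: numeral_eq_Suc)
  qed
  have c0: "(jet cos oo \<theta>) $ 0 = 1" by simp
  have th_low: "\<theta> $ i = 0" if "i < 3" for i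
  proof -
    have "i = 0 \<or> i = 1 \<or> i = 2" using that by linarith
    then show ?thesis using th by (auto simp: \<theta>_def)
  qed
  have s_low: "(jet sin oo \<theta>) $ i = 0" if "i < 3" for i
    by (rule compose_low_order[OF _ th_low that]) auto
  have xn: "real (i + 1) * x $ (i + 1) = (A * (jet cos oo \<theta>)) $ i" for i
    unfolding dx[symmetric] by simp
  have yn: "real (i + 1) * y $ (i + 1) = (A * (jet sin oo \<theta>)) $ i" for i
    unfolding dy[symmetric] by simp
  \<comment> \<open>Degree j - 1 is above 2, so t^2/2 does not interfere with the contribution of
    \<theta>'.\<close>
  have "A $ (j - 1) \<noteq> 0" using nz d unfolding An by auto
  define l where "l = (LEAST i. A $ i \<noteq> 0)"
  have l: "A $ l \<noteq> 0" unfolding l_def by (rule LeastI[of _ "j - 1"]) (rule \<open>A $ (j - 1) \<noteq> 0\<close>)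
  have ll: "A $ i = 0" if "i < l" for i using that not_less_Least unfolding l_def by blast
  have l5: "l \<ge> 5" using A_low l by (meson not_less)
  have x_l: "x $ i = 0" "y $ i = 0" if "i < Suc l" for i
  proof -
    have "(A * (jet cos oo \<theta>)) $ (i - 1) = 0 \<and> (A * (jet sin oo \<theta>)) $ (i - 1) = 0" if "i > 0"
      using mult_low_order(1)[of l A 0 _ "i - 1"] ll that \<open>i < Suc l\<close> by simp
    then show "x $ i = 0" "y $ i = 0" using xn[of "i - 1"] yn[of "i - 1"] x0 by (cases i; simp)+
  qed
  have "real (l + 1) * x $ (l + 1) = A $ l"
    using xn[of l] mult_low_order(2)[of l A 0 "jet cos oo \<theta>"] ll c0 by simp
  then have "x $ Suc l \<noteq> 0" using l by auto
  then have "has_multiplicity (parallel3_germ \<kappa> \<delta>) (Suc l)"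
    using sg x_l by (intro has_multiplicityI) (auto simp: smooth_germ_def x_def y_def)
  then show "\<exists>m\<ge>5. has_multiplicity (parallel3_germ \<kappa> \<delta>) m" using l5 by (intro exI[of _ "Suc l"]) auto
  show "jet (\<lambda>t. fst (parallel3_germ \<kappa> \<delta> t)) $ i = 0" if "i < 6" for i
    using x_l(1)[of i] that l5 by (simp add: x_def)
  have ms: "(A * (jet sin oo \<theta>)) $ i = 0" if "i < 8" for i
    by (rule mult_low_order(1)[of 5 A 3]) (use A_low s_low that in auto)
  show "jet (\<lambda>t. snd (parallel3_germ \<kappa> \<delta> t)) $ i = 0" if "i < 9" for i
    using yn[of "i - 1"] ms[of "i - 1"] that x0 unfolding y_def[symmetric] by (cases i) auto
  \<comment> \<open>If x has no term of degree 6, the speed has none of degree 5, and its product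
    with sin \<theta> has none of degree 8.\<close>
  show "jet (\<lambda>t. snd (parallel3_germ \<kappa> \<delta> t)) $ 9 = 0"
    if "jet (\<lambda>t. fst (parallel3_germ \<kappa> \<delta> t)) $ 6 = 0"
  proof -
    have "(A * (jet cos oo \<theta>)) $ (5 + 0) = A $ 5 * (jet cos oo \<theta>) $ 0"
      by (rule mult_low_order(2)[of 5 A 0]) (use A_low in auto)
    then have "A $ 5 = 0" using xn[of 5] that c0 unfolding x_def[symmetric] by simp
    moreover have "(A * (jet sin oo \<theta>)) $ (5 + 3) = A $ 5 * (jet sin oo \<theta>) $ 3"
      by (rule mult_low_order(2)[of 5 A 3]) (use A_low s_low in auto)
    ultimately show ?thesis using yn[of 8] unfolding y_def[symmetric] by simp
  qed
qed

subsection \<open>Deformations with moduli\<close>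

text \<open>Families affine in u are closed under partial derivatives: d/dt acts on b and on all g
  i, and the derivative in the i-th parameter is g i with zero linear part. Hence the induction over
  all b and g.\<close>

lemma C_family_affine:
  fixes b :: "real \<Rightarrow> real \<times> real"
  assumes I: "open I"
  shows "\<lbrakk>\<And>t. t \<in> I \<Longrightarrow> smooth_at b t; \<And>t i. t \<in> I \<Longrightarrow> smooth_at (g i) t;
    \<And>u t. u \<in> topspace (Euclidean_space r) \<Longrightarrow> t \<in> I \<Longrightarrow> F u t = b t + (\<Sum>i<r. u i *\<^sub>R g i t)\<rbrakk> \<Longrightarrow>
    C_family n r (topspace (Euclidean_space r) \<times> I) F"
proof (induction n arbitrary: b g F)
  case 0
  let ?T = "Euclidean_space r"
  have s: "subtopology (prod_topology ?T euclideanreal) (topspace ?T \<times> I) = prod_topology ?T (top_of_set I)"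
    by (simp add: prod_topology_subtopology)
  have cm: "continuous_map (prod_topology ?T (top_of_set I)) euclidean (\<lambda>p. h (snd p))"
    if "\<And>t. t \<in> I \<Longrightarrow> smooth_at h t" for h :: "real \<Rightarrow> real \<times> real"
  proof -
    have "continuous_on I h"
      using that by (auto intro!: continuous_at_imp_continuous_on smooth_at_isCont)
    then have "continuous_map (top_of_set I) euclidean h" by simp
    then show ?thesis using continuous_map_compose[OF continuous_map_snd, of "top_of_set I" euclidean h ?T]
      by (simp add: o_def)
  qed
  have "continuous_map ?T euclideanreal (\<lambda>u. u i)" for i
    unfolding Euclidean_space_def
    by (rule continuous_map_from_subtopology) (rule continuous_map_product_projection, simp)
  then have cu: "continuous_map (prod_topology ?T (top_of_set I)) euclideanreal (\<lambda>p. fst p i)" for i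
    using continuous_map_compose[OF continuous_map_fst, of ?T euclideanreal "\<lambda>u. u i" "top_of_set I"]
    by (simp add: o_def)
  have sc: "continuous_map (prod_topology ?T (top_of_set I)) euclidean (\<lambda>p. fst p i *\<^sub>R g i (snd p))" for i
    using cu[of i] cm[OF "0.prems"(2), of i] by (simp add: continuous_map_atin tendsto_scaleR)
  have "continuous_map (prod_topology ?T (top_of_set I)) euclidean
      (\<lambda>p. b (snd p) + (\<Sum>i<r. fst p i *\<^sub>R g i (snd p)))"
    by (intro continuous_map_add continuous_map_sum cm 0 sc) auto
  then have "continuous_map (prod_topology ?T (top_of_set I)) euclidean (\<lambda>(u, t). F u t)"
    by (rule continuous_map_eq) (use 0 in \<open>auto simp: topspace_prod_topology\<close>)
  then show ?case by (simp add: s)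
next
  case (Suc n)
  let ?E = "topspace (Euclidean_space r)"
  let ?D = "\<lambda>h t. frechet_derivative h (at t) (1::real)"
  have hd: "(h has_vector_derivative ?D h t) (at t)" if "smooth_at h t" for h :: "real \<Rightarrow> real \<times> real" and t
  proof -
    have D: "(h has_derivative frechet_derivative h (at t)) (at t)" by (rule smooth_at_has_derivative[OF that])
    have "frechet_derivative h (at t) v = v *\<^sub>R ?D h t" for v
      using linear_scale[OF has_derivative_linear[OF D], of v 1] by simp
    then have "frechet_derivative h (at t) = (\<lambda>v. v *\<^sub>R ?D h t)" by (rule ext)
    then show ?thesis using D by (simp only: has_vector_derivative_def)
  qed
  have dt: "(F u has_vector_derivative ?D b t + (\<Sum>i<r. u i *\<^sub>R ?D (g i) t)) (at t)" if "u \<in> ?E" "t \<in> I" for u t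
  proof -
    have "((\<lambda>t. b t + (\<Sum>i<r. u i *\<^sub>R g i t)) has_vector_derivative ?D b t + (\<Sum>i<r. u i *\<^sub>R ?D (g i) t)) (at t)"
      using Suc.prems that
      by (intro has_vector_derivative_add has_vector_derivative_sum hd)
         (auto intro!: bounded_linear.has_vector_derivative[OF bounded_linear_scaleR_right] hd)
    then show ?thesis
      by (rule has_vector_derivative_transform_within_open[OF _ I that(2)]) (use Suc.prems(3) that in auto)
  qed
  have us: "u(i := s) \<in> ?E" if "u \<in> ?E" "i < r" for u i s
    using that by (auto simp: topspace_Euclidean_space)
  have du: "((\<lambda>s. F (u(i := s)) t) has_vector_derivative g i t) (at (u i))" if "u \<in> ?E" "t \<in> I" "i < r" for u t i
  proof -
    have sm: "(\<Sum>j<r. (u(i := s)) j *\<^sub>R g j t) = s *\<^sub>R g i t + (\<Sum>j\<in>{..<r} - {i}. u j *\<^sub>R g j t)" for s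
      using that(3) by (subst sum.remove[of _ i]) (auto intro!: sum.cong)
    have "(\<lambda>s. F (u(i := s)) t) = (\<lambda>s. b t + (s *\<^sub>R g i t + (\<Sum>j\<in>{..<r} - {i}. u j *\<^sub>R g j t)))"
      by (rule ext) (simp only: Suc.prems(3)[OF us[OF that(1,3)] that(2)] sm)
    then show ?thesis by (auto intro!: derivative_eq_intros)
  qed
  have 1: "C_family n r (?E \<times> I) (\<lambda>u t. vector_derivative (F u) (at t))"
  proof (rule Suc.IH)
    show "vector_derivative (F u) (at t) = ?D b t + (\<Sum>i<r. u i *\<^sub>R ?D (g i) t)" if "u \<in> ?E" "t \<in> I" for u t
      by (rule vector_derivative_at[OF dt[OF that]])
  qed (use Suc.prems in \<open>auto intro: smooth_at_frechet\<close>)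
  have 2: "C_family n r (?E \<times> I) (\<lambda>u t. vector_derivative (\<lambda>s. F (u(i := s)) t) (at (u i)))" if "i < r" for i
  proof (rule Suc.IH)
    show "vector_derivative (\<lambda>s. F (u(i := s)) t) (at (u i)) = g i t + (\<Sum>i<r. u i *\<^sub>R (\<lambda>i t. 0) i t)"
      if "u \<in> ?E" "t \<in> I" for u t
      using vector_derivative_at[OF du[OF that \<open>i < r\<close>]] by simp
  qed (use Suc.prems in auto)
  have 3: "F u differentiable (at t)" if "u \<in> ?E" "t \<in> I" for u t
    by (rule differentiableI_vector[OF dt[OF that]])
  have 4: "(\<lambda>s. F (u(i := s)) t) differentiable (at (u i))" if "u \<in> ?E" "t \<in> I" "i < r" for u t i
    by (rule differentiableI_vector[OF du[OF that]])
  show ?case using 1 2 3 4 by auto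
qed

text \<open>It suffices to have a continuous path in parameter space that starts at the origin and
  has pairwise inequivalent germs for 0 < s < 1: every neighbourhood of the origin contains the
  image of an interval, hence uncountably many parameters.\<close>

lemma not_A_simpleI:
  fixes f :: "real \<Rightarrow> real \<times> real" and g :: "nat \<Rightarrow> real \<Rightarrow> real \<times> real" and v :: "real \<Rightarrow> nat \<Rightarrow> real"
  assumes f: "smooth_germ f" and g: "\<And>i t. smooth_at (g i) t" "\<And>i. g i 0 = 0"
    and v: "\<And>i. continuous_on UNIV (\<lambda>s. v s i)" "\<And>i. v 0 i = 0"
    and inj: "\<And>s s'. 0 < s \<Longrightarrow> s < 1 \<Longrightarrow> 0 < s' \<Longrightarrow> s' < 1 \<Longrightarrow>
      A_equiv (\<lambda>t. f t + (\<Sum>i<r. v s i *\<^sub>R g i t)) (\<lambda>t. f t + (\<Sum>i<r. v s' i *\<^sub>R g i t)) \<Longrightarrow> s = s'"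
  shows "\<not> A_simple f"
proof
  assume A: "A_simple f"
  define F where "F u t = f t + (\<Sum>i<r. u i *\<^sub>R g i t)" for u t
  \<comment> \<open>Cut off at r, so that the path stays in
    \<open>Euclidean_space r\<close>.\<close>
  define c where "c s = (\<lambda>i. if i < r then v s i else 0)" for s
  have f0: "smooth_at f 0" "f 0 = 0" using f by (auto simp: smooth_germ_def)
  obtain e where e: "e > 0" "\<And>x. dist x 0 < e \<Longrightarrow> smooth_at f x"
    using smooth_at_nearby[OF f0(1)] by (auto simp: eventually_nhds_metric)
  let ?W = "topspace (Euclidean_space r) \<times> ball (0::real) e"
  have "deformation r F f"
    unfolding deformation_def
  proof (intro conjI exI[of _ ?W])
    show "openin (prod_topology (Euclidean_space r) euclideanreal) ?W"
      by (simp add: openin_prod_Times_iff)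
    show "(\<lambda>_. 0, 0) \<in> ?W" using e(1) by (simp add: topspace_Euclidean_space)
    show "\<forall>n. C_family n r ?W F"
      by (intro allI C_family_affine[where b = f and g = g]) (use e g in \<open>auto simp: F_def dist_commute\<close>)
    show "\<forall>u. (u, 0) \<in> ?W \<longrightarrow> F u 0 = 0" by (simp add: F_def f0 g)
    show "\<forall>\<^sub>F t in nhds 0. F (\<lambda>_. 0) t = f t" by (simp add: F_def)
  qed
  moreover have "moduli_at_0 r F (c ` {0<..<1})"
    unfolding moduli_at_0_def
  proof (intro conjI allI impI)
    show "c ` {0<..<1} \<subseteq> topspace (Euclidean_space r)" by (auto simp: c_def topspace_Euclidean_space)
    have Fc: "F (c s) = (\<lambda>t. f t + (\<Sum>i<r. v s i *\<^sub>R g i t))" for s by (simp add: F_def c_def fun_eq_iff)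
    show "pairwise (\<lambda>u v. \<not> A_equiv (F u) (F v)) (c ` {0<..<1})"
    proof (rule pairwiseI)
      fix u w assume u: "u \<in> c ` {0<..<1}" "w \<in> c ` {0<..<1}" "u \<noteq> w"
      then obtain s s' where s: "u = c s" "w = c s'" "0 < s" "s < 1" "0 < s'" "s' < 1" by auto
      show "\<not> A_equiv (F u) (F w)"
        using inj[OF s(3-6)] u(3) unfolding s(1,2) Fc by blast
    qed
    fix U assume U: "openin (Euclidean_space r) U \<and> (\<lambda>_. 0) \<in> U"
    have "continuous_map euclideanreal (Euclidean_space r) c"
      unfolding c_def continuous_map_componentwise_Euclidean_space using v(1) by simp
    then have "openin euclideanreal {s \<in> topspace euclideanreal. c s \<in> U}"
      using U by (intro openin_continuous_map_preimage) auto
    then have "open {s. c s \<in> U}" by simp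
    moreover have "c 0 = (\<lambda>_. 0)" by (simp add: c_def v fun_eq_iff)
    then have "0 \<in> {s. c s \<in> U}" using U by simp
    ultimately obtain \<eta> where \<eta>: "\<eta> > 0" "ball 0 \<eta> \<subseteq> {s. c s \<in> U}" using open_contains_ball by blast
    have sub: "c ` {0<..<min \<eta> 1} \<subseteq> c ` {0<..<1} \<inter> U" 
    proof -
      have "c s \<in> U" if "0 < s" "s < \<eta>" for s
        using subsetD[OF \<eta>(2), of s] that by (simp add: dist_real_def)
      then show ?thesis by auto
    qed
    have "inj_on c {0<..<min \<eta> 1}"
    proof (rule inj_onI)
      fix s s' assume "s \<in> {0<..<min \<eta> 1}" "s' \<in> {0<..<min \<eta> 1}" "c s = c s'"
      moreover from this have "A_equiv (F (c s)) (F (c s'))" by simp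
      ultimately show "s = s'" unfolding Fc by (intro inj) auto
    qed
    moreover have "uncountable {0<..<min \<eta> 1}" using \<eta>(1) by (simp add: uncountable_open_interval)
    ultimately have "uncountable (c ` {0<..<min \<eta> 1})" using countable_image_inj_on by blast
    then show "uncountable (c ` {0<..<1} \<inter> U)" using sub countable_subset by blast
  qed
  ultimately show False using A unfolding A_simple_def by blast
qed

text \<open>The derivation rule is used twice: first to see that functions of the curve have no
  terms in degrees 1 to d - 1, then to see that below degree 2d only the constant terms of the
  partial derivatives of H meet f and g.\<close>

lemma jet_plane_low_order:
  assumes fg: "smooth_germ f" "smooth_germ g" and H: "smooth_at H 0"
    and low: "\<And>i. i < d \<Longrightarrow> jet f $ i = 0" "\<And>i. i < d \<Longrightarrow> jet g $ i = 0" and n: "0 < n" "n < 2 * d"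
  shows "jet (\<lambda>t. H (f t, g t)) $ n = partial1 H 0 * jet f $ n + partial2 H 0 * jet g $ n"
proof -
  have fg0: "f 0 = 0" "g 0 = 0" using fg by (auto simp: smooth_germ_def)
  have X: "(fps_X * fps_deriv b) $ j = real j * b $ j" for b :: "real fps" and j by (cases j) (auto simp: fps_X_mult_nth)
  have M: "(a * (fps_X * fps_deriv b)) $ m = (\<Sum>j=0..m. a $ j * (real (m - j) * b $ (m - j)))"
    for a b :: "real fps" and m by (subst fps_mult_nth) (simp only: X)
  have eq: "real n * jet (\<lambda>t. K (f t, g t)) $ n =
      (\<Sum>j=0..n. jet (\<lambda>t. partial1 K (f t, g t)) $ j * (real (n - j) * jet f $ (n - j)) +
        jet (\<lambda>t. partial2 K (f t, g t)) $ j * (real (n - j) * jet g $ (n - j)))"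
    if "smooth_at K 0" for K n
  proof -
    have "real n * jet (\<lambda>t. K (f t, g t)) $ n = (fps_X * fps_deriv (jet (\<lambda>t. K (f t, g t)))) $ n" by (simp only: X)
    also have "fps_X * fps_deriv (jet (\<lambda>t. K (f t, g t))) =
        jet (\<lambda>t. partial1 K (f t, g t)) * (fps_X * fps_deriv (jet f)) +
        jet (\<lambda>t. partial2 K (f t, g t)) * (fps_X * fps_deriv (jet g))"
      unfolding deriv_jet_plane[OF that fg] by (simp add: algebra_simps)
    finally show ?thesis by (simp only: fps_add_nth M sum.distrib)
  qed
  have small: "jet (\<lambda>t. K (f t, g t)) $ j = 0" if "smooth_at K 0" "0 < j" "j < d" for K j
  proof -
    have "real j * jet (\<lambda>t. K (f t, g t)) $ j = 0"
      unfolding eq[OF that(1)] using that low by (intro sum.neutral) auto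
    then show ?thesis using that by simp
  qed
  note sp = smooth_at_partial[OF H]
  have "real n * jet (\<lambda>t. H (f t, g t)) $ n =
      (\<Sum>j\<in>{0}. jet (\<lambda>t. partial1 H (f t, g t)) $ j * (real (n - j) * jet f $ (n - j)) +
        jet (\<lambda>t. partial2 H (f t, g t)) $ j * (real (n - j) * jet g $ (n - j)))"
    unfolding eq[OF H]
  proof (rule sum.mono_neutral_right)
    show "\<forall>j\<in>{0..n} - {0}. jet (\<lambda>t. partial1 H (f t, g t)) $ j * (real (n - j) * jet f $ (n - j)) +
        jet (\<lambda>t. partial2 H (f t, g t)) $ j * (real (n - j) * jet g $ (n - j)) = 0"
    proof
      fix j assume j: "j \<in> {0..n} - {0}"
      show "jet (\<lambda>t. partial1 H (f t, g t)) $ j * (real (n - j) * jet f $ (n - j)) +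
        jet (\<lambda>t. partial2 H (f t, g t)) $ j * (real (n - j) * jet g $ (n - j)) = 0"
      proof (cases "j < d")
        case True
        then show ?thesis using j small[OF sp(1), of j] small[OF sp(2), of j] by auto
      next
        case False
        then have "n - j < d" using n j by auto
        then show ?thesis using low by simp
      qed
    qed
  qed auto
  then have "real n * jet (\<lambda>t. H (f t, g t)) $ n = real n * (partial1 H 0 * jet f $ n + partial2 H 0 * jet g $ n)"
    using fg0 by (simp add: algebra_simps zero_prod_def)
  then show ?thesis using n(1) by simp
qed

text \<open>Only the linear part of the diffeomorphism germ matters: quadratic terms have order at least \<open>2 d\<close>.\<close>

lemma A_equiv_linear_jets:
  fixes f1 f2 g1 g2 :: "real \<Rightarrow> real"
  assumes eq: "A_equiv (\<lambda>t. (f1 t, f2 t)) (\<lambda>t. (g1 t, g2 t))"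
    and f: "smooth_at f1 0" "smooth_at f2 0" and g: "smooth_germ g1" "smooth_germ g2"
    and low: "\<And>i. i < d \<Longrightarrow> jet g1 $ i = 0" "\<And>i. i < d \<Longrightarrow> jet g2 $ i = 0"
  obtains w :: "real fps" and a b a' b' where "w $ 0 \<noteq> 0"
    "\<And>n. 0 < n \<Longrightarrow> n < 2 * d \<Longrightarrow> (jet f1 oo (fps_X * w)) $ n = a * jet g1 $ n + b * jet g2 $ n"
    "\<And>n. 0 < n \<Longrightarrow> n < 2 * d \<Longrightarrow> (jet f2 oo (fps_X * w)) $ n = a' * jet g1 $ n + b' * jet g2 $ n"
proof -
  obtain h \<psi> where h: "diffeo_germ h" "diffeo_germ \<psi>"
    "\<forall>\<^sub>F t in nhds 0. (f1 (h t), f2 (h t)) = \<psi> (g1 t, g2 t)"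
    using eq unfolding A_equiv_def by blast
  have sh: "smooth_germ h" using h(1) by (rule diffeo_germ_smooth)
  have s\<psi>: "smooth_at \<psi> 0" using h(2) by (auto simp: smooth_germ_def dest: diffeo_germ_smooth)
  define w where "w = fps_shift 1 (jet h)"
  have hw: "jet h = fps_X * w"
    unfolding w_def by (rule fps_eq_X_mult) (use sh in \<open>simp add: smooth_germ_def\<close>)
  have w0: "w $ 0 \<noteq> 0" using diffeo_germ_deriv_nonzero[OF h(1)] by (simp add: w_def jet_nth_1[symmetric])
  have "\<forall>\<^sub>F t in nhds 0. f1 (h t) = fst (\<psi> (g1 t, g2 t))" using h(3) by eventually_elim (metis fst_conv)
  from jet_cong[OF this] have 1: "jet f1 oo (fps_X * w) = jet (\<lambda>t. fst (\<psi> (g1 t, g2 t)))"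
    using jet_compose[OF f(1) sh] hw by simp
  have "\<forall>\<^sub>F t in nhds 0. f2 (h t) = snd (\<psi> (g1 t, g2 t))" using h(3) by eventually_elim (metis snd_conv)
  from jet_cong[OF this] have 2: "jet f2 oo (fps_X * w) = jet (\<lambda>t. snd (\<psi> (g1 t, g2 t)))"
    using jet_compose[OF f(2) sh] hw by simp
  show ?thesis
    by (rule that[OF w0])
       (simp_all only: 1 2 jet_plane_low_order[OF g smooth_at_fst[OF s\<psi>] low]
          jet_plane_low_order[OF g smooth_at_snd[OF s\<psi>] low])
qed

section \<open>Degrees 5 to 9 under a change of parameter\<close>

lemma power_nth_1: "((w::real fps) ^ Suc k) $ 1 = real (Suc k) * (w $ 0) ^ k * w $ 1"
  by (induction k) (simp_all add: fps_mult_nth fps_nth_power_0 algebra_simps)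

lemma power_nth_2:
  "((w::real fps) ^ Suc (Suc k)) $ 2 =
    real (k + 2) * (w $ 0) ^ Suc k * w $ 2 + real ((k + 2) * (k + 1)) / 2 * (w $ 0) ^ k * (w $ 1)\<^sup>2"
proof (induction k)
  case 0
  show ?case by (simp add: fps_mult_nth numeral_2_eq_2 power2_eq_square algebra_simps)
next
  case (Suc k)
  have "(w ^ Suc (Suc (Suc k))) $ 2 = w $ 0 * (w ^ Suc (Suc k)) $ 2 + w $ 1 * (w ^ Suc (Suc k)) $ 1 +
      w $ 2 * (w $ 0) ^ Suc (Suc k)"
    by (subst power_Suc, subst fps_mult_nth) (simp add: numeral_2_eq_2 fps_nth_power_0)
  then show ?case unfolding Suc power_nth_1 by (simp add: power2_eq_square field_simps)
qed

lemma power_nth_3: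
  "((w::real fps) ^ Suc (Suc (Suc k))) $ 3 =
    real (k + 3) * (w $ 0) ^ Suc (Suc k) * w $ 3 + real ((k + 3) * (k + 2)) * (w $ 0) ^ Suc k * w $ 1 * w $ 2 +
    real ((k + 3) * (k + 2) * (k + 1)) / 6 * (w $ 0) ^ k * (w $ 1) ^ 3"
proof (induction k)
  case 0
  show ?case by (simp add: fps_mult_nth numeral_3_eq_3 numeral_2_eq_2 power2_eq_square power3_eq_cube algebra_simps)
next
  case (Suc k)
  have "(w ^ Suc (Suc (Suc (Suc k)))) $ 3 = w $ 0 * (w ^ Suc (Suc (Suc k))) $ 3 + w $ 1 * (w ^ Suc (Suc (Suc k))) $ 2 +
      w $ 2 * (w ^ Suc (Suc (Suc k))) $ 1 + w $ 3 * (w $ 0) ^ Suc (Suc (Suc k))"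
    by (subst power_Suc, subst fps_mult_nth) (simp add: numeral_3_eq_3 numeral_2_eq_2 fps_nth_power_0)
  then show ?case unfolding Suc power_nth_2 power_nth_1 by (simp add: power2_eq_square power3_eq_cube field_simps)
qed

lemma compose_X_mult_nth_from:
  fixes a w :: "real fps"
  assumes "\<And>i. i < d \<Longrightarrow> a $ i = 0"
  shows "(a oo (fps_X * w)) $ (d + k) = (\<Sum>i=0..k. a $ (d + i) * (w ^ (d + i)) $ (k - i))"
proof -
  have "(a oo (fps_X * w)) $ (d + k) = (\<Sum>i\<in>{0 + d..k + d}. a $ i * (w ^ i) $ (d + k - i))"
    unfolding compose_X_mult_nth by (rule sum.mono_neutral_right) (use assms in \<open>auto simp: add.commute\<close>)
  then show ?thesis unfolding sum.shift_bounds_cl_nat_ivl by (simp add: add.commute)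
qed

text \<open>The numerical factors are multinomial coefficients of the powers of w. In degree 9 the
  condition a_5 = 0 avoids the coefficient of w of degree 4.\<close>

lemma compose_nth_from_5:
  fixes a w :: "real fps"
  assumes low: "\<And>i. i < 5 \<Longrightarrow> a $ i = 0"
  defines "h \<equiv> w $ 0"
  shows "(a oo (fps_X * w)) $ 5 = a $ 5 * h ^ 5"
    and "(a oo (fps_X * w)) $ 6 = a $ 5 * (5 * h ^ 4 * w $ 1) + a $ 6 * h ^ 6"
    and "(a oo (fps_X * w)) $ 7 = a $ 5 * (5 * h ^ 4 * w $ 2 + 10 * h ^ 3 * (w $ 1)\<^sup>2) +
      a $ 6 * (6 * h ^ 5 * w $ 1) + a $ 7 * h ^ 7"
    and "(a oo (fps_X * w)) $ 8 =
      a $ 5 * (5 * h ^ 4 * w $ 3 + 20 * h ^ 3 * w $ 1 * w $ 2 + 10 * h\<^sup>2 * (w $ 1) ^ 3) +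
      a $ 6 * (6 * h ^ 5 * w $ 2 + 15 * h ^ 4 * (w $ 1)\<^sup>2) + a $ 7 * (7 * h ^ 6 * w $ 1) + a $ 8 * h ^ 8"
    and "a $ 5 = 0 \<Longrightarrow> (a oo (fps_X * w)) $ 9 =
      a $ 6 * (6 * h ^ 5 * w $ 3 + 30 * h ^ 4 * w $ 1 * w $ 2 + 20 * h ^ 3 * (w $ 1) ^ 3) +
      a $ 7 * (7 * h ^ 6 * w $ 2 + 21 * h ^ 5 * (w $ 1)\<^sup>2) + a $ 8 * (8 * h ^ 7 * w $ 1) + a $ 9 * h ^ 9"
proof -
  have n: "(a oo (fps_X * w)) $ (5 + k) = (\<Sum>i=0..k. a $ (5 + i) * (w ^ (5 + i)) $ (k - i))" for k
    by (rule compose_X_mult_nth_from[OF low])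
  have w0: "(w ^ k) $ 0 = h ^ k" for k by (simp add: fps_nth_power_0 h_def)
  have w1: "(w ^ 5) $ 1 = 5 * h ^ 4 * w $ 1" "(w ^ 6) $ 1 = 6 * h ^ 5 * w $ 1"
    "(w ^ 7) $ 1 = 7 * h ^ 6 * w $ 1" "(w ^ 8) $ 1 = 8 * h ^ 7 * w $ 1"
    using power_nth_1[of w 4] power_nth_1[of w 5] power_nth_1[of w 6] power_nth_1[of w 7]
    by (simp_all add: h_def)
  have w2: "(w ^ 5) $ 2 = 5 * h ^ 4 * w $ 2 + 10 * h ^ 3 * (w $ 1)\<^sup>2"
    "(w ^ 6) $ 2 = 6 * h ^ 5 * w $ 2 + 15 * h ^ 4 * (w $ 1)\<^sup>2"
    "(w ^ 7) $ 2 = 7 * h ^ 6 * w $ 2 + 21 * h ^ 5 * (w $ 1)\<^sup>2"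
    using power_nth_2[of w 3] power_nth_2[of w 4] power_nth_2[of w 5]
    by (simp_all add: h_def)
  have w3: "(w ^ 5) $ 3 = 5 * h ^ 4 * w $ 3 + 20 * h ^ 3 * w $ 1 * w $ 2 + 10 * h\<^sup>2 * (w $ 1) ^ 3"
    "(w ^ 6) $ 3 = 6 * h ^ 5 * w $ 3 + 30 * h ^ 4 * w $ 1 * w $ 2 + 20 * h ^ 3 * (w $ 1) ^ 3"
    using power_nth_3[of w 2] power_nth_3[of w 3]
    by (simp_all add: h_def)
  have s: "(\<Sum>i=0..1. f i) = f 0 + f 1" "(\<Sum>i=0..2. f i) = f 0 + f 1 + f 2"
    "(\<Sum>i=0..3. f i) = f 0 + f 1 + f 2 + f 3" "(\<Sum>i=0..4. f i) = f 0 + f 1 + f 2 + f 3 + f 4"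
    for f :: "nat \<Rightarrow> real"
    by (simp_all add: numeral_eq_Suc)
  have r: "5 + 0 = (5::nat)" "5 + 1 = (6::nat)" "5 + 2 = (7::nat)" "5 + 3 = (8::nat)" "5 + 4 = (9::nat)"
    "1 - 0 = (1::nat)" "1 - 1 = (0::nat)" "2 - 0 = (2::nat)" "2 - 1 = (1::nat)" "2 - 2 = (0::nat)"
    "3 - 0 = (3::nat)" "3 - 1 = (2::nat)" "3 - 2 = (1::nat)" "3 - 3 = (0::nat)"
    "4 - 0 = (4::nat)" "4 - 1 = (3::nat)" "4 - 2 = (2::nat)" "4 - 3 = (1::nat)" "4 - 4 = (0::nat)"
    by simp_all
  show "(a oo (fps_X * w)) $ 5 = a $ 5 * h ^ 5" using n[of 0] by (simp add: w0)
  show "(a oo (fps_X * w)) $ 6 = a $ 5 * (5 * h ^ 4 * w $ 1) + a $ 6 * h ^ 6"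
    using n[of 1] unfolding s by (simp only: r w0 w1)
  show "(a oo (fps_X * w)) $ 7 = a $ 5 * (5 * h ^ 4 * w $ 2 + 10 * h ^ 3 * (w $ 1)\<^sup>2) +
      a $ 6 * (6 * h ^ 5 * w $ 1) + a $ 7 * h ^ 7"
    using n[of 2] unfolding s by (simp only: r w0 w1 w2)
  show "(a oo (fps_X * w)) $ 8 =
      a $ 5 * (5 * h ^ 4 * w $ 3 + 20 * h ^ 3 * w $ 1 * w $ 2 + 10 * h\<^sup>2 * (w $ 1) ^ 3) +
      a $ 6 * (6 * h ^ 5 * w $ 2 + 15 * h ^ 4 * (w $ 1)\<^sup>2) + a $ 7 * (7 * h ^ 6 * w $ 1) + a $ 8 * h ^ 8"
    using n[of 3] unfolding s by (simp only: r w0 w1 w2 w3)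
  show "(a oo (fps_X * w)) $ 9 =
      a $ 6 * (6 * h ^ 5 * w $ 3 + 30 * h ^ 4 * w $ 1 * w $ 2 + 20 * h ^ 3 * (w $ 1) ^ 3) +
      a $ 7 * (7 * h ^ 6 * w $ 2 + 21 * h ^ 5 * (w $ 1)\<^sup>2) + a $ 8 * (8 * h ^ 7 * w $ 1) + a $ 9 * h ^ 9"
    if "a $ 5 = 0"
    using n[of 4] unfolding s by (simp only: r w0 w1 w2 w3 that mult_zero_left add_0_left)
qed

text \<open>The quantities \<open>p8 - 13/12 p\<^sup>2\<close> and \<open>p9 - 7/3 p (p8 - 13/12 p\<^sup>2) - 133/108 p\<^sup>3\<close> are the coefficients of
  degree 8 and 9 after normalising \<open>(t\<^sup>6 + p t\<^sup>7 + p8 t\<^sup>8 + p9 t\<^sup>9, t\<^sup>5)\<close> to have no term of degree 7.\<close>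

lemma weighted_invariants:
  fixes h c1 c2 c3 p p8 p9 p8' p9' m :: real
  assumes 1: "6 * c1 + p * h = p"
    and 2: "6 * c2 + 15 * c1\<^sup>2 + 7 * p * h * c1 + p8 * h\<^sup>2 = p8'"
    and 3: "6 * c3 + 30 * c1 * c2 + 20 * c1 ^ 3 + p * h * (7 * c2 + 21 * c1\<^sup>2) + 8 * p8 * h\<^sup>2 * c1 + p9 * h ^ 3 = p9'"
    and 4: "5 * c1 = m" and 5: "5 * c2 + 10 * c1\<^sup>2 = m * p" and 6: "5 * c3 + 20 * c1 * c2 + 10 * c1 ^ 3 = m * p8'"
  shows "p8' - 13/12 * p\<^sup>2 = h\<^sup>2 * (p8 - 13/12 * p\<^sup>2)"
    and "p9' - 7/3 * p * (p8' - 13/12 * p\<^sup>2) - 133/108 * p ^ 3 =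
      h ^ 3 * (p9 - 7/3 * p * (p8 - 13/12 * p\<^sup>2) - 133/108 * p ^ 3)"
proof -
  \<comment> \<open>With c_i = w_i/h the first three hypotheses are degrees 7 to 9 of the first
    component, the last three degrees 6 to 8 of the second. The first component yields c1, the
    second c2 and c3 after inserting m = 5 c1, and polynomial identities remain.\<close>
  have c1: "c1 = (p - p * h) / 6" using 1 by simp
  have "5 * c2 = 5 * (c1 * p - 2 * c1\<^sup>2)" using 5 unfolding 4[symmetric] by (simp add: algebra_simps)
  then have c2: "c2 = c1 * p - 2 * c1\<^sup>2" by simp
  have "5 * c3 = 5 * (c1 * p8' - 4 * c1 * c2 - 2 * c1 ^ 3)"
    using 6 unfolding 4[symmetric] by (simp add: algebra_simps)
  then have c3: "c3 = c1 * p8' - 4 * c1 * c2 - 2 * c1 ^ 3" by simp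
  have p8': "p8' = 6 * c2 + 15 * c1\<^sup>2 + 7 * p * h * c1 + p8 * h\<^sup>2" using 2 by simp
  show D: "p8' - 13/12 * p\<^sup>2 = h\<^sup>2 * (p8 - 13/12 * p\<^sup>2)"
    unfolding p8' c2 unfolding c1 by (simp add: field_simps power2_eq_square)
  have p9': "p9' = 6 * c3 + 30 * c1 * c2 + 20 * c1 ^ 3 + p * h * (7 * c2 + 21 * c1\<^sup>2) + 8 * p8 * h\<^sup>2 * c1 + p9 * h ^ 3"
    using 3 by simp
  have e: "p8' = h\<^sup>2 * (p8 - 13/12 * p\<^sup>2) + 13/12 * p\<^sup>2" using D by simp
  show "p9' - 7/3 * p * (p8' - 13/12 * p\<^sup>2) - 133/108 * p ^ 3 =
      h ^ 3 * (p9 - 7/3 * p * (p8 - 13/12 * p\<^sup>2) - 133/108 * p ^ 3)"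
    unfolding p9' c3 c2 unfolding e unfolding c1
    by (simp add: field_simps power2_eq_square power3_eq_cube)
qed

section \<open>Families of pairwise inequivalent germs of multiplicity 5\<close>

text \<open>Ten directions, the degrees 5 to 9 in either component: the range of exponents on which
  the separating invariants depend.\<close>

definition monomial_deformation :: "nat \<Rightarrow> real \<Rightarrow> real \<times> real" where
  "monomial_deformation i t = (if i < 5 then (t ^ (i + 5), 0) else (0, t ^ i))"

lemma monomial_deformation_jets:
  fixes f :: "real \<Rightarrow> real \<times> real"
  assumes f: "smooth_at (\<lambda>t. fst (f t)) 0" "smooth_at (\<lambda>t. snd (f t)) 0"
  defines "F \<equiv> \<lambda>v t. f t + (\<Sum>i<10. v i *\<^sub>R monomial_deformation i t)"
  shows "smooth_at (\<lambda>t. fst (F v t)) 0" "smooth_at (\<lambda>t. snd (F v t)) 0"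
    "jet (\<lambda>t. fst (F v t)) $ n = jet (\<lambda>t. fst (f t)) $ n + (if 5 \<le> n \<and> n < 10 then v (n - 5) else 0)"
    "jet (\<lambda>t. snd (F v t)) $ n = jet (\<lambda>t. snd (f t)) $ n + (if 5 \<le> n \<and> n < 10 then v n else 0)"
proof -
  have js: "jet (\<lambda>t. \<Sum>i\<in>I. h i t) = (\<Sum>i\<in>I. jet (h i))" if "finite I" "\<And>i. smooth_at (h i) 0"
    for h :: "nat \<Rightarrow> real \<Rightarrow> real" and I
    using that(1) by (induction I) (simp_all add: jet_const jet_add that(2) smooth_at_sum)
  define P where "P i t = v i * (if i < 5 then t ^ (i + 5) else 0)" for i and t :: real
  define Q where "Q i t = v i * (if i < 5 then 0 else t ^ i)" for i and t :: real
  have sP: "smooth_at (P i) 0" for i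
    unfolding P_def by (cases "i < 5") (simp_all add: smooth_at_mult smooth_at_power)
  have sQ: "smooth_at (Q i) 0" for i
    unfolding Q_def by (cases "i < 5") (simp_all add: smooth_at_mult smooth_at_power)
  have jP: "jet (P i) $ n = (if i < 5 \<and> n = i + 5 then v i else 0)" for i
    unfolding P_def by (cases "i < 5") (simp_all add: jet_const jet_cmult jet_power jet_ident smooth_at_power fps_X_power_nth)
  have jQ: "jet (Q i) $ n = (if \<not> i < 5 \<and> n = i then v i else 0)" for i
    unfolding Q_def by (cases "i < 5") (simp_all add: jet_const jet_cmult jet_power jet_ident smooth_at_power fps_X_power_nth)
  have F1: "(\<lambda>t. fst (F v t)) = (\<lambda>t. fst (f t) + (\<Sum>i<10. P i t))"
    by (simp add: F_def fst_sum monomial_deformation_def P_def fun_eq_iff if_distrib cong: if_cong)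
  have F2: "(\<lambda>t. snd (F v t)) = (\<lambda>t. snd (f t) + (\<Sum>i<10. Q i t))"
    by (simp add: F_def snd_sum monomial_deformation_def Q_def fun_eq_iff if_distrib cong: if_cong)
  have sS: "smooth_at (\<lambda>t. \<Sum>i<10. P i t) 0" "smooth_at (\<lambda>t. \<Sum>i<10. Q i t) 0"
    by (intro smooth_at_sum sP sQ)+
  show "smooth_at (\<lambda>t. fst (F v t)) 0" "smooth_at (\<lambda>t. snd (F v t)) 0"
    unfolding F1 F2 by (intro smooth_at_add f sS)+
  have "(\<Sum>i<10. jet (P i) $ n) = (\<Sum>i<10. if i = n - 5 then (if 5 \<le> n \<and> n < 10 then v (n - 5) else 0) else 0)"
    by (rule sum.cong) (auto simp: jP)
  also have "\<dots> = (if 5 \<le> n \<and> n < 10 then v (n - 5) else 0)" by (auto simp: sum.delta)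
  finally show "jet (\<lambda>t. fst (F v t)) $ n = jet (\<lambda>t. fst (f t)) $ n + (if 5 \<le> n \<and> n < 10 then v (n - 5) else 0)"
    unfolding F1 by (simp add: jet_add[OF f(1) sS(1)] js[OF _ sP] fps_sum_nth)
  have "(\<Sum>i<10. jet (Q i) $ n) = (\<Sum>i<10. if i = n then (if 5 \<le> n \<and> n < 10 then v n else 0) else 0)"
    by (rule sum.cong) (auto simp: jQ)
  also have "\<dots> = (if 5 \<le> n \<and> n < 10 then v n else 0)" by (auto simp: sum.delta)
  finally show "jet (\<lambda>t. snd (F v t)) $ n = jet (\<lambda>t. snd (f t)) $ n + (if 5 \<le> n \<and> n < 10 then v n else 0)"
    unfolding F2 by (simp add: jet_add[OF f(2) sS(2)] js[OF _ sQ] fps_sum_nth)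
qed

lemma smooth_at_monomial_deformation: "smooth_at (monomial_deformation i) t"
  unfolding monomial_deformation_def
  by (cases "i < 5") (simp_all add: smooth_at_Pair smooth_at_power)

text \<open>In either case two expressions in the coefficients scale by h^2 and h^3 under an
  equivalence whose source change has derivative h, so the cube of the first over the square of the
  second is invariant. The path v is adapted to the given coefficients so that this quotient is
  defined and injective in s.\<close>

lemma not_A_simple_multiplicity_6:
  fixes f :: "real \<Rightarrow> real \<times> real"
  assumes f: "smooth_germ (\<lambda>t. fst (f t))" "smooth_germ (\<lambda>t. snd (f t))"
    and low: "\<And>i. i < 6 \<Longrightarrow> jet (\<lambda>t. fst (f t)) $ i = 0" "\<And>i. i < 9 \<Longrightarrow> jet (\<lambda>t. snd (f t)) $ i = 0"
    and top: "jet (\<lambda>t. fst (f t)) $ 6 = 0 \<Longrightarrow> jet (\<lambda>t. snd (f t)) $ 9 = 0"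
  shows "\<not> A_simple f"
proof -
  define x where "x = jet (\<lambda>t. fst (f t))"
  define y where "y = jet (\<lambda>t. snd (f t))"
  have sf: "smooth_at (\<lambda>t. fst (f t)) 0" "smooth_at (\<lambda>t. snd (f t)) 0" using f by (auto simp: smooth_germ_def)
  have gf: "smooth_germ f"
    using smooth_at_Pair[OF sf] f by (simp add: smooth_germ_def zero_prod_def prod_eq_iff)
  define F where "F v t = f t + (\<Sum>i<10. v i *\<^sub>R monomial_deformation i t)" for v t
  note FD = monomial_deformation_jets[OF sf, folded F_def x_def y_def]
  define X where "X v = jet (\<lambda>t. fst (F v t))" for v
  define Y where "Y v = jet (\<lambda>t. snd (F v t))" for v
  have X: "X v $ n = x $ n + (if 5 \<le> n \<and> n < 10 then v (n - 5) else 0)" for v n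
    unfolding X_def by (rule FD(3))
  have Y: "Y v $ n = y $ n + (if 5 \<le> n \<and> n < 10 then v n else 0)" for v n
    unfolding Y_def by (rule FD(4))
  have xl: "x $ i = 0" if "i < 6" for i using low(1)[OF that] by (simp add: x_def)
  have yl: "y $ i = 0" if "i < 9" for i using low(2)[OF that] by (simp add: y_def)
  have XY5: "X v $ i = 0" "Y v $ i = 0" if "i < 5" for v i using that xl yl by (auto simp: X Y)
  have XY: "X v $ 5 = v 0" "X v $ 6 = x $ 6 + v 1" "X v $ 7 = x $ 7 + v 2" "X v $ 8 = x $ 8 + v 3" "X v $ 9 = x $ 9 + v 4"
    "Y v $ 5 = v 5" "Y v $ 6 = v 6" "Y v $ 7 = v 7" "Y v $ 8 = v 8" "Y v $ 9 = y $ 9 + v 9" for v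
    using xl yl by (simp_all add: X Y)
  have gF: "smooth_germ (\<lambda>t. fst (F v t))" "smooth_germ (\<lambda>t. snd (F v t))" for v
    using FD(1,2)[of v] XY5[of 0 v] by (auto simp: smooth_germ_def X_def Y_def)
  have lin: "\<exists>w a b a' b'. w $ 0 \<noteq> 0 \<and>
      (\<forall>n. 0 < n \<and> n < 10 \<longrightarrow> (X u oo (fps_X * w)) $ n = a * X v $ n + b * Y v $ n) \<and>
      (\<forall>n. 0 < n \<and> n < 10 \<longrightarrow> (Y u oo (fps_X * w)) $ n = a' * X v $ n + b' * Y v $ n)"
    if "A_equiv (F u) (F v)" for u v
  proof -
    have eq: "A_equiv (\<lambda>t. (fst (F u t), snd (F u t))) (\<lambda>t. (fst (F v t), snd (F v t)))" using that by simp
    show ?thesis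
      by (rule A_equiv_linear_jets[OF eq FD(1,2) gF, of 5])
         (use XY5 in \<open>simp_all add: X_def[symmetric] Y_def[symmetric], blast\<close>)
  qed
  note co = compose_nth_from_5[OF XY5(1)] compose_nth_from_5[OF XY5(2)]
  show ?thesis
  proof (cases "x $ 6 = 0")
    case True
    have y9: "y $ 9 = 0" using top True by (simp add: x_def y_def)
    \<comment> \<open>\<alpha> and \<beta> are switched on where x_7 or x_8 vanishes, to keep A and
      B below nonzero. The invariant A^3/(s B^2) is then proportional to s^3, s^5, s^(-3) or
      s^(-1).\<close>
    define \<alpha> where "\<alpha> s = (if x $ 7 = 0 then s\<^sup>2 else 0)" for s :: real
    define \<beta> where "\<beta> s = (if x $ 8 = 0 then s else 0)" for s :: real
    \<comment> \<open>The curve becomes (s t^5 + x_7 t^7 + x_8 t^8 + ..., s t^6 + \<alpha> t^8 +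
      \<beta> t^9 + ...).\<close>
    define v where "v s i = (if i = 0 then s else if i = 6 then s else if i = 8 then \<alpha> s else if i = 9 then \<beta> s else 0)"
      for s :: real and i :: nat
    show ?thesis
    proof (rule not_A_simpleI[OF gf, of monomial_deformation v 10])
      have "continuous_on UNIV \<alpha>" unfolding \<alpha>_def by (cases "x $ 7 = 0") (auto intro!: continuous_intros)
      moreover have "continuous_on UNIV \<beta>" unfolding \<beta>_def by (cases "x $ 8 = 0") (auto intro!: continuous_intros)
      ultimately show "continuous_on UNIV (\<lambda>s. v s i)" for i
        unfolding v_def by (cases "i = 0"; cases "i = 6"; cases "i = 8"; cases "i = 9") auto
      show "v 0 i = 0" for i by (simp add: v_def \<alpha>_def \<beta>_def)
      show "s = s'" if s: "0 < s" "s < 1" "0 < s'" "s' < 1"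
        and eq: "A_equiv (\<lambda>t. f t + (\<Sum>i<10. v s i *\<^sub>R monomial_deformation i t))
          (\<lambda>t. f t + (\<Sum>i<10. v s' i *\<^sub>R monomial_deformation i t))" for s s'
      proof -
        have "A_equiv (F (v s)) (F (v s'))" using eq by (simp add: F_def[abs_def])
        then obtain w a b a' b' where w: "w $ 0 \<noteq> 0"
          and E1: "\<And>n. 0 < n \<Longrightarrow> n < 10 \<Longrightarrow> (X (v s) oo (fps_X * w)) $ n = a * X (v s') $ n + b * Y (v s') $ n"
          and E2: "\<And>n. 0 < n \<Longrightarrow> n < 10 \<Longrightarrow> (Y (v s) oo (fps_X * w)) $ n = a' * X (v s') $ n + b' * Y (v s') $ n"
          using lin by meson
        define h where "h = w $ 0"
        have h: "h \<noteq> 0" using w by (simp add: h_def)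
        have XX: "X (v r) $ 5 = r" "X (v r) $ 6 = 0" "X (v r) $ 7 = x $ 7" "X (v r) $ 8 = x $ 8"
          "Y (v r) $ 5 = 0" "Y (v r) $ 6 = r" "Y (v r) $ 7 = 0" "Y (v r) $ 8 = \<alpha> r" "Y (v r) $ 9 = \<beta> r" for r
          unfolding XY using True y9 by (simp_all add: v_def)
        \<comment> \<open>Degrees 5 and 7 of the second component and degree 6 of the first force a'
          = 0, w_1 = 0 and b = 0, so the linear target change is diagonal.\<close>
        have a': "a' = 0" using E2[of 5] co(6)[of "v s" w] s by (simp add: XX)
        have b': "s * h ^ 6 = b' * s'" using E2[of 6] co(7)[of "v s" w] by (simp add: XX a' h_def)
        have w1: "w $ 1 = 0" using E2[of 7] co(8)[of "v s" w] s w by (simp add: XX a')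
        have y8: "s * (6 * h ^ 5 * w $ 2) + \<alpha> s * h ^ 8 = b' * \<alpha> s'"
          using E2[of 8] co(9)[of "v s" w] w1 by (simp add: XX a' h_def)
        have y9': "s * (6 * h ^ 5 * w $ 3) + \<beta> s * h ^ 9 = b' * \<beta> s'"
          using E2[of 9] co(10)[of "v s" w] w1 by (simp add: XX a' h_def)
        have ax: "s * h ^ 5 = a * s'" using E1[of 5] co(1)[of "v s" w] by (simp add: XX h_def)
        have b: "b = 0" using E1[of 6] co(2)[of "v s" w] w1 s by (simp add: XX)
        have x7: "s * (5 * h ^ 4 * w $ 2) + x $ 7 * h ^ 7 = a * x $ 7"
          using E1[of 7] co(3)[of "v s" w] w1 by (simp add: XX b h_def)
        have x8: "s * (5 * h ^ 4 * w $ 3) + x $ 8 * h ^ 8 = a * x $ 8"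
          using E1[of 8] co(4)[of "v s" w] w1 by (simp add: XX b h_def)
        \<comment> \<open>The coefficient w_2 enters degree 7 of the first and degree 8 of the
          second component with weights 5s and 6s; 5 \<alpha> - 6 x_7 is the combination that
          eliminates it. B eliminates w_3 in the same way.\<close>
        define A where "A r = 5 * \<alpha> r - 6 * x $ 7" for r
        define B where "B r = 5 * \<beta> r - 6 * x $ 8" for r
        have "h ^ 6 * (s' * A s * h\<^sup>2 - s * A s') = 0"
        proof -
          have e1: "s' * (s * (30 * h ^ 5 * w $ 2)) = 6 * h * (s' * (a * x $ 7) - s' * x $ 7 * h ^ 7)"
            unfolding x7[symmetric] by (simp add: algebra_simps eval_nat_numeral)
          have e2: "s' * (a * x $ 7) = s * h ^ 5 * x $ 7" using ax by (simp add: mult_ac)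
          have e3: "s' * (s * (30 * h ^ 5 * w $ 2)) + 5 * s' * \<alpha> s * h ^ 8 = 5 * (s' * (b' * \<alpha> s'))"
            unfolding y8[symmetric] by (simp add: algebra_simps)
          have e4: "s' * (b' * \<alpha> s') = s * h ^ 6 * \<alpha> s'" using b' by (simp add: mult_ac)
          have "6 * h * (s * h ^ 5 * x $ 7 - s' * x $ 7 * h ^ 7) + 5 * s' * \<alpha> s * h ^ 8 = 5 * (s * h ^ 6 * \<alpha> s')"
            using e3 unfolding e1 e2 e4 .
          then show ?thesis unfolding A_def by (simp add: algebra_simps eval_nat_numeral)
        qed
        then have A: "s' * A s * h\<^sup>2 = s * A s'" using h by simp
        have "h ^ 6 * (s' * B s * h ^ 3 - s * B s') = 0"
        proof -
          have e1: "s' * (s * (30 * h ^ 5 * w $ 3)) = 6 * h * (s' * (a * x $ 8) - s' * x $ 8 * h ^ 8)"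
            unfolding x8[symmetric] by (simp add: algebra_simps eval_nat_numeral)
          have e2: "s' * (a * x $ 8) = s * h ^ 5 * x $ 8" using ax by (simp add: mult_ac)
          have e3: "s' * (s * (30 * h ^ 5 * w $ 3)) + 5 * s' * \<beta> s * h ^ 9 = 5 * (s' * (b' * \<beta> s'))"
            unfolding y9'[symmetric] by (simp add: algebra_simps)
          have e4: "s' * (b' * \<beta> s') = s * h ^ 6 * \<beta> s'" using b' by (simp add: mult_ac)
          have "6 * h * (s * h ^ 5 * x $ 8 - s' * x $ 8 * h ^ 8) + 5 * s' * \<beta> s * h ^ 9 = 5 * (s * h ^ 6 * \<beta> s')"
            using e3 unfolding e1 e2 e4 .
          then show ?thesis unfolding B_def by (simp add: algebra_simps eval_nat_numeral)
        qed
        then have B: "s' * B s * h ^ 3 = s * B s'" using h by simp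
        \<comment> \<open>The cube of one relation against the square of the other removes
          h.\<close>
        have "(s' * A s * h\<^sup>2) ^ 3 * (s * B s')\<^sup>2 = (s * A s') ^ 3 * (s' * B s * h ^ 3)\<^sup>2"
          unfolding A B by simp
        then have "h ^ 6 * s\<^sup>2 * s'\<^sup>2 * (s' * A s ^ 3 * (B s')\<^sup>2 - s * A s' ^ 3 * (B s)\<^sup>2) = 0"
          by (simp add: power_mult_distrib algebra_simps eval_nat_numeral)
        then have key: "s' * A s ^ 3 * (B s')\<^sup>2 = s * A s' ^ 3 * (B s)\<^sup>2" using h s by simp
        consider (1) "x $ 7 = 0" "x $ 8 = 0" | (2) "x $ 7 = 0" "x $ 8 \<noteq> 0"
          | (3) "x $ 7 \<noteq> 0" "x $ 8 = 0" | (4) "x $ 7 \<noteq> 0" "x $ 8 \<noteq> 0" by blast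
        then show "s = s'"
        proof cases
          case 1
          have AB: "A r = 5 * r\<^sup>2" "B r = 5 * r" for r by (simp_all add: A_def B_def \<alpha>_def \<beta>_def 1)
          have "3125 * (s ^ 3 * s' ^ 3 * (s ^ 3 - s' ^ 3)) = s' * A s ^ 3 * (B s')\<^sup>2 - s * A s' ^ 3 * (B s)\<^sup>2"
            unfolding AB by algebra
          then have "s ^ 3 = s' ^ 3" using s unfolding key by simp
          then show ?thesis using s power_eq_iff_eq_base[of 3 s s'] by simp
        next
          case 2
          have AB: "A r = 5 * r\<^sup>2" "B r = - 6 * x $ 8" for r by (simp_all add: A_def B_def \<alpha>_def \<beta>_def 2)
          have "4500 * (x $ 8)\<^sup>2 * (s * s' * (s ^ 5 - s' ^ 5)) = s' * A s ^ 3 * (B s')\<^sup>2 - s * A s' ^ 3 * (B s)\<^sup>2"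
            unfolding AB by algebra
          then have "s ^ 5 = s' ^ 5" using s 2 unfolding key by simp
          then show ?thesis using s power_eq_iff_eq_base[of 5 s s'] by simp
        next
          case 3
          have AB: "A r = - 6 * x $ 7" "B r = 5 * r" for r by (simp_all add: A_def B_def \<alpha>_def \<beta>_def 3)
          have "5400 * (x $ 7) ^ 3 * (s ^ 3 - s' ^ 3) = s' * A s ^ 3 * (B s')\<^sup>2 - s * A s' ^ 3 * (B s)\<^sup>2"
            unfolding AB by algebra
          then have "s ^ 3 = s' ^ 3" using 3 unfolding key by simp
          then show ?thesis using s power_eq_iff_eq_base[of 3 s s'] by simp
        next
          case 4
          then have AB: "A r = - 6 * x $ 7" "B r = - 6 * x $ 8" for r by (simp_all add: A_def B_def \<alpha>_def \<beta>_def)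
          then show ?thesis using key 4 unfolding AB by simp
        qed
      qed
    qed (simp_all add: smooth_at_monomial_deformation monomial_deformation_def zero_prod_def power_0_left)
  next
    case False
    \<comment> \<open>The second component will start with s t^5, the first with x_6 t^6; D0 and E0
      are the two normalised coefficients of \<open>weighted_invariants\<close> at s = 0.\<close>
    define p where "p = x $ 7 / x $ 6"
    define D0 where "D0 = x $ 8 / x $ 6 - 13/12 * p\<^sup>2"
    define E0 where "E0 = x $ 9 / x $ 6 - 7/3 * p * D0 - 133/108 * p ^ 3"
    \<comment> \<open>D and E start at D0 and E0. In the four cases of vanishing or nonvanishing D0
      and E0 the invariant D^3/E^2 is s, s^3/E0^2, D0^3/s^2 or D0^3 (1 + s)^3/E0^2, each injective
      for 0 < s < 1.\<close>
    define D where "D s = (if D0 = 0 then s else if E0 = 0 then D0 else D0 * (1 + s))" for s :: real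
    define E where "E s = (if E0 = 0 then s else E0)" for s :: real
    \<comment> \<open>The shifts in degrees 8 and 9 give the member s the normalised coefficients
      D(s) and E(s); index 5 supplies s t^5.\<close>
    define v where "v s i = (if i = 3 then x $ 6 * (D s - D0) else if i = 4 then x $ 6 * (E s - E0 + 7/3 * p * (D s - D0))
      else if i = 5 then s else 0)" for s :: real and i :: nat
    show ?thesis
    proof (rule not_A_simpleI[OF gf, of monomial_deformation v 10])
      have "continuous_on UNIV D"
        unfolding D_def by (cases "D0 = 0"; cases "E0 = 0") (auto intro!: continuous_intros)
      moreover have "continuous_on UNIV E"
        unfolding E_def by (cases "E0 = 0") (auto intro!: continuous_intros)
      ultimately show "continuous_on UNIV (\<lambda>s. v s i)" for i
        unfolding v_def by (cases "i = 3"; cases "i = 4"; cases "i = 5") (auto intro!: continuous_intros)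
      show "v 0 i = 0" for i by (simp add: v_def D_def E_def)
      show "s = s'" if s: "0 < s" "s < 1" "0 < s'" "s' < 1"
        and eq: "A_equiv (\<lambda>t. f t + (\<Sum>i<10. v s i *\<^sub>R monomial_deformation i t))
          (\<lambda>t. f t + (\<Sum>i<10. v s' i *\<^sub>R monomial_deformation i t))" for s s'
      proof -
        have "A_equiv (F (v s)) (F (v s'))" using eq by (simp add: F_def[abs_def])
        then obtain w a b a' b' where w: "w $ 0 \<noteq> 0"
          and E1: "\<And>n. 0 < n \<Longrightarrow> n < 10 \<Longrightarrow> (X (v s) oo (fps_X * w)) $ n = a * X (v s') $ n + b * Y (v s') $ n"
          and E2: "\<And>n. 0 < n \<Longrightarrow> n < 10 \<Longrightarrow> (Y (v s) oo (fps_X * w)) $ n = a' * X (v s') $ n + b' * Y (v s') $ n"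
          using lin by meson
        define h where "h = w $ 0"
        have h: "h \<noteq> 0" using w by (simp add: h_def)
        define k where "k = x $ 6"
        have k: "k \<noteq> 0" using False by (simp add: k_def)
        define P8 where "P8 r = D r + 13/12 * p\<^sup>2" for r
        define P9 where "P9 r = E r + 7/3 * p * D r + 133/108 * p ^ 3" for r
        have XX: "X (v r) $ 5 = 0" "X (v r) $ 6 = k" "X (v r) $ 7 = k * p" "X (v r) $ 8 = k * P8 r"
          "X (v r) $ 9 = k * P9 r"
          "Y (v r) $ 5 = r" "Y (v r) $ 6 = 0" "Y (v r) $ 7 = 0" "Y (v r) $ 8 = 0" for r
          unfolding XY using False by (simp_all add: v_def k_def P8_def P9_def p_def[symmetric] D0_def E0_def field_simps)
             (simp_all add: p_def)
        define c1 where "c1 = w $ 1 / h"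
        define c2 where "c2 = w $ 2 / h"
        define c3 where "c3 = w $ 3 / h"
        have wc: "w $ 0 = h" "w $ 1 = h * c1" "w $ 2 = h * c2" "w $ 3 = h * c3"
          using h by (simp_all add: h_def c1_def c2_def c3_def)
        have b: "b = 0" using E1[of 5] co(1)[of "v s" w] s by (simp add: XX)
        have "k * h ^ 6 = a * k" using E1[of 6] co(2)[of "v s" w] unfolding wc by (simp add: XX b)
        then have a: "a = h ^ 6" using k by simp
        define m where "m = a' * k / (s * h ^ 5)"
        have m: "a' * k = m * (s * h ^ 5)" using s h by (simp add: m_def)
        have "k * h ^ 6 * (6 * c1 + p * h) = k * h ^ 6 * p"
          using trans[OF co(3)[of "v s" w, symmetric] E1[of 7]] unfolding wc XX b a by (simp add: algebra_simps eval_nat_numeral)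
        then have q1: "6 * c1 + p * h = p" using k h by simp
        have "k * h ^ 6 * (6 * c2 + 15 * c1\<^sup>2 + 7 * p * h * c1 + P8 s * h\<^sup>2) = k * h ^ 6 * P8 s'"
          using trans[OF co(4)[of "v s" w, symmetric] E1[of 8]] unfolding wc XX b a by (simp add: algebra_simps eval_nat_numeral)
        then have q2: "6 * c2 + 15 * c1\<^sup>2 + 7 * p * h * c1 + P8 s * h\<^sup>2 = P8 s'" using k h by simp
        have "k * h ^ 6 * (6 * c3 + 30 * c1 * c2 + 20 * c1 ^ 3 + p * h * (7 * c2 + 21 * c1\<^sup>2) + 8 * P8 s * h\<^sup>2 * c1 +
            P9 s * h ^ 3) = k * h ^ 6 * P9 s'"
          using trans[OF co(5)[of "v s" w, OF _ XX(1), symmetric] E1[of 9]] unfolding wc XX b a by (simp add: algebra_simps eval_nat_numeral)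
        then have q3: "6 * c3 + 30 * c1 * c2 + 20 * c1 ^ 3 + p * h * (7 * c2 + 21 * c1\<^sup>2) + 8 * P8 s * h\<^sup>2 * c1 +
            P9 s * h ^ 3 = P9 s'" using k h by simp
        have "s * h ^ 5 * (5 * c1) = a' * k"
          using trans[OF co(7)[of "v s" w, symmetric] E2[of 6]] unfolding wc XX by (simp add: algebra_simps eval_nat_numeral)
        then have q4: "5 * c1 = m" unfolding m using s h by simp
        have "s * h ^ 5 * (5 * c2 + 10 * c1\<^sup>2) = a' * k * p"
          using trans[OF co(8)[of "v s" w, symmetric] E2[of 7]] unfolding wc XX by (simp add: algebra_simps eval_nat_numeral)
        then have q5: "5 * c2 + 10 * c1\<^sup>2 = m * p" unfolding m using s h by simp
        have "s * h ^ 5 * (5 * c3 + 20 * c1 * c2 + 10 * c1 ^ 3) = a' * k * P8 s'"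
          using trans[OF co(9)[of "v s" w, symmetric] E2[of 8]] unfolding wc XX by (simp add: algebra_simps eval_nat_numeral)
        then have q6: "5 * c3 + 20 * c1 * c2 + 10 * c1 ^ 3 = m * P8 s'" unfolding m using s h by simp
        note inv = weighted_invariants[OF q1 q2 q3 q4 q5 q6]
        have D: "D s' = h\<^sup>2 * D s" using inv(1) by (simp add: P8_def)
        have E: "E s' = h ^ 3 * E s" using inv(2) by (simp add: P8_def P9_def)
        have key: "D s ^ 3 * (E s')\<^sup>2 = D s' ^ 3 * (E s)\<^sup>2"
          unfolding D E by (simp add: power_mult_distrib power_mult[symmetric])
        consider (1) "D0 = 0" "E0 = 0" | (2) "D0 = 0" "E0 \<noteq> 0" | (3) "D0 \<noteq> 0" "E0 = 0" | (4) "D0 \<noteq> 0" "E0 \<noteq> 0"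
          by blast
        then show "s = s'"
        proof cases
          case 1
          have "s\<^sup>2 * s'\<^sup>2 * (s - s') = 0"
            using key by (simp add: D_def E_def 1 algebra_simps eval_nat_numeral)
          then show ?thesis using s by simp
        next
          case 2
          then have "s ^ 3 = s' ^ 3" using key by (simp add: D_def E_def)
          then show ?thesis using s power_eq_iff_eq_base[of 3 s s'] by simp
        next
          case 3
          then have "s'\<^sup>2 = s\<^sup>2" using key by (simp add: D_def E_def)
          then show ?thesis using s power_eq_iff_eq_base[of 2 s s'] by simp
        next
          case 4
          then have "(1 + s) ^ 3 = (1 + s') ^ 3" using key by (simp add: D_def E_def power_mult_distrib)
          then show ?thesis using s power_eq_iff_eq_base[of 3 "1 + s" "1 + s'"] by simp
        qed
      qed
    qed (simp_all add: smooth_at_monomial_deformation monomial_deformation_def zero_prod_def power_0_left)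
  qed
qed

subsection \<open>The singularities \<open>E\<^bsub>6k\<^esub>\<close> and \<open>E\<^bsub>6k+2\<^esub>\<close>\<close>

text \<open>Both families at once: \<open>(e, p) = (1, 3k - 5)\<close> for the first and \<open>(2, 3k - 4)\<close> for the second.\<close>

definition cubic_form_class :: "nat \<Rightarrow> nat \<Rightarrow> (real \<Rightarrow> real \<times> real) \<Rightarrow> bool" where
  "cubic_form_class e p f \<longleftrightarrow>
     (\<exists>q \<epsilon>. p < q \<and> q \<le> 2 * p \<and> q mod 3 = 2 * e mod 3 \<and> (if odd (q - p) then \<epsilon> = 1 else \<epsilon> = 1 \<or> \<epsilon> = -1) \<and>
        A_equiv f (\<lambda>t. (t ^ 3, t ^ (p + 6) + \<epsilon> * t ^ (q + 6)))) \<or>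
     A_equiv f (\<lambda>t. (t ^ 3, t ^ (p + 6)))"

text \<open>For q = 3(k + m) - 4 and p = 3k - 5 one has q - p = 3m + 1, which is odd for even m, and
  q <= 2p means m <= k - 2.\<close>

lemma has_E6k_iff:
  assumes k: "k \<ge> 2"
  shows "has_E6k k f \<longleftrightarrow> cubic_form_class 1 (3 * k - 5) f"
proof -
  define p where "p = 3 * k - 5"
  have p: "p + 6 = 3 * k + 1" "p + 5 = 3 * k" using k by (auto simp: p_def)
  have form: "E6k_form k m \<epsilon> = (\<lambda>t. (t ^ 3, t ^ (p + 6) + \<epsilon> * t ^ (q + 6)))" if "q + 4 = 3 * (k + m)" for m q \<epsilon>
  proof -
    have q: "q + 6 = 3 * (k + m) + 2" using that by simp
    show ?thesis unfolding E6k_form_def[abs_def] p(1) q by (rule refl)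
  qed
  have sign: "admissible_sign m \<epsilon> \<longleftrightarrow> (if odd (q - p) then \<epsilon> = 1 else \<epsilon> = 1 \<or> \<epsilon> = -1)"
    if "q + 4 = 3 * (k + m)" for m q \<epsilon>
  proof -
    have "q - p = 3 * m + 1" using that p by simp
    then show ?thesis by (simp add: admissible_sign_def)
  qed
  have last: "E6k_last_form k = (\<lambda>t. (t ^ 3, t ^ (p + 6)))" by (simp add: E6k_last_form_def fun_eq_iff p(1))
  show ?thesis unfolding p_def[symmetric]
  proof
    assume "has_E6k k f"
    then consider m \<epsilon> where "m + 2 \<le> k" "admissible_sign m \<epsilon>" "A_equiv f (E6k_form k m \<epsilon>)"
      | "A_equiv f (E6k_last_form k)" unfolding has_E6k_def by blast
    then show "cubic_form_class 1 p f"
    proof cases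
      case 1
      define q where "q = 3 * (k + m) - 4"
      have q: "q + 4 = 3 * (k + m)" using k by (simp add: q_def)
      have pq: "p < q" "q \<le> 2 * p" using q[unfolded distrib_left] p(2) 1(1) by - (linarith+)
      have "q = 2 + 3 * (k + m - 2)" using q k by simp
      then have "q mod 3 = 2 * 1 mod 3" by presburger
      then show ?thesis unfolding cubic_form_class_def
        by (intro disjI1 exI[of _ q] exI[of _ \<epsilon>] conjI pq sign[OF q, THEN iffD1] 1(2) 1(3)[unfolded form[OF q]])
    qed (simp add: cubic_form_class_def last)
  next
    assume "cubic_form_class 1 p f"
    then consider q \<epsilon> where "p < q" "q \<le> 2 * p" "q mod 3 = 2" "if odd (q - p) then \<epsilon> = 1 else \<epsilon> = 1 \<or> \<epsilon> = -1"
        "A_equiv f (\<lambda>t. (t ^ 3, t ^ (p + 6) + \<epsilon> * t ^ (q + 6)))"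
      | "A_equiv f (\<lambda>t. (t ^ 3, t ^ (p + 6)))" unfolding cubic_form_class_def by auto
    then show "has_E6k k f"
    proof cases
      case 1
      define m where "m = q div 3 + 2 - k"
      have "q = 3 * (q div 3) + 2" using mult_div_mod_eq[of 3 q] 1(3) by linarith
      then have m: "q + 4 = 3 * (k + m)" "m + 2 \<le> k" using 1(1,2) p(2) unfolding m_def distrib_left by - (linarith+)
      show ?thesis unfolding has_E6k_def
        by (intro disjI1 exI[of _ m] exI[of _ \<epsilon>] conjI m(2) sign[OF m(1), THEN iffD2] 1(4) 1(5)[folded form[OF m(1)]])
    qed (simp add: has_E6k_def last)
  qed
qed

text \<open>For q = 3(k + m) - 2 and p = 3k - 4 one has q - p = 3m + 2, which is odd for odd m;
  hence the index m + 1 in the sign. Again q <= 2p means m <= k - 2.\<close>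

lemma has_E6k2_iff:
  assumes k: "k \<ge> 2"
  shows "has_E6k2 k f \<longleftrightarrow> cubic_form_class 2 (3 * k - 4) f"
proof -
  define p where "p = 3 * k - 4"
  have p: "p + 6 = 3 * k + 2" "p + 4 = 3 * k" using k by (auto simp: p_def)
  have form: "E6k2_form k m \<epsilon> = (\<lambda>t. (t ^ 3, t ^ (p + 6) + \<epsilon> * t ^ (q + 6)))" if "q + 2 = 3 * (k + m)" for m q \<epsilon>
  proof -
    have q: "q + 6 = 3 * (k + m) + 4" using that by simp
    show ?thesis unfolding E6k2_form_def[abs_def] p(1) q by (rule refl)
  qed
  have sign: "admissible_sign (m + 1) \<epsilon> \<longleftrightarrow> (if odd (q - p) then \<epsilon> = 1 else \<epsilon> = 1 \<or> \<epsilon> = -1)"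
    if "q + 2 = 3 * (k + m)" for m q \<epsilon>
  proof -
    have "q - p = 3 * m + 2" using that p by simp
    then show ?thesis by (simp add: admissible_sign_def)
  qed
  have last: "E6k2_last_form k = (\<lambda>t. (t ^ 3, t ^ (p + 6)))" by (simp add: E6k2_last_form_def fun_eq_iff p(1))
  show ?thesis unfolding p_def[symmetric]
  proof
    assume "has_E6k2 k f"
    then consider m \<epsilon> where "m + 2 \<le> k" "admissible_sign (m + 1) \<epsilon>" "A_equiv f (E6k2_form k m \<epsilon>)"
      | "A_equiv f (E6k2_last_form k)" unfolding has_E6k2_def by blast
    then show "cubic_form_class 2 p f"
    proof cases
      case 1
      define q where "q = 3 * (k + m) - 2"
      have q: "q + 2 = 3 * (k + m)" using k by (simp add: q_def)
      have pq: "p < q" "q \<le> 2 * p" using q[unfolded distrib_left] p(2) 1(1) by - (linarith+)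
      have "q = 1 + 3 * (k + m - 1)" using q k by simp
      then have "q mod 3 = 2 * 2 mod 3" by simp
      then show ?thesis unfolding cubic_form_class_def
        by (intro disjI1 exI[of _ q] exI[of _ \<epsilon>] conjI pq sign[OF q, THEN iffD1] 1(2) 1(3)[unfolded form[OF q]])
    qed (simp add: cubic_form_class_def last)
  next
    assume "cubic_form_class 2 p f"
    then consider q \<epsilon> where "p < q" "q \<le> 2 * p" "q mod 3 = 1" "if odd (q - p) then \<epsilon> = 1 else \<epsilon> = 1 \<or> \<epsilon> = -1"
        "A_equiv f (\<lambda>t. (t ^ 3, t ^ (p + 6) + \<epsilon> * t ^ (q + 6)))"
      | "A_equiv f (\<lambda>t. (t ^ 3, t ^ (p + 6)))" unfolding cubic_form_class_def by auto
    then show "has_E6k2 k f"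
    proof cases
      case 1
      define m where "m = q div 3 + 1 - k"
      have "q = 3 * (q div 3) + 1" using mult_div_mod_eq[of 3 q] 1(3) by linarith
      then have m: "q + 2 = 3 * (k + m)" "m + 2 \<le> k" using 1(1,2) p(2) unfolding m_def distrib_left by - (linarith+)
      show ?thesis unfolding has_E6k2_def
        by (intro disjI1 exI[of _ m] exI[of _ \<epsilon>] conjI m(2) sign[OF m(1), THEN iffD2] 1(4) 1(5)[folded form[OF m(1)]])
    qed (simp add: has_E6k2_def last)
  qed
qed

lemma binomial_germ:
  fixes \<epsilon> :: real
  assumes he: "e = 1 \<or> e = 2" and p: "p mod 3 = e" "p < q"
  defines "W \<equiv> \<lambda>t. t ^ (p + 6) + \<epsilon> * t ^ (q + 6)"
  shows "smooth_germ W" "jet W \<in> res_class e (p + 6) (q + 6)" "jet W $ (p + 6) = 1" "jet W $ (q + 6) = \<epsilon>"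
proof -
  have sm: "smooth_at (\<lambda>t::real. t ^ n) 0" "smooth_at (\<lambda>t::real. \<epsilon> * t ^ n) 0" for n
    by (intro smooth_at_mult smooth_at_power smooth_at_ident smooth_at_const)+
  show "smooth_germ W" unfolding smooth_germ_def W_def using smooth_at_add[OF sm] by (simp add: power_0_left)
  have j: "jet W $ n = (if n = p + 6 then 1 else 0) + \<epsilon> * (if n = q + 6 then 1 else 0)" for n
    unfolding W_def jet_add[OF sm] by (simp add: jet_cmult jet_power jet_ident sm smooth_at_power fps_X_power_nth)
  show "jet W $ (p + 6) = 1" "jet W $ (q + 6) = \<epsilon>" using p(2) by (simp_all add: j)
  show "jet W \<in> res_class e (p + 6) (q + 6)"
  proof (rule res_classI)
    fix i assume "i mod 3 = 2 * e mod 3" "i < q + 6"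
    moreover have "(p + 6) mod 3 \<noteq> 2 * e mod 3" using he p(1) mod3_add6[of p] by auto
    ultimately show "jet W $ i = 0" by (auto simp: j)
  qed (use p(2) in \<open>simp add: j\<close>)
qed

text \<open>The monomial form counts as the binomial with \<epsilon> = 0 and q = 2p, so both
  alternatives are covered by one shape.\<close>

lemma cubic_form_classE:
  assumes he: "e = 1 \<or> e = 2" and p: "0 < p" "p mod 3 = e" and f: "cubic_form_class e p f"
  obtains q W where "p < q" "q \<le> 2 * p" "smooth_germ W" "jet W \<in> res_class e (p + 6) (q + 6)"
    "jet W $ (p + 6) \<noteq> 0" "A_equiv f (\<lambda>t. (t ^ 3, W t))"
proof -
  have "\<exists>q \<epsilon>. p < q \<and> q \<le> 2 * p \<and> A_equiv f (\<lambda>t. (t ^ 3, t ^ (p + 6) + \<epsilon> * t ^ (q + 6)))"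
    using f unfolding cubic_form_class_def
  proof
    assume "A_equiv f (\<lambda>t. (t ^ 3, t ^ (p + 6)))"
    then show ?thesis using p(1) by (intro exI[of _ "2 * p"] exI[of _ 0]) simp
  qed blast
  then obtain q \<epsilon> where q: "p < q" "q \<le> 2 * p" "A_equiv f (\<lambda>t. (t ^ 3, t ^ (p + 6) + \<epsilon> * t ^ (q + 6)))" by blast
  note b = binomial_germ[OF he p(2) q(1), of \<epsilon>]
  show ?thesis by (rule that[OF q(1,2) b(1,2) _ q(3)]) (simp add: b(3))
qed

text \<open>Translation to \<open>theta_coeff\<close>: as 6c = 1 - \<delta> \<theta>_3, the factor
  1/(1/\<delta> - \<theta>_3) is \<delta>/(6c), and the factorials of the series coefficients
  combine to the factor p + 3.\<close>

lemma parallel_cubic_form: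
  fixes \<kappa> :: "real \<Rightarrow> real" and \<delta> :: real
  assumes k: "smooth_at \<kappa> 0" and he: "e = 1 \<or> e = 2" and p: "0 < p" "p mod 3 = e"
    and d: "\<delta> \<noteq> 0" "\<delta> * theta_coeff \<kappa> 3 \<noteq> 1"
  shows "cubic_form_class e p (phi3 \<kappa>) \<Longrightarrow> cubic_form_class e p (parallel3_germ \<kappa> \<delta>)"
    and "\<lbrakk>p < q; q < 2 * p; q mod 3 = 2 * e mod 3; \<epsilon> \<noteq> 0;
      A_equiv (phi3 \<kappa>) (\<lambda>t. (t ^ 3, t ^ (p + 6) + \<epsilon> * t ^ (q + 6)))\<rbrakk> \<Longrightarrow>
      A_equiv (parallel3_germ \<kappa> \<delta>) (phi3 \<kappa>)"
    and "A_equiv (phi3 \<kappa>) (\<lambda>t. (t ^ 3, t ^ (p + 6) + \<epsilon> * t ^ (2 * p + 6))) \<Longrightarrow>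
      A_equiv (parallel3_germ \<kappa> \<delta>) (\<lambda>t. (t ^ 3, t ^ (p + 6))) \<longleftrightarrow>
      1 / (1 / \<delta> - theta_coeff \<kappa> 3) * (2 * (theta_coeff \<kappa> (p + 3))\<^sup>2 / (fact (p + 2) * fact (p + 3))) +
      theta_coeff \<kappa> (2 * p + 3) / fact (2 * p + 3) = 0"
proof -
  define c where "c = (1 - 6 * \<delta> * jet (angle \<kappa>) $ 3) / 6"
  have t3: "theta_coeff \<kappa> 3 = 6 * jet (angle \<kappa>) $ 3" by (simp add: theta_coeff_eq fact_numeral)
  have c: "6 * c = 1 - \<delta> * theta_coeff \<kappa> 3" by (simp add: c_def t3)
  have c0: "c \<noteq> 0" using c d(2) by auto
  note S = parallel_curve_singularity[OF k he p _ _ c_def c0]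
  show "cubic_form_class e p (parallel3_germ \<kappa> \<delta>)" if f: "cubic_form_class e p (phi3 \<kappa>)"
  proof -
    obtain q W where q: "p < q" "q \<le> 2 * p" and W: "smooth_germ W" "jet W \<in> res_class e (p + 6) (q + 6)"
      "jet W $ (p + 6) \<noteq> 0" "A_equiv (phi3 \<kappa>) (\<lambda>t. (t ^ 3, W t))"
      using cubic_form_classE[OF he p f] .
    show ?thesis unfolding cubic_form_class_def by (rule S(1)[OF q W])
  qed
  show "A_equiv (parallel3_germ \<kappa> \<delta>) (phi3 \<kappa>)"
    if q: "p < q" "q < 2 * p" "q mod 3 = 2 * e mod 3" and ep: "\<epsilon> \<noteq> 0"
      and eq: "A_equiv (phi3 \<kappa>) (\<lambda>t. (t ^ 3, t ^ (p + 6) + \<epsilon> * t ^ (q + 6)))"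
  proof -
    note b = binomial_germ[OF he p(2) q(1), of \<epsilon>]
    show ?thesis
      by (rule S(2)[OF q(1) less_imp_le[OF q(2)] b(1,2) _ eq q(3,2)]) (use ep in \<open>simp_all add: b\<close>)
  qed
  show "A_equiv (parallel3_germ \<kappa> \<delta>) (\<lambda>t. (t ^ 3, t ^ (p + 6))) \<longleftrightarrow>
      1 / (1 / \<delta> - theta_coeff \<kappa> 3) * (2 * (theta_coeff \<kappa> (p + 3))\<^sup>2 / (fact (p + 2) * fact (p + 3))) +
      theta_coeff \<kappa> (2 * p + 3) / fact (2 * p + 3) = 0"
    if eq: "A_equiv (phi3 \<kappa>) (\<lambda>t. (t ^ 3, t ^ (p + 6) + \<epsilon> * t ^ (2 * p + 6)))"
  proof -
    have pq: "p < 2 * p" using p(1) by simp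
    note b = binomial_germ[OF he p(2) pq, of \<epsilon>]
    let ?a = "jet (angle \<kappa>) $ (p + 3)"
    have "A_equiv (parallel3_germ \<kappa> \<delta>) (\<lambda>t. (t ^ 3, t ^ (p + 6))) \<longleftrightarrow>
      jet (angle \<kappa>) $ (2 * p + 3) + 2 * real (p + 3) * \<delta> * ?a\<^sup>2 / (6 * c) = 0"
      by (rule S(3)[OF pq order_refl b(1,2) _ eq refl]) (simp add: b)
    moreover have "2 * (theta_coeff \<kappa> (p + 3))\<^sup>2 / (fact (p + 2) * fact (p + 3)) = 2 * real (p + 3) * ?a\<^sup>2"
    proof -
      have "fact (p + 3) = real (p + 3) * fact (p + 2)" by (simp add: numeral_3_eq_3 numeral_2_eq_2)
      then show ?thesis unfolding theta_coeff_eq power_mult_distrib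
        using fact_nonzero[of "p + 2", where 'a = real] by (simp add: power2_eq_square)
    qed
    moreover have "1 / (1 / \<delta> - theta_coeff \<kappa> 3) = \<delta> / (6 * c)"
      unfolding c using d(1) by (simp add: divide_simps mult.commute)
    ultimately show ?thesis by (simp add: theta_coeff_eq add.commute mult_ac)
  qed
qed

text \<open>For p >= 4, which is k >= 3, both bounds in the class of \<theta> are at least 7, so its
  coefficients of degrees 1, 2, 4 and 5 vanish.\<close>

lemma degenerate_parallel_curve:
  fixes \<kappa> :: "real \<Rightarrow> real" and \<delta> :: real
  assumes k: "smooth_at \<kappa> 0" and he: "e = 1 \<or> e = 2" and p: "4 \<le> p" "p mod 3 = e"
    and d: "\<delta> * theta_coeff \<kappa> 3 = 1" and f: "cubic_form_class e p (phi3 \<kappa>)"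
  shows "(\<exists>m\<ge>5. has_multiplicity (parallel3_germ \<kappa> \<delta>) m) \<and> \<not> A_simple (parallel3_germ \<kappa> \<delta>)"
proof -
  have p0: "0 < p" using p(1) by simp
  obtain q W where q: "p < q" "q \<le> 2 * p" and W: "smooth_germ W" "jet W \<in> res_class e (p + 6) (q + 6)"
    "jet W $ (p + 6) \<noteq> 0" "A_equiv (phi3 \<kappa>) (\<lambda>t. (t ^ 3, W t))"
    using cubic_form_classE[OF he p0 p(2) f] .
  note th = angle_of_normal_form[OF k he p0 p(2) q W]
  have z: "jet (angle \<kappa>) $ i = 0" if "i mod 3 = 1 \<or> i mod 3 = 2" "i < 7" for i
  proof -
    have "i mod 3 = e \<or> i mod 3 = 2 * e mod 3" using he that(1) by auto
    then show ?thesis using res_classD[OF th(1), of i] that(2) p(1) q(1) by auto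
  qed
  have d': "\<delta> * (6 * jet (angle \<kappa>) $ 3) = 1" using d by (simp add: theta_coeff_eq fact_numeral)
  have p3: "3 < p + 3" using p0 by simp
  note D = degenerate_parallel_jets[OF k d' z z z z p3 th(2)]
  have "\<exists>m\<ge>5. has_multiplicity (parallel3_germ \<kappa> \<delta>) m" by (rule D(1)) simp_all
  moreover have "\<not> A_simple (parallel3_germ \<kappa> \<delta>)"
    by (rule not_A_simple_multiplicity_6[OF smooth_germ_parallel3[OF k]]) (rule D(2-4); simp)+
  ultimately show ?thesis by blast
qed

theorem theorem5p11:
  fixes k :: nat and \<kappa> :: "real \<Rightarrow> real" and \<delta> :: real
  assumes "k \<ge> 3"
    and "smooth_at \<kappa> 0"
    and "\<delta> \<noteq> 0"
  shows
    "(has_E6k k (phi3 \<kappa>) \<longrightarrow>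
       (\<delta> * theta_coeff \<kappa> 3 \<noteq> 1 \<longrightarrow>
          has_E6k k (parallel3_germ \<kappa> \<delta>) \<and>
          (\<forall>p \<epsilon>. p + 2 \<le> k \<and> admissible_sign p \<epsilon> \<and> A_equiv (phi3 \<kappa>) (E6k_form k p \<epsilon>) \<longrightarrow>
             (p + 2 < k \<longrightarrow> A_equiv (parallel3_germ \<kappa> \<delta>) (phi3 \<kappa>)) \<and>
             (p + 2 = k \<longrightarrow>
               (A_equiv (parallel3_germ \<kappa> \<delta>) (E6k_last_form k) \<longleftrightarrow>
                 (let l1 = k - 1; l2 = k + p - 1 in
                    1 / (1 / \<delta> - theta_coeff \<kappa> 3) *
                      (2 * (theta_coeff \<kappa> (3 * l1 + 1))\<^sup>2 / (fact (3 * l1) * fact (3 * l1 + 1))) +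
                    theta_coeff \<kappa> (3 * l2 + 2) / fact (3 * l2 + 2) = 0))))) \<and>
       (1 / \<delta> = theta_coeff \<kappa> 3 \<longrightarrow>
          (\<exists>m\<ge>5. has_multiplicity (parallel3_germ \<kappa> \<delta>) m) \<and> \<not> A_simple (parallel3_germ \<kappa> \<delta>)))
     \<and>
     (has_E6k2 k (phi3 \<kappa>) \<longrightarrow>
       (\<delta> * theta_coeff \<kappa> 3 \<noteq> 1 \<longrightarrow>
          has_E6k2 k (parallel3_germ \<kappa> \<delta>) \<and>
          (\<forall>p \<epsilon>. p + 2 \<le> k \<and> admissible_sign (p + 1) \<epsilon> \<and> A_equiv (phi3 \<kappa>) (E6k2_form k p \<epsilon>) \<longrightarrow>
             (p + 2 < k \<longrightarrow> A_equiv (parallel3_germ \<kappa> \<delta>) (phi3 \<kappa>)) \<and>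
             (p + 2 = k \<longrightarrow>
               (A_equiv (parallel3_germ \<kappa> \<delta>) (E6k2_last_form k) \<longleftrightarrow>
                 (let l1 = k + p; l2 = k - 1 in
                    theta_coeff \<kappa> (3 * l1 + 1) / fact (3 * l1 + 1) +
                    1 / (1 / \<delta> - theta_coeff \<kappa> 3) *
                      (2 * (theta_coeff \<kappa> (3 * l2 + 2))\<^sup>2 / (fact (3 * l2 + 1) * fact (3 * l2 + 2))) = 0))))) \<and>
       (1 / \<delta> = theta_coeff \<kappa> 3 \<longrightarrow>
          (\<exists>m\<ge>5. has_multiplicity (parallel3_germ \<kappa> \<delta>) m) \<and> \<not> A_simple (parallel3_germ \<kappa> \<delta>)))"
proof -
  have d1: "\<delta> * theta_coeff \<kappa> 3 = 1" if "1 / \<delta> = theta_coeff \<kappa> 3"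
    using that \<open>\<delta> \<noteq> 0\<close> by (metis nonzero_mult_div_cancel_left times_divide_eq_right mult.right_neutral)
  have k2: "k \<ge> 2" using \<open>k \<ge> 3\<close> by simp
  have he: "1 = (1::nat) \<or> 1 = (2::nat)" "2 = (1::nat) \<or> 2 = (2::nat)" by simp_all
  have sign: "\<epsilon> \<noteq> 0" if "admissible_sign m \<epsilon>" for m \<epsilon>
    using that by (auto simp: admissible_sign_def split: if_splits)
  show ?thesis
  proof (intro conjI impI allI; (elim conjE)?)
    assume E: "has_E6k k (phi3 \<kappa>)"
    define p where "p = 3 * k - 5"
    have p: "p + 5 = 3 * k" "4 \<le> p" "0 < p" using \<open>k \<ge> 3\<close> unfolding p_def by - (linarith+)
    have "p = 1 + 3 * (k - 2)" using p(1) k2 by simp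
    then have pm: "p mod 3 = 1" by simp
    have C: "cubic_form_class 1 p (phi3 \<kappa>)" using E unfolding has_E6k_iff[OF k2] p_def .
    {
      assume d: "\<delta> * theta_coeff \<kappa> 3 \<noteq> 1"
      note P = parallel_cubic_form[OF assms(2) he(1) p(3) pm assms(3) d]
      show "has_E6k k (parallel3_germ \<kappa> \<delta>)"
        using P(1)[OF C] unfolding has_E6k_iff[OF k2] p_def .
      fix m \<epsilon>
      assume m: "m + 2 \<le> k" "admissible_sign m \<epsilon>" and eq: "A_equiv (phi3 \<kappa>) (E6k_form k m \<epsilon>)"
      define q where "q = 3 * (k + m) - 4"
      have q: "q + 4 = 3 * (k + m)" "q + 6 = 3 * (k + m) + 2" "p + 6 = 3 * k + 1"
        using p(1) k2 by (auto simp: q_def)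
      have eq': "A_equiv (phi3 \<kappa>) (\<lambda>t. (t ^ 3, t ^ (p + 6) + \<epsilon> * t ^ (q + 6)))"
        using eq unfolding E6k_form_def[abs_def] q(2,3) .
      show "A_equiv (parallel3_germ \<kappa> \<delta>) (phi3 \<kappa>)" if "m + 2 < k"
      proof (rule P(2)[OF _ _ _ sign[OF m(2)] eq'])
        show "p < q" "q < 2 * p" using p(1) q(1)[unfolded distrib_left] that by - (linarith+)
        have "q = 2 + 3 * (k + m - 2)" using q(1) k2 by simp
        then show "q mod 3 = 2 * 1 mod 3" by presburger
      qed
      assume mk: "m + 2 = k"
      \<comment> \<open>The extreme value of m is the case with the quadratic term; there 3 l1 + 1 =
        p + 3 and 3 l2 + 2 = 2p + 3.\<close>
      have qp: "q = 2 * p" using p(1) q(1) mk by simp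
      have i: "3 * (k - 1) = p + 2" "p + 2 + 1 = p + 3" "3 * (k + m - 1) + 2 = 2 * p + 3"
        using p(1) mk by auto
      show "A_equiv (parallel3_germ \<kappa> \<delta>) (E6k_last_form k) \<longleftrightarrow>
        (let l1 = k - 1; l2 = k + m - 1 in
           1 / (1 / \<delta> - theta_coeff \<kappa> 3) *
             (2 * (theta_coeff \<kappa> (3 * l1 + 1))\<^sup>2 / (fact (3 * l1) * fact (3 * l1 + 1))) +
           theta_coeff \<kappa> (3 * l2 + 2) / fact (3 * l2 + 2) = 0)"
        using P(3)[OF eq'[unfolded qp]] unfolding Let_def E6k_last_form_def[abs_def] i q(3) .
    }
    assume d: "1 / \<delta> = theta_coeff \<kappa> 3"
    show "\<exists>m\<ge>5. has_multiplicity (parallel3_germ \<kappa> \<delta>) m" "\<not> A_simple (parallel3_germ \<kappa> \<delta>)"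
      using degenerate_parallel_curve[OF assms(2) he(1) p(2) pm d1[OF d] C] by blast+
  next
    assume E: "has_E6k2 k (phi3 \<kappa>)"
    define p where "p = 3 * k - 4"
    have p: "p + 4 = 3 * k" "4 \<le> p" "0 < p" using \<open>k \<ge> 3\<close> unfolding p_def by - (linarith+)
    have "p = 2 + 3 * (k - 2)" using p(1) k2 by simp
    then have pm: "p mod 3 = 2" by presburger
    have C: "cubic_form_class 2 p (phi3 \<kappa>)" using E unfolding has_E6k2_iff[OF k2] p_def .
    {
      assume d: "\<delta> * theta_coeff \<kappa> 3 \<noteq> 1"
      note P = parallel_cubic_form[OF assms(2) he(2) p(3) pm assms(3) d]
      show "has_E6k2 k (parallel3_germ \<kappa> \<delta>)"
        using P(1)[OF C] unfolding has_E6k2_iff[OF k2] p_def .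
      fix m \<epsilon>
      assume m: "m + 2 \<le> k" "admissible_sign (m + 1) \<epsilon>" and eq: "A_equiv (phi3 \<kappa>) (E6k2_form k m \<epsilon>)"
      define q where "q = 3 * (k + m) - 2"
      have q: "q + 2 = 3 * (k + m)" "q + 6 = 3 * (k + m) + 4" "p + 6 = 3 * k + 2"
        using p(1) k2 by (auto simp: q_def)
      have eq': "A_equiv (phi3 \<kappa>) (\<lambda>t. (t ^ 3, t ^ (p + 6) + \<epsilon> * t ^ (q + 6)))"
        using eq unfolding E6k2_form_def[abs_def] q(2,3) .
      show "A_equiv (parallel3_germ \<kappa> \<delta>) (phi3 \<kappa>)" if "m + 2 < k"
      proof (rule P(2)[OF _ _ _ sign[OF m(2)] eq'])
        show "p < q" "q < 2 * p" using p(1) q(1)[unfolded distrib_left] that by - (linarith+)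
        have "q = 1 + 3 * (k + m - 1)" using q(1) k2 by simp
        then show "q mod 3 = 2 * 2 mod 3" by simp
      qed
      assume mk: "m + 2 = k"
      \<comment> \<open>Now the indices have exchanged roles: 3 l2 + 2 = p + 3 and 3 l1 + 1 = 2p +
        3.\<close>
      have qp: "q = 2 * p" using p(1) q(1) mk by simp
      have i: "3 * (k - 1) + 1 = p + 2" "3 * (k - 1) + 2 = p + 3" "3 * (k + m) + 1 = 2 * p + 3"
        using p(1) mk by auto
      show "A_equiv (parallel3_germ \<kappa> \<delta>) (E6k2_last_form k) \<longleftrightarrow>
        (let l1 = k + m; l2 = k - 1 in
           theta_coeff \<kappa> (3 * l1 + 1) / fact (3 * l1 + 1) +
           1 / (1 / \<delta> - theta_coeff \<kappa> 3) *
             (2 * (theta_coeff \<kappa> (3 * l2 + 2))\<^sup>2 / (fact (3 * l2 + 1) * fact (3 * l2 + 2))) = 0)"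
        using P(3)[OF eq'[unfolded qp]] unfolding Let_def E6k2_last_form_def[abs_def] i q(3)
          add.commute[of "theta_coeff \<kappa> (2 * p + 3) / fact (2 * p + 3)"] .
    }
    assume d: "1 / \<delta> = theta_coeff \<kappa> 3"
    show "\<exists>m\<ge>5. has_multiplicity (parallel3_germ \<kappa> \<delta>) m" "\<not> A_simple (parallel3_germ \<kappa> \<delta>)"
      using degenerate_parallel_curve[OF assms(2) he(2) p(2) pm d1[OF d] C] by blast+
  qed
qed

end
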